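(* Let $0<\varepsilon\le1$. The sesqui-linear form $\mathfrak{t}_\varepsilon$ on $\mathfrak{D}_\varepsilon\times\mathfrak{D}_\varepsilon$ is an ultra-weak time operator of $h_\varepsilon$ (with respect to the decomposition $h_\varepsilon=h_{\rm even}\oplus h_{\rm odd}$ on $L^2(\mathbb{R})=L^2_0\oplus L^2_1$), with symmetric domain $\mathfrak{D}_\varepsilon$ and ultra-weak CCR-domain $\mathfrak{M}_\varepsilon$.
   Context: Work in $L^2(\mathbb{R})$ with inner product $(f,g)=\int\overline{f}g\,dx$ (antilinear in the first slot). Let $q$ be multiplication by $x$, $p=-i\,d/dx$, $t=q^{-1}p$ with $D(t)=\{f\in D(p):pf\in D(q^{-1})\}$, $t^*$ its adjoint. For $0<\varepsilon\le1$ let $h_\varepsilon=\frac12(\varepsilon p^2+q^2)$, self-adjoint on $D(p^2)\cap D(q^2)$. $L^2_0$, $L^2_1$ are the even and odd subspaces; $h_\varepsilon$ is reduced by them, $h_{\rm even}$, $h_{\rm odd}$ being its parts. Define $S_\varepsilon$ in $L^2_0$ by $D(S_\varepsilon)=\{f\in L^2_0\cap\bigcap_{n}D(t^{2n+1}): \sum_{n=0}^N\frac{(-1)^n}{2n+1}(\sqrt\varepsilon t)^{2n+1}f$ converges in norm as $N\to\infty\}$, $S_\varepsilon f=-\varepsilon^{-1/2}\sum_{n\ge0}\frac{(-1)^n}{2n+1}(\sqrt\varepsilon t)^{2n+1}f$; define $S^*_\varepsilon$ (notation only) in $L^2_1$ by the same formulas with $t^*$ and $L^2_1$. Let $\mathfrak{M}_{\varepsilon,0}$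 be the span of $\{x^{2n}e^{-\alpha x^2/(2\sqrt\varepsilon)}: n\ge0,\alpha\in(0,1)\}$, $\mathfrak{M}_{\varepsilon,1}$ the span of $\{x^{2n+1}e^{-\alpha x^2/(2\sqrt\varepsilon)}: n\ge0,\alpha\in(0,1)\}$, $\mathfrak{M}_\varepsilon=\mathfrak{M}_{\varepsilon,0}\oplus\mathfrak{M}_{\varepsilon,1}$, $\mathfrak{D}_\varepsilon=D(S_\varepsilon)\oplus D(S^*_\varepsilon)$. Define $\mathfrak{t}_{\varepsilon,0}[\psi,\phi]=\frac12((\psi,S_\varepsilon\phi)+(S_\varepsilon\psi,\phi))$ on $D(S_\varepsilon)\times D(S_\varepsilon)$, $\mathfrak{t}_{\varepsilon,1}[\psi,\phi]=\frac12((\psi,S^*_\varepsilon\phi)+(S^*_\varepsilon\psi,\phi))$ on $D(S^*_\varepsilon)\times D(S^*_\varepsilon)$, and $\mathfrak{t}_\varepsilon[\psi_0\oplus\psi_1,\phi_0\oplus\phi_1]=\mathfrak{t}_{\varepsilon,0}[\psi_0,\phi_0]+\mathfrak{t}_{\varepsilon,1}[\psi_1,\phi_1]$. Definition (ultra-weak time operator): Let $H$ be self-adjoint on a Hilbert space $\mathcal H$ and $D_1,D_2$ nonzero subspaces. A sesqui-linear form $\mathfrak{t}:D_1\times D_2\to\mathbb{C}$ is an ultra-weak time operator of $H$ with symmetric domain $D$ and ultra-weak CCR-domain $E$, where $D,E$ are nonzero subspaces of $D_1\cap D_2$, if (1) $E\subset D(H)\cap D$; (2) $\overline{\mathfrak{t}[\phi,\psi]}=\mathfrak{t}[\psi,\phi]$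 for all $\phi,\psi\in D$; (3) $HE\subset D_1$ and $\mathfrak{t}[H\phi,\psi]-\overline{\mathfrak{t}[H\psi,\phi]}=-i(\phi,\psi)$ for all $\phi,\psi\in E$. *)

theory Defs
  imports "HOL-Analysis.Analysis"
begin

text \<open>Elements of L^2(R) are represented by functions real => complex that are
  Borel measurable and square integrable; equality in L^2 is equality almost everywhere.
  (Possibly unbounded) operators are represented by their graphs, i.e. relations
  (sets of pairs), closed under a.e. equality of both components.\<close>

definition L2 :: "(real \<Rightarrow> complex) \<Rightarrow> bool" where
  "L2 f \<longleftrightarrow> f \<in> borel_measurable lborel \<and> integrable lborel (\<lambda>x. (cmod (f x))\<^sup>2)"

definition ae_eq :: "(real \<Rightarrow> complex) \<Rightarrow> (real \<Rightarrow> complex) \<Rightarrow> bool" where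
  "ae_eq f g \<longleftrightarrow> (AE x in lborel. f x = g x)"

definition l2_inner :: "(real \<Rightarrow> complex) \<Rightarrow> (real \<Rightarrow> complex) \<Rightarrow> complex" where
  "l2_inner f g = (LINT x|lborel. cnj (f x) * g x)"

definition l2_norm :: "(real \<Rightarrow> complex) \<Rightarrow> real" where
  "l2_norm f = sqrt (LINT x|lborel. (cmod (f x))\<^sup>2)"

definition test_fun :: "(real \<Rightarrow> real) \<Rightarrow> bool" where
  "test_fun \<phi> \<longleftrightarrow> (\<forall>k x. ((deriv ^^ k) \<phi>) differentiable (at x)) \<and> bounded {x. \<phi> x \<noteq> 0}"

text \<open>Momentum operator p = -i d/dx on its natural domain H^1 (weak derivative in L^2):
  p f = g iff the weak derivative of f is i g.\<close>
definition p_op :: "((real \<Rightarrow> complex) \<times> (real \<Rightarrow> complex)) set" where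
  "p_op = {(f, g). L2 f \<and> L2 g \<and>
     (\<forall>\<phi>. test_fun \<phi> \<longrightarrow>
        (LINT x|lborel. f x * complex_of_real (deriv \<phi> x))
          = - \<i> * (LINT x|lborel. g x * complex_of_real (\<phi> x)))}"

definition q_op :: "((real \<Rightarrow> complex) \<times> (real \<Rightarrow> complex)) set" where
  "q_op = {(f, g). L2 f \<and> L2 g \<and> (AE x in lborel. g x = complex_of_real x * f x)}"

definition qinv_op :: "((real \<Rightarrow> complex) \<times> (real \<Rightarrow> complex)) set" where
  "qinv_op = converse q_op"

definition t_op :: "((real \<Rightarrow> complex) \<times> (real \<Rightarrow> complex)) set" where
  "t_op = p_op O qinv_op"

definition adjoint_op ::
  "((real \<Rightarrow> complex) \<times> (real \<Rightarrow> complex)) set \<Rightarrow> ((real \<Rightarrow> complex) \<times> (real \<Rightarrow> complex)) set" where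
  "adjoint_op A = {(u, v). L2 u \<and> L2 v \<and> (\<forall>(f, g) \<in> A. l2_inner u g = l2_inner v f)}"

definition L2_even :: "(real \<Rightarrow> complex) \<Rightarrow> bool" where
  "L2_even f \<longleftrightarrow> L2 f \<and> (AE x in lborel. f (- x) = f x)"

definition L2_odd :: "(real \<Rightarrow> complex) \<Rightarrow> bool" where
  "L2_odd f \<longleftrightarrow> L2 f \<and> (AE x in lborel. f (- x) = - f x)"

definition even_part :: "(real \<Rightarrow> complex) \<Rightarrow> real \<Rightarrow> complex" where
  "even_part f = (\<lambda>x. (f x + f (- x)) / 2)"

definition odd_part :: "(real \<Rightarrow> complex) \<Rightarrow> real \<Rightarrow> complex" where
  "odd_part f = (\<lambda>x. (f x - f (- x)) / 2)"

definition S_gen :: "real \<Rightarrow> ((real \<Rightarrow> complex) \<times> (real \<Rightarrow> complex)) set \<Rightarrow>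
    ((real \<Rightarrow> complex) \<Rightarrow> bool) \<Rightarrow> ((real \<Rightarrow> complex) \<times> (real \<Rightarrow> complex)) set" where
  "S_gen \<epsilon> T P = {(f, g). P f \<and>
     (\<exists>u L. (\<forall>n. (f, u n) \<in> T ^^ (2 * n + 1)) \<and> L2 L \<and>
        ((\<lambda>N. l2_norm (\<lambda>x. (\<Sum>n\<le>N. complex_of_real ((-1) ^ n / real (2 * n + 1) * sqrt \<epsilon> ^ (2 * n + 1)) * u n x) - L x))
           \<longlonglongrightarrow> 0) \<and>
        L2 g \<and> ae_eq g (\<lambda>x. - complex_of_real (1 / sqrt \<epsilon>) * L x))}"

definition S_eps :: "real \<Rightarrow> ((real \<Rightarrow> complex) \<times> (real \<Rightarrow> complex)) set" where
  "S_eps \<epsilon> = S_gen \<epsilon> t_op L2_even"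

definition S_star_eps :: "real \<Rightarrow> ((real \<Rightarrow> complex) \<times> (real \<Rightarrow> complex)) set" where
  "S_star_eps \<epsilon> = S_gen \<epsilon> (adjoint_op t_op) L2_odd"

text \<open>Applying an operator given by its graph (a representative of the image class).\<close>
definition op_app :: "((real \<Rightarrow> complex) \<times> (real \<Rightarrow> complex)) set \<Rightarrow> (real \<Rightarrow> complex) \<Rightarrow> real \<Rightarrow> complex" where
  "op_app A f = (SOME g. (f, g) \<in> A)"

definition h_op :: "real \<Rightarrow> ((real \<Rightarrow> complex) \<times> (real \<Rightarrow> complex)) set" where
  "h_op \<epsilon> = {(f, g). \<exists>a b. (f, a) \<in> p_op O p_op \<and> (f, b) \<in> q_op O q_op \<and> L2 g \<and>
      ae_eq g (\<lambda>x. (complex_of_real \<epsilon> * a x + b x) / 2)}"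

text \<open>The domain D_eps = D(S_eps) (+) D(S*_eps), as a subset of L^2 = L^2_0 (+) L^2_1.\<close>
definition frakD :: "real \<Rightarrow> (real \<Rightarrow> complex) set" where
  "frakD \<epsilon> = {\<psi>. L2 \<psi> \<and> even_part \<psi> \<in> Domain (S_eps \<epsilon>) \<and> odd_part \<psi> \<in> Domain (S_star_eps \<epsilon>)}"

definition frakM0 :: "real \<Rightarrow> (real \<Rightarrow> complex) set" where
  "frakM0 \<epsilon> = {f. \<exists>F c. finite F \<and> (\<forall>(n, \<alpha>) \<in> F. 0 < \<alpha> \<and> \<alpha> < 1) \<and>
      f = (\<lambda>x. \<Sum>(n, \<alpha>) \<in> F. c (n, \<alpha>) * complex_of_real (x ^ (2 * n) * exp (- \<alpha> * x\<^sup>2 / (2 * sqrt \<epsilon>))))}"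

definition frakM1 :: "real \<Rightarrow> (real \<Rightarrow> complex) set" where
  "frakM1 \<epsilon> = {f. \<exists>F c. finite F \<and> (\<forall>(n, \<alpha>) \<in> F. 0 < \<alpha> \<and> \<alpha> < 1) \<and>
      f = (\<lambda>x. \<Sum>(n, \<alpha>) \<in> F. c (n, \<alpha>) * complex_of_real (x ^ (2 * n + 1) * exp (- \<alpha> * x\<^sup>2 / (2 * sqrt \<epsilon>))))}"

definition frakM :: "real \<Rightarrow> (real \<Rightarrow> complex) set" where
  "frakM \<epsilon> = {f. \<exists>f0 f1. f0 \<in> frakM0 \<epsilon> \<and> f1 \<in> frakM1 \<epsilon> \<and> f = (\<lambda>x. f0 x + f1 x)}"

definition t_form :: "real \<Rightarrow> (real \<Rightarrow> complex) \<Rightarrow> (real \<Rightarrow> complex) \<Rightarrow> complex" where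
  "t_form \<epsilon> \<psi> \<phi> =
     (l2_inner (even_part \<psi>) (op_app (S_eps \<epsilon>) (even_part \<phi>))
       + l2_inner (op_app (S_eps \<epsilon>) (even_part \<psi>)) (even_part \<phi>)) / 2
   + (l2_inner (odd_part \<psi>) (op_app (S_star_eps \<epsilon>) (odd_part \<phi>))
       + l2_inner (op_app (S_star_eps \<epsilon>) (odd_part \<psi>)) (odd_part \<phi>)) / 2"

definition nz_subspace :: "(real \<Rightarrow> complex) set \<Rightarrow> bool" where
  "nz_subspace X \<longleftrightarrow> (\<forall>f \<in> X. L2 f) \<and> (\<lambda>x. 0) \<in> X \<and>
     (\<forall>f \<in> X. \<forall>g \<in> X. (\<lambda>x. f x + g x) \<in> X) \<and>
     (\<forall>c. \<forall>f \<in> X. (\<lambda>x. c * f x) \<in> X) \<and>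
     (\<exists>f \<in> X. \<not> ae_eq f (\<lambda>x. 0))"

definition sesquilinear_on :: "(real \<Rightarrow> complex) set \<Rightarrow> (real \<Rightarrow> complex) set \<Rightarrow>
    ((real \<Rightarrow> complex) \<Rightarrow> (real \<Rightarrow> complex) \<Rightarrow> complex) \<Rightarrow> bool" where
  "sesquilinear_on D1 D2 tf \<longleftrightarrow>
     (\<forall>\<phi> \<in> D1. \<forall>\<phi>' \<in> D1. \<forall>\<psi> \<in> D2. tf (\<lambda>x. \<phi> x + \<phi>' x) \<psi> = tf \<phi> \<psi> + tf \<phi>' \<psi>) \<and>
     (\<forall>c. \<forall>\<phi> \<in> D1. \<forall>\<psi> \<in> D2. tf (\<lambda>x. c * \<phi> x) \<psi> = cnj c * tf \<phi> \<psi>) \<and>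
     (\<forall>\<phi> \<in> D1. \<forall>\<psi> \<in> D2. \<forall>\<psi>' \<in> D2. tf \<phi> (\<lambda>x. \<psi> x + \<psi>' x) = tf \<phi> \<psi> + tf \<phi> \<psi>') \<and>
     (\<forall>c. \<forall>\<phi> \<in> D1. \<forall>\<psi> \<in> D2. tf \<phi> (\<lambda>x. c * \<psi> x) = c * tf \<phi> \<psi>)"

text \<open>Ultra-weak time operator of H (self-adjoint, given by its graph) in L^2(R):
  the form tf on D1 x D2 with symmetric domain D and ultra-weak CCR-domain E.\<close>
definition ultra_weak_time_op ::
  "((real \<Rightarrow> complex) \<times> (real \<Rightarrow> complex)) set \<Rightarrow> (real \<Rightarrow> complex) set \<Rightarrow> (real \<Rightarrow> complex) set \<Rightarrow>
   ((real \<Rightarrow> complex) \<Rightarrow> (real \<Rightarrow> complex) \<Rightarrow> complex) \<Rightarrow>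
   (real \<Rightarrow> complex) set \<Rightarrow> (real \<Rightarrow> complex) set \<Rightarrow> bool" where
  "ultra_weak_time_op H D1 D2 tf D E \<longleftrightarrow>
     nz_subspace D1 \<and> nz_subspace D2 \<and> sesquilinear_on D1 D2 tf \<and>
     nz_subspace D \<and> nz_subspace E \<and> D \<subseteq> D1 \<inter> D2 \<and> E \<subseteq> D1 \<inter> D2 \<and>
     E \<subseteq> Domain H \<inter> D \<and>
     (\<forall>\<phi> \<in> D. \<forall>\<psi> \<in> D. cnj (tf \<phi> \<psi>) = tf \<psi> \<phi>) \<and>
     (\<forall>\<phi> \<in> E. \<forall>g. (\<phi>, g) \<in> H \<longrightarrow> g \<in> D1) \<and>
     (\<forall>\<phi> \<in> E. \<forall>\<psi> \<in> E. \<forall>g k. (\<phi>, g) \<in> H \<longrightarrow> (\<psi>, k) \<in> H \<longrightarrow>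
        tf g \<psi> - cnj (tf k \<phi>) = - \<i> * l2_inner \<phi> \<psi>)"

end

theory Submission
  imports Defs "HOL-Probability.Distributions"
begin

text \<open>With \<open>u = x\<^sup>2 / (2 \<surd>\<epsilon>)\<close>, every element of \<open>\<MM>\<^sub>\<epsilon>\<close> is \<open>x\<^sup>\<sigma> g(u)\<close> with \<open>g\<close> in the span
  of \<open>u\<^sup>k e\<^sup>-\<^sup>\<alpha>\<^sup>u\<close> (\<open>\<sigma> = 0\<close> even, \<open>\<sigma> = 1\<close> odd). In this picture \<open>\<surd>\<epsilon> t\<close> on the even and \<open>\<surd>\<epsilon> t\<^sup>*\<close> on
  the odd part are both \<open>-\<i> d/du\<close>, so \<open>S\<close> is \<open>\<i>/\<surd>\<epsilon>\<close> times \<open>artanh(d/du)\<close>, and \<open>h\<^sub>\<epsilon>\<close> becomes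
  \<open>\<surd>\<epsilon> (u - u d\<^sup>2/du\<^sup>2 - (\<sigma> + 1/2) d/du)\<close>. The commutator of the \<open>N\<close>-th partial sum of \<open>artanh(d/du)\<close>
  with \<open>h\<^sub>\<epsilon>\<close> telescopes to \<open>\<surd>\<epsilon> (1 - (d/du)\<^sup>2\<^sup>N\<^sup>+\<^sup>2)\<close>, whose second term vanishes in the limit because
  \<open>d/du\<close> has spectral radius below 1 on each \<open>g\<close>. Symmetry of \<open>h\<^sub>\<epsilon>\<close> then turns this commutator into the
  weak CCR. Well-definedness of the form rests on \<open>t\<close> and \<open>t\<^sup>*\<close> being single-valued almost everywhere,
  which follows from testing against the bumps \<open>exp(-1/(n (x - a)(b - x)))\<close>; these increase to the
  indicator of \<open>(a, b)\<close> and lie in the domain of \<open>t\<close> when \<open>0 \<notin> [a, b]\<close>.\<close>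

section \<open>Smooth bump functions\<close>

text \<open>Write D = d/du. The arctangent series becomes that of artanh because (-\<i>)^(2n+1) =
  -\<i> (-1)^n, so the alternating signs cancel. The telescoping comes from [D^m, h] = sqrt
  \<epsilon> m (D^(m-1) - D^(m+1)), whose factor m cancels the Taylor weight 1/m. The spectral
  radius is below 1 because D has the single eigenvalue -\<alpha> on the span of u^j exp(-\<alpha>
  u), j \<le> k. Three obstacles shape the rest. Operators are relations between functions and
  \<open>op_app\<close> picks representatives by choice, so linearity, invariance and uniqueness are
  carried up to null sets, bundled in \<open>linear_ae_op\<close>. The adjoint of
  \<open>t_op\<close> is known only through pairings with the domain of \<open>t_op\<close>; its
  action on x g(u) is verified by testing a weak derivative against Gaussian weights, which lack
  compact support, so the test class of \<open>p_op\<close> has to be enlarged by cutoffs. Finally,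
  \<open>h_op\<close> is never applied to the limit of the series: symmetry moves it onto the
  partial sums, which stay in the span.\<close>

text \<open>Allowing the division by \<open>y ^ k\<close> makes the family closed under
  differentiation up to linear combinations, so that one formula, \<open>flat_deriv\<close>, covers
  every order.\<close>

definition flat :: "nat \<Rightarrow> real \<Rightarrow> real" where
  "flat k y = (if y \<le> 0 then 0 else exp (- 1 / y) / y ^ k)"

lemma power_div_fact_le_exp:
  fixes s :: real
  assumes "0 \<le> s"
  shows "s ^ m / fact m \<le> exp s"
proof -
  have "(\<Sum>n\<in>{m}. s ^ n /\<^sub>R fact n) \<le> (\<Sum>n. s ^ n /\<^sub>R fact n)"
    by (rule sum_le_suminf[OF summable_exp_generic]) (use assms in auto)
  then show ?thesis by (simp add: exp_def field_simps)
qed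

lemma flat_nonneg: "0 \<le> flat k y"
  by (simp add: flat_def)

text \<open>A single term of the series of \<open>exp (1 / y)\<close> beats the pole of order k and
  leaves a factor \<open>y ^ m\<close>. It is used with m = 2 for the difference quotient at 0 and
  with m = 0 for boundedness.\<close>

lemma flat_le_power:
  assumes "0 < y"
  shows "flat k y \<le> fact (k + m) * y ^ m"
proof -
  have "(1 / y) ^ (k + m) / fact (k + m) \<le> exp (1 / y)"
    by (rule power_div_fact_le_exp) (use assms in auto)
  then have "1 \<le> exp (1 / y) * (fact (k + m) * y ^ (k + m))"
    using assms by (simp add: field_simps power_divide)
  then have "exp (- 1 / y) \<le> exp (- 1 / y) * (exp (1 / y) * (fact (k + m) * y ^ (k + m)))"
    by (metis exp_gt_zero mult.right_neutral mult_left_mono less_imp_le)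
  also have "\<dots> = fact (k + m) * y ^ (k + m)"
    by (simp add: mult.assoc[symmetric] exp_add[symmetric])
  finally show ?thesis using assms by (simp add: flat_def field_simps power_add)
qed

lemma flat_deriv:
  "(flat k has_real_derivative flat (k + 2) y - real k * flat (k + 1) y) (at y)"
proof -
  consider "y < 0" | "y > 0" | "y = 0" by linarith
  then show ?thesis
  proof cases
    case 1
    have "((\<lambda>_. 0) has_real_derivative 0) (at y)" by simp
    then have "(flat k has_real_derivative 0) (at y)"
      by (rule has_field_derivative_transform_within_open[where S = "{..<0}"])
        (use 1 in \<open>auto simp: flat_def\<close>)
    then show ?thesis using 1 by (simp add: flat_def)
  next
    case 2
    have "((\<lambda>y. exp (- 1 / y) / y ^ k) has_real_derivative
        flat (k + 2) y - real k * flat (k + 1) y) (at y)"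
    proof (cases k)
      case 0
      then show ?thesis using 2
        by (auto intro!: derivative_eq_intros simp: flat_def field_simps power2_eq_square)
    next
      case (Suc j)
      have "((\<lambda>y. exp (- 1 / y) / y ^ k) has_real_derivative
          (exp (- 1 / y) * (1 / y\<^sup>2) * y ^ k - exp (- 1 / y) * (real k * y ^ (k - 1))) / (y ^ k * y ^ k)) (at y)"
        using 2 by (auto intro!: derivative_eq_intros simp: power2_eq_square)
      moreover have "(exp (- 1 / y) * (1 / y\<^sup>2) * y ^ k - exp (- 1 / y) * (real k * y ^ (k - 1))) / (y ^ k * y ^ k)
          = flat (k + 2) y - real k * flat (k + 1) y"
        using 2 Suc by (simp add: flat_def divide_simps power_add power2_eq_square) (simp add: algebra_simps)
      ultimately show ?thesis by simp
    qed
    then show ?thesis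
      by (rule has_field_derivative_transform_within_open[where S = "{0<..}"])
        (use 2 in \<open>auto simp: flat_def\<close>)
  next
    case 3
    have "(\<lambda>h. (flat k (0 + h) - flat k 0) / h) \<midarrow>0\<rightarrow> 0"
    proof (rule Lim_null_comparison)
      show "\<forall>\<^sub>F h in at 0. norm ((flat k (0 + h) - flat k 0) / h) \<le> fact (k + 2) * \<bar>h\<bar>"
      proof (rule always_eventually, rule allI)
        fix h :: real
        show "norm ((flat k (0 + h) - flat k 0) / h) \<le> fact (k + 2) * \<bar>h\<bar>"
        proof (cases "0 < h")
          case True
          then show ?thesis using flat_le_power[of h k 2] flat_nonneg[of k h]
            by (simp add: flat_def[of k 0] field_simps power2_eq_square)
        next
          case False
          then have "flat k h = 0" "flat k 0 = 0" by (auto simp: flat_def)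
          then show ?thesis by (auto intro!: mult_nonneg_nonneg simp del: fact_Suc)
        qed
      qed
      show "((\<lambda>h. fact (k + 2) * \<bar>h\<bar>) \<longlongrightarrow> (0::real)) (at 0)"
        by (auto intro!: tendsto_eq_intros)
    qed
    then show ?thesis using 3 by (simp add: DERIV_def flat_def)
  qed
qed

lemma flat_0_le_1: "flat 0 y \<le> 1"
  by (simp add: flat_def)

lemma flat_2_le_2: "flat 2 y \<le> 2"
  using flat_le_power[of y 2 0] by (cases "0 < y") (simp_all add: flat_def fact_2)

text \<open>\<open>test_fun\<close> asks for differentiability of every iterated derivative. A class
  of functions whose derivatives stay in the class gives this by induction; \<open>flat_comp\<close>
  supplies the bumps and \<open>exp_comp\<close> the Gaussian weights.\<close>

inductive smooth_alg :: "(real \<Rightarrow> real) \<Rightarrow> bool" where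
  const: "smooth_alg (\<lambda>x. c)"
| ident: "smooth_alg (\<lambda>x. x)"
| plus: "smooth_alg f \<Longrightarrow> smooth_alg g \<Longrightarrow> smooth_alg (\<lambda>x. f x + g x)"
| times: "smooth_alg f \<Longrightarrow> smooth_alg g \<Longrightarrow> smooth_alg (\<lambda>x. f x * g x)"
| exp_comp: "smooth_alg f \<Longrightarrow> smooth_alg (\<lambda>x. exp (f x))"
| flat_comp: "smooth_alg f \<Longrightarrow> smooth_alg (\<lambda>x. flat k (f x))"

lemma smooth_alg_power: "smooth_alg f \<Longrightarrow> smooth_alg (\<lambda>x. f x ^ n)"
  by (induction n) (auto intro: smooth_alg.intros)

lemma smooth_alg_diff: "smooth_alg f \<Longrightarrow> smooth_alg g \<Longrightarrow> smooth_alg (\<lambda>x. f x - g x)"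
  using plus[OF _ times[OF const[of "-1"]], of f g] by simp

lemma smooth_alg_has_derivative:
  assumes "smooth_alg f"
  shows "\<exists>f'. smooth_alg f' \<and> (\<forall>x. (f has_real_derivative f' x) (at x))"
  using assms
proof induction
  case (const c)
  show ?case by (rule exI[of _ "\<lambda>x. 0"]) (auto intro: smooth_alg.const)
next
  case ident
  show ?case by (rule exI[of _ "\<lambda>x. 1"]) (auto intro: smooth_alg.const)
next
  case (plus f g)
  then obtain f' g' where "smooth_alg f'" "\<forall>x. (f has_real_derivative f' x) (at x)"
    "smooth_alg g'" "\<forall>x. (g has_real_derivative g' x) (at x)" by blast
  then show ?case
    by (intro exI[of _ "\<lambda>x. f' x + g' x"]) (auto intro!: smooth_alg.plus derivative_eq_intros)
next
  case (times f g)
  then obtain f' g' where "smooth_alg f'" "\<forall>x. (f has_real_derivative f' x) (at x)"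
    "smooth_alg g'" "\<forall>x. (g has_real_derivative g' x) (at x)" by blast
  then show ?case using times
    by (intro exI[of _ "\<lambda>x. f' x * g x + f x * g' x"])
      (auto intro!: smooth_alg.plus smooth_alg.times derivative_eq_intros)
next
  case (exp_comp f)
  then obtain f' where "smooth_alg f'" "\<forall>x. (f has_real_derivative f' x) (at x)" by blast
  then show ?case using exp_comp
    by (intro exI[of _ "\<lambda>x. exp (f x) * f' x"])
      (auto intro!: smooth_alg.times smooth_alg.exp_comp derivative_eq_intros)
next
  case (flat_comp f k)
  then obtain f' where f': "smooth_alg f'" "\<forall>x. (f has_real_derivative f' x) (at x)" by blast
  have "((\<lambda>x. flat k (f x)) has_real_derivative
      (flat (k + 2) (f x) - real k * flat (k + 1) (f x)) * f' x) (at x)" for x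
    using DERIV_chain2[OF flat_deriv, of f "f' x" x UNIV k] f'(2) by blast
  then show ?case using f'(1) flat_comp
    by (intro exI[of _ "\<lambda>x. (flat (k + 2) (f x) - real k * flat (k + 1) (f x)) * f' x"])
      (auto intro!: smooth_alg.times smooth_alg_diff smooth_alg.const smooth_alg.flat_comp)
qed

lemma smooth_alg_deriv: "smooth_alg f \<Longrightarrow> smooth_alg (deriv f)"
  using smooth_alg_has_derivative[of f] by (metis DERIV_imp_deriv ext)

lemma smooth_alg_DERIV: "smooth_alg f \<Longrightarrow> (f has_real_derivative deriv f x) (at x)"
  using smooth_alg_has_derivative[of f] by (metis DERIV_imp_deriv)

lemma smooth_alg_continuous: "smooth_alg f \<Longrightarrow> continuous_on A f"
  by (meson smooth_alg_DERIV DERIV_isCont continuous_at_imp_continuous_on)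

lemma test_fun_smooth_alg:
  assumes "smooth_alg f" "bounded {x. f x \<noteq> 0}"
  shows "test_fun f"
proof -
  have "smooth_alg ((deriv ^^ k) f)" for k
    by (induction k) (auto simp: assms smooth_alg_deriv)
  then show ?thesis unfolding test_fun_def
    using assms(2) real_differentiable_def smooth_alg_DERIV by blast
qed

text \<open>The scale n drives the values inside (a, b) to 1. With n = 1 and growing symmetric
  intervals the same function serves as a cutoff in \<open>p_op_smooth_mult\<close>.\<close>

definition bump :: "real \<Rightarrow> real \<Rightarrow> real \<Rightarrow> real \<Rightarrow> real" where
  "bump n a b x = flat 0 (n * ((x - a) * (b - x)))"

lemma smooth_alg_bump: "smooth_alg (bump n a b)"
  unfolding bump_def by (intro flat_comp times smooth_alg_diff const ident)

lemma bump_deriv: "(bump n a b has_real_derivative flat 2 (n * ((x - a) * (b - x))) * (n * (a + b - 2 * x))) (at x)"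
proof -
  have "((\<lambda>x. n * ((x - a) * (b - x))) has_real_derivative n * (a + b - 2 * x)) (at x)"
    by (auto intro!: derivative_eq_intros simp: algebra_simps)
  from DERIV_chain2[OF flat_deriv[of 0] this] show ?thesis
    by (simp add: bump_def[abs_def] numeral_2_eq_2)
qed

lemma deriv_bump: "deriv (bump n a b) x = flat 2 (n * ((x - a) * (b - x))) * (n * (a + b - 2 * x))"
  by (rule DERIV_imp_deriv[OF bump_deriv])

lemma prod_nonpos_outside:
  fixes a b x :: real
  assumes "a \<le> b" "x \<notin> {a<..<b}" "0 < n" shows "n * ((x - a) * (b - x)) \<le> 0"
  using assms by (auto simp: mult_le_0_iff)

lemma bump_outside: "a \<le> b \<Longrightarrow> 0 < n \<Longrightarrow> x \<notin> {a<..<b} \<Longrightarrow> bump n a b x = 0"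
  unfolding bump_def flat_def using prod_nonpos_outside[of a b x n] by simp

lemma deriv_bump_outside: "a \<le> b \<Longrightarrow> 0 < n \<Longrightarrow> x \<notin> {a<..<b} \<Longrightarrow> deriv (bump n a b) x = 0"
  unfolding deriv_bump flat_def using prod_nonpos_outside[of a b x n] by simp

lemma bump_bounds: "0 \<le> bump n a b x" "bump n a b x \<le> 1"
  unfolding bump_def by (auto simp: flat_nonneg flat_0_le_1)

lemma test_fun_bump:
  assumes "a \<le> b" "0 < n"
  shows "test_fun (bump n a b)"
proof (rule test_fun_smooth_alg[OF smooth_alg_bump])
  have "{x. bump n a b x \<noteq> 0} \<subseteq> {a<..<b}"
    using bump_outside[OF assms] by blast
  then show "bounded {x. bump n a b x \<noteq> 0}"
    by (rule bounded_subset[rotated]) simp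
qed

lemma bump_tendsto_indicator:
  assumes "a \<le> b"
  shows "(\<lambda>n. bump (real (Suc n)) a b x) \<longlonglongrightarrow> indicator {a<..<b} x"
proof (cases "x \<in> {a<..<b}")
  case True
  then have p: "0 < (x - a) * (b - x)" by simp
  have "(\<lambda>n. exp (- (1 / ((x - a) * (b - x))) * inverse (real (Suc n)))) \<longlonglongrightarrow> exp (- (1 / ((x - a) * (b - x))) * 0)"
    by (intro tendsto_exp tendsto_mult tendsto_const LIMSEQ_inverse_real_of_nat)
  moreover have "bump (real (Suc n)) a b x = exp (- (1 / ((x - a) * (b - x))) * inverse (real (Suc n)))" for n
  proof -
    have "0 < real (Suc n) * ((x - a) * (b - x))" by (rule mult_pos_pos[OF _ p]) simp
    then have "bump (real (Suc n)) a b x = exp (- 1 / (real (Suc n) * ((x - a) * (b - x))))"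
      unfolding bump_def flat_def by (simp only: not_le[symmetric] if_False power_0 div_by_1)
    also have "- 1 / (real (Suc n) * ((x - a) * (b - x))) = - (1 / ((x - a) * (b - x))) * inverse (real (Suc n))"
      by (simp only: divide_inverse inverse_mult_distrib mult_1_left mult_minus_left mult.commute)
    finally show ?thesis .
  qed
  ultimately show ?thesis using True by simp
qed (use bump_outside[OF assms] in simp)

section \<open>Square integrable functions\<close>

lemma L2D:
  assumes "L2 f"
  shows "f \<in> borel_measurable borel" "integrable lborel (\<lambda>x. (cmod (f x))\<^sup>2)"
  using assms by (auto simp: L2_def)

lemma L2_dominated:
  assumes "f \<in> borel_measurable borel" "L2 g" "\<And>x. cmod (f x) \<le> cmod (g x)"
  shows "L2 f"
  unfolding L2_def
proof
  show "integrable lborel (\<lambda>x. (cmod (f x))\<^sup>2)"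
    by (rule Bochner_Integration.integrable_bound[OF L2D(2)[OF assms(2)]])
      (use assms in \<open>auto intro!: power_mono\<close>)
qed (use assms in simp)

lemma integrable_L2_mult:
  assumes "L2 f" "L2 g"
  shows "integrable lborel (\<lambda>x. f x * g x)"
proof (rule Bochner_Integration.integrable_bound)
  show "integrable lborel (\<lambda>x. (cmod (f x))\<^sup>2 + (cmod (g x))\<^sup>2)"
    using assms by (auto simp: L2_def)
  have "cmod (f x) * cmod (g x) \<le> (cmod (f x))\<^sup>2 + (cmod (g x))\<^sup>2" for x
  proof -
    have "0 \<le> cmod (f x) * cmod (g x)" by simp
    then show ?thesis
      using sum_squares_bound[of "cmod (f x)" "cmod (g x)"] by linarith
  qed
  then show "AE x in lborel. norm (f x * g x) \<le> norm ((cmod (f x))\<^sup>2 + (cmod (g x))\<^sup>2)"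
    by (simp add: norm_mult)
  show "(\<lambda>x. f x * g x) \<in> borel_measurable lborel"
    using assms by (auto simp: L2_def)
qed

lemma cmod_add_square_le: "(cmod (a + b))\<^sup>2 \<le> 2 * (cmod a)\<^sup>2 + 2 * (cmod b)\<^sup>2"
proof -
  have "(cmod (a + b))\<^sup>2 \<le> (cmod a + cmod b)\<^sup>2"
    by (intro power_mono norm_triangle_ineq norm_ge_zero)
  then show ?thesis
    using sum_squares_bound[of "cmod a" "cmod b"] by (simp add: power2_sum)
qed

lemma L2_cmult: "L2 f \<Longrightarrow> L2 (\<lambda>x. c * f x)"
  by (auto simp: L2_def norm_mult power_mult_distrib)

lemma L2_add:
  assumes "L2 f" "L2 g"
  shows "L2 (\<lambda>x. f x + g x)"
  unfolding L2_def
proof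
  show "integrable lborel (\<lambda>x. (cmod (f x + g x))\<^sup>2)"
  proof (rule Bochner_Integration.integrable_bound)
    show "integrable lborel (\<lambda>x. 2 * (cmod (f x))\<^sup>2 + 2 * (cmod (g x))\<^sup>2)"
      using assms by (auto simp: L2_def)
    show "AE x in lborel. norm ((cmod (f x + g x))\<^sup>2) \<le> norm (2 * (cmod (f x))\<^sup>2 + 2 * (cmod (g x))\<^sup>2)"
      using cmod_add_square_le by (auto intro!: always_eventually simp del: power_abs)
  qed (use assms in \<open>auto simp: L2_def\<close>)
qed (use assms in \<open>auto simp: L2_def\<close>)

lemma L2_uminus: "L2 f \<Longrightarrow> L2 (\<lambda>x. - f x)"
  by (auto simp: L2_def)

lemma L2_diff: "L2 f \<Longrightarrow> L2 g \<Longrightarrow> L2 (\<lambda>x. f x - g x)"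
  using L2_add[OF _ L2_uminus] by simp

lemma L2_zero: "L2 (\<lambda>x. 0)"
  by (simp add: L2_def)

lemma L2_sum: "(\<And>i. i \<in> I \<Longrightarrow> L2 (f i)) \<Longrightarrow> L2 (\<lambda>x. \<Sum>i\<in>I. f i x)"
  by (induction I rule: infinite_finite_induct) (auto intro: L2_zero L2_add)

lemma L2_cnj:
  assumes "L2 f"
  shows "L2 (\<lambda>x. cnj (f x))"
proof (rule L2_dominated[OF _ assms])
  show "(\<lambda>x. cnj (f x)) \<in> borel_measurable borel"
    by (rule measurable_compose[OF L2D(1)[OF assms]])
      (intro borel_measurable_continuous_onI continuous_intros)
qed simp

lemma L2_reflect:
  assumes "L2 f"
  shows "L2 (\<lambda>x. f (- x))"
  using assms lborel_integrable_real_affine[of "\<lambda>x. (cmod (f x))\<^sup>2" "-1" 0]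
  by (auto simp: L2_def intro: measurable_compose[rotated])

lemma L2_bounded_support:
  assumes "f \<in> borel_measurable borel" "\<And>x. x \<notin> {a..b} \<Longrightarrow> f x = 0" "\<And>x. cmod (f x) \<le> B"
  shows "L2 f"
proof (rule L2_dominated[OF assms(1)])
  show "L2 (\<lambda>x. complex_of_real (B * indicator {a..b} x))"
  proof -
    have "(cmod (complex_of_real (B * indicator {a..b} x)))\<^sup>2 = B\<^sup>2 * indicator {a..b} x" for x
      by (simp add: norm_mult power_mult_distrib indicator_def)
    then show ?thesis
      unfolding L2_def by (auto intro!: integrable_real_indicator simp: emeasure_lborel_Icc_eq)
  qed
  show "cmod (f x) \<le> cmod (complex_of_real (B * indicator {a..b} x))" for x
    using assms(2)[of x] assms(3)[of x] by (auto simp: indicator_def)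
qed

lemma L2_continuous_support:
  assumes "continuous_on UNIV f" "\<And>x. x \<notin> {a..b} \<Longrightarrow> f x = 0"
  shows "L2 f"
proof -
  have "compact (f ` {a..b})"
    by (intro compact_continuous_image continuous_on_subset[OF assms(1)]) auto
  then obtain B where "\<forall>y\<in>f ` {a..b}. cmod y \<le> B"
    using compact_imp_bounded[of "f ` {a..b}"] unfolding bounded_iff by blast
  then have "\<And>x. x \<in> {a..b} \<Longrightarrow> cmod (f x) \<le> B" by blast
  then have "cmod (f x) \<le> max B 0" for x
    using assms(2)[of x] by (cases "x \<in> {a..b}") (auto simp: le_max_iff_disj)
  then show ?thesis
    by (intro L2_bounded_support[of f a b "max B 0"] borel_measurable_continuous_onI assms) auto
qed

lemma L2_bump:
  assumes "a \<le> b" "0 < n"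
  shows "L2 (\<lambda>x. complex_of_real (bump n a b x))"
  using bump_outside[OF assms]
  by (intro L2_continuous_support[of _ a b] continuous_intros smooth_alg_continuous smooth_alg_bump)
    auto

section \<open>Vanishing almost everywhere from pairings with bumps\<close>

text \<open>The bumps lie below the indicator of (a, b) and converge to it pointwise, so dominated
  convergence with majorant |h| times that indicator passes to the limit.\<close>

lemma integral_interval_zero:
  assumes h: "L2 h" and "a < b"
    and zero: "\<And>n. 0 < n \<Longrightarrow> (LINT x|lborel. h x * complex_of_real (bump n a b x)) = 0"
  shows "(LINT x|lborel. h x * complex_of_real (indicator {a<..<b} x)) = 0"
proof -
  have ind: "L2 (\<lambda>x. complex_of_real (indicator {a<..<b} x))"
    by (rule L2_bounded_support[of _ a b 1]) (auto simp: indicator_def)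
  have "(\<lambda>n. LINT x|lborel. h x * complex_of_real (bump (real (Suc n)) a b x))
      \<longlonglongrightarrow> (LINT x|lborel. h x * complex_of_real (indicator {a<..<b} x))"
  proof (rule integral_dominated_convergence)
    show "integrable lborel (\<lambda>x. cmod (h x * complex_of_real (indicator {a<..<b} x)))"
      by (intro integrable_norm integrable_L2_mult h ind)
    show "(\<lambda>x. h x * complex_of_real (indicator {a<..<b} x)) \<in> borel_measurable lborel"
      using L2D(1)[OF h] by auto
    show "(\<lambda>x. h x * complex_of_real (bump (real (Suc n)) a b x)) \<in> borel_measurable lborel" for n
      using integrable_L2_mult[OF h L2_bump[of a b "real (Suc n)"]] \<open>a < b\<close> by auto
    show "AE x in lborel. (\<lambda>n. h x * complex_of_real (bump (real (Suc n)) a b x))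
        \<longlonglongrightarrow> h x * complex_of_real (indicator {a<..<b} x)"
      using \<open>a < b\<close> by (intro always_eventually allI tendsto_intros bump_tendsto_indicator) auto
    show "AE x in lborel. norm (h x * complex_of_real (bump (real (Suc n)) a b x))
        \<le> cmod (h x * complex_of_real (indicator {a<..<b} x))" for n
    proof (rule always_eventually, rule allI)
      fix x
      show "norm (h x * complex_of_real (bump (real (Suc n)) a b x))
        \<le> cmod (h x * complex_of_real (indicator {a<..<b} x))"
        using bump_outside[of a b "real (Suc n)" x] bump_bounds[of "real (Suc n)" a b x] \<open>a < b\<close>
        by (cases "x \<in> {a<..<b}") (auto simp: norm_mult mult_left_le)
    qed
  qed
  moreover have "(LINT x|lborel. h x * complex_of_real (bump (real (Suc n)) a b x)) = 0" for n
    by (rule zero) simp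
  ultimately show ?thesis by (simp add: LIMSEQ_const_iff)
qed

text \<open>The Borel sets over which r integrates to 0 are closed under complements and disjoint
  countable unions. They contain the open intervals, an intersection-stable generator, hence all
  Borel sets, and a density is determined by its integrals.\<close>

lemma AE_zero_if_interval_integrals_zero:
  fixes r :: "real \<Rightarrow> real"
  assumes r: "integrable lborel r"
    and zero: "\<And>a b. a < b \<Longrightarrow> (LINT x|lborel. indicator {a<..<b} x * r x) = 0"
  shows "AE x in lborel. r x = 0"
proof (rule density_unique_real[OF r, of "\<lambda>x. 0"])
  have borel_eq: "(borel :: real measure) = sigma UNIV (range (\<lambda>(a, b). {a<..<b::real}))"
    using borel_eq_box[where 'a = real] by (simp add: box_real)
  fix A :: "real set" assume "A \<in> sets lborel"
  then have A: "A \<in> sigma_sets UNIV (range (\<lambda>(a, b). {a<..<b::real}))"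
    by (simp add: borel_eq)
  have int: "integrable lborel (\<lambda>x. indicator A x * r x)" if "A \<in> sets borel" for A
    using integrable_mult_indicator[OF _ r, of A] that by simp
  \<comment> \<open>Complements need the integral over the whole line, obtained as the limit over
    the intervals (-n - 1, n + 1).\<close>
  have total: "(LINT x|lborel. r x) = 0"
  proof -
    have "(\<lambda>n. LINT x|lborel. indicator {- real (Suc n)<..<real (Suc n)} x * r x) \<longlonglongrightarrow> (LINT x|lborel. r x)"
    proof (rule integral_dominated_convergence[where w = "\<lambda>x. norm (r x)"])
      show "AE x in lborel. (\<lambda>n. indicator {- real (Suc n)<..<real (Suc n)} x * r x) \<longlonglongrightarrow> r x"
      proof (rule always_eventually, rule allI)
        fix x
        obtain N where N: "\<bar>x\<bar> < real N" using reals_Archimedean2 by blast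
        have "indicator {- real (Suc n)<..<real (Suc n)} x * r x = r x" if "n \<ge> N" for n
          using N that by (auto simp: indicator_def)
        then show "(\<lambda>n. indicator {- real (Suc n)<..<real (Suc n)} x * r x) \<longlonglongrightarrow> r x"
          by (intro tendsto_eventually) (auto simp: eventually_sequentially)
      qed
    qed (use r in \<open>auto simp: indicator_def\<close>)
    moreover have "(LINT x|lborel. indicator {- real (Suc n)<..<real (Suc n)} x * r x) = 0" for n
      by (rule zero) simp
    ultimately show ?thesis by (simp add: LIMSEQ_const_iff)
  qed
  have "(LINT x|lborel. indicator A x * r x) = 0"
  proof (rule sigma_sets_induct_disjoint[OF _ _ A, of "\<lambda>A. (LINT x|lborel. indicator A x * r x) = 0"])
    show "Int_stable (range (\<lambda>(a, b). {a<..<b::real}))"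
      by (auto simp: Int_stable_def)
    show "range (\<lambda>(a, b). {a<..<b::real}) \<subseteq> Pow UNIV" by simp
  next
    fix B assume "B \<in> range (\<lambda>(a, b). {a<..<b::real})"
    then obtain a b where "B = {a<..<b}" by auto
    then show "(LINT x|lborel. indicator B x * r x) = 0"
      using zero[of a b] by (cases "a < b") auto
  next
    show "(LINT x|lborel. indicator {} x * r x) = 0" by simp
  next
    fix B assume B: "B \<in> sigma_sets UNIV (range (\<lambda>(a, b). {a<..<b::real}))"
      and *: "(LINT x|lborel. indicator B x * r x) = 0"
    have "B \<in> sets borel" using B by (simp add: borel_eq)
    have "(LINT x|lborel. indicator (UNIV - B) x * r x) = (LINT x|lborel. r x - indicator B x * r x)"
      by (rule Bochner_Integration.integral_cong) (auto simp: indicator_def)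
    then show "(LINT x|lborel. indicator (UNIV - B) x * r x) = 0"
      using * total r int[OF \<open>B \<in> sets borel\<close>] by simp
  next
    fix B :: "nat \<Rightarrow> real set"
    assume dis: "disjoint_family B"
      and B: "range B \<subseteq> sigma_sets UNIV (range (\<lambda>(a, b). {a<..<b::real}))"
      and *: "\<And>i. (LINT x|lborel. indicator (B i) x * r x) = 0"
    have "B i \<in> sets borel" for i using B by (auto simp: borel_eq)
    then have "(LINT x:(\<Union>i. B i)|lborel. r x) = (\<Sum>i. LINT x:B i|lborel. r x)"
      using dis int[of "\<Union>i. B i"]
      by (intro lebesgue_integral_countable_add)
        (auto simp: disjoint_family_on_def set_integrable_def)
    then show "(LINT x|lborel. indicator (\<Union>i. B i) x * r x) = 0"
      using * by (simp add: set_lebesgue_integral_def)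
  qed
  then show "(LINT x:A|lborel. r x) = (LINT x:A|lborel. 0)"
    by (simp add: set_lebesgue_integral_def)
qed simp

text \<open>Bumps away from 0 are the ones known to lie in the domain of \<open>t_op\<close>. They
  suffice because {0} is a null set and countably many intervals exhaust its complement.\<close>

lemma AE_zero_off_origin:
  assumes h: "L2 h"
    and zero: "\<And>n a b. 0 < n \<Longrightarrow> a < b \<Longrightarrow> 0 < a \<or> b < 0 \<Longrightarrow>
      (LINT x|lborel. h x * complex_of_real (bump n a b x)) = 0"
  shows "AE x in lborel. h x = 0"
proof -
  have local: "AE x in lborel. x \<in> {c<..<d} \<longrightarrow> h x = 0" if cd: "0 < c \<or> d < 0" for c d
  proof -
    \<comment> \<open>Localising to (c, d) turns the square integrable h into an integrable
      function, and every interval cut with (c, d) still avoids the origin.\<close>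
    define k where "k = (\<lambda>x. h x * complex_of_real (indicator {c<..<d} x))"
    have ind: "L2 (\<lambda>x. complex_of_real (indicator {c<..<d} x))"
      by (rule L2_bounded_support[of _ c d 1]) (auto simp: indicator_def)
    have k: "integrable lborel k"
      unfolding k_def by (rule integrable_L2_mult[OF h ind])
    have *: "(LINT x|lborel. indicator {a<..<b} x *\<^sub>R k x) = 0" for a b
    proof (cases "max a c < min b d")
      case True
      then have "(LINT x|lborel. h x * complex_of_real (indicator {max a c<..<min b d} x)) = 0"
        using cd by (intro integral_interval_zero h zero) auto
      moreover have "indicator {a<..<b} x *\<^sub>R k x = h x * complex_of_real (indicator {max a c<..<min b d} x)" for x
        by (auto simp: k_def indicator_def)
      ultimately show ?thesis by simp
    next
      case False
      then have "(\<lambda>x. indicator {a<..<b} x *\<^sub>R k x) = (\<lambda>x. 0)"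
        by (auto simp: k_def indicator_def fun_eq_iff)
      then show ?thesis by simp
    qed
    have ik: "integrable lborel (\<lambda>x. indicator {a<..<b} x *\<^sub>R k x)" for a b
      by (rule integrable_mult_indicator[OF _ k]) simp
    have "AE x in lborel. Re (k x) = 0" 
      using integral_Re[OF ik] * by (intro AE_zero_if_interval_integrals_zero integrable_Re k) simp
    moreover have "AE x in lborel. Im (k x) = 0"
      using integral_Im[OF ik] * by (intro AE_zero_if_interval_integrals_zero integrable_Im k) simp
    ultimately show ?thesis
      by eventually_elim (auto simp: k_def complex_eq_iff)
  qed
  have "AE x in lborel. \<forall>n::nat. (x \<in> {1 / real (Suc n)<..<real n} \<longrightarrow> h x = 0) \<and>
      (x \<in> {- real n<..< - 1 / real (Suc n)} \<longrightarrow> h x = 0)"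
    by (auto simp: AE_all_countable intro!: local[simplified])
  moreover have "AE x in lborel. x \<noteq> (0::real)"
    by (rule AE_lborel_singleton)
  ultimately show ?thesis
  proof eventually_elim
    case (elim x)
    obtain n1 where n1: "1 / \<bar>x\<bar> < real n1" using reals_Archimedean2 by blast
    obtain n2 where n2: "\<bar>x\<bar> < real n2" using reals_Archimedean2 by blast
    define n where "n = max n1 n2"
    have "1 / \<bar>x\<bar> < real (Suc n)" "\<bar>x\<bar> < real n" using n1 n2 by (auto simp: n_def)
    then have "1 / real (Suc n) < \<bar>x\<bar>" "\<bar>x\<bar> < real n" using elim by (auto simp: field_simps)
    then show ?case using elim(1)[rule_format, of n] by (cases "0 < x") auto
  qed
qed

section \<open>The momentum operator\<close>

lemma test_fun_DERIV: "test_fun \<phi> \<Longrightarrow> (\<phi> has_real_derivative deriv \<phi> x) (at x)"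
  unfolding test_fun_def by (metis DERIV_deriv_iff_real_differentiable funpow_0)

lemma test_fun_deriv_continuous: "test_fun \<phi> \<Longrightarrow> continuous_on A (deriv \<phi>)"
proof -
  assume "test_fun \<phi>"
  then have "((deriv ^^ 1) \<phi>) differentiable (at x)" for x
    unfolding test_fun_def by blast
  then show ?thesis
    by (auto intro!: continuous_at_imp_continuous_on differentiable_imp_continuous_within)
qed

lemma test_fun_supportE:
  assumes "test_fun \<phi>"
  obtains R where "0 < R" "\<And>x. R \<le> \<bar>x\<bar> \<Longrightarrow> \<phi> x = 0" "\<And>x. R \<le> \<bar>x\<bar> \<Longrightarrow> deriv \<phi> x = 0"
proof -
  obtain B where B: "\<And>x. \<phi> x \<noteq> 0 \<Longrightarrow> \<bar>x\<bar> \<le> B"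
    using assms unfolding test_fun_def bounded_iff by auto
  have z: "\<phi> x = 0" if "\<bar>B\<bar> < \<bar>x\<bar>" for x
    using B[of x] that by linarith
  have "deriv \<phi> x = 0" if x: "\<bar>B\<bar> < \<bar>x\<bar>" for x
  proof -
    have "open {x::real. \<bar>B\<bar> < \<bar>x\<bar>}"
      by (intro open_Collect_less continuous_intros)
    then have "(\<phi> has_real_derivative 0) (at x)"
      using x z by (intro has_field_derivative_transform_within_open[where f = "\<lambda>_. 0" and g = \<phi>
            and S = "{x. \<bar>B\<bar> < \<bar>x\<bar>}"]) auto
    then show ?thesis by (rule DERIV_imp_deriv)
  qed
  with z show ?thesis by (intro that[of "\<bar>B\<bar> + 1"]) auto
qed

lemma L2_test_fun: "test_fun \<phi> \<Longrightarrow> L2 (\<lambda>x. complex_of_real (\<phi> x))"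
proof -
  assume t: "test_fun \<phi>"
  obtain R where R: "0 < R" "\<And>x. R \<le> \<bar>x\<bar> \<Longrightarrow> \<phi> x = 0"
    using test_fun_supportE[OF t] by metis
  have "continuous_on UNIV \<phi>"
    using test_fun_DERIV[OF t] by (meson DERIV_isCont continuous_at_imp_continuous_on)
  then show ?thesis
    by (intro L2_continuous_support[of _ "-R" R] continuous_intros) (auto intro!: R(2))
qed

lemma L2_test_fun_deriv: "test_fun \<phi> \<Longrightarrow> L2 (\<lambda>x. complex_of_real (deriv \<phi> x))"
proof -
  assume t: "test_fun \<phi>"
  obtain R where R: "0 < R" "\<And>x. R \<le> \<bar>x\<bar> \<Longrightarrow> deriv \<phi> x = 0"
    using test_fun_supportE[OF t] by metis
  then show ?thesis
    by (intro L2_continuous_support[of _ "-R" R] continuous_intros test_fun_deriv_continuous t)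
      (auto intro!: R(2))
qed

lemma p_opD:
  assumes "(f, g) \<in> p_op"
  shows "L2 f" "L2 g"
    "test_fun \<phi> \<Longrightarrow> (LINT x|lborel. f x * complex_of_real (deriv \<phi> x))
          = - \<i> * (LINT x|lborel. g x * complex_of_real (\<phi> x))"
  using assms by (auto simp: p_op_def)

text \<open>Integration by parts: the fundamental theorem of calculus applied to f \<phi> on
  [-R, R], where R is so large that \<phi> and its derivative vanish from R on in both directions,
  endpoints included.\<close>

lemma p_opI:
  assumes f: "L2 f" "L2 f'" and der: "\<And>x. (f has_vector_derivative f' x) (at x)"
    and cont: "continuous_on UNIV f'"
  shows "(f, \<lambda>x. - \<i> * f' x) \<in> p_op"
  unfolding p_op_def
proof (clarify, intro conjI allI impI)
  show "L2 f" by (rule f)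
  show "L2 (\<lambda>x. - \<i> * f' x)" by (rule L2_cmult[OF f(2)])
  fix \<phi> assume t: "test_fun \<phi>"
  obtain R where R: "0 < R" "\<And>x. R \<le> \<bar>x\<bar> \<Longrightarrow> \<phi> x = 0" "\<And>x. R \<le> \<bar>x\<bar> \<Longrightarrow> deriv \<phi> x = 0"
    using test_fun_supportE[OF t] by metis
  let ?F = "\<lambda>x. f x * complex_of_real (\<phi> x)"
  let ?F' = "\<lambda>x. f x * complex_of_real (deriv \<phi> x) + f' x * complex_of_real (\<phi> x)"
  have contf: "continuous_on UNIV f"
    using der by (meson has_vector_derivative_continuous continuous_at_imp_continuous_on)
  have cont\<phi>: "continuous_on UNIV \<phi>"
    using test_fun_DERIV[OF t] by (meson DERIV_isCont continuous_at_imp_continuous_on)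
  have "has_bochner_integral lborel (\<lambda>x. indicator {-R..R} x *\<^sub>R ?F' x) (?F R - ?F (- R))"
  proof (rule has_bochner_integral_FTC_Icc)
    show "- R \<le> R" using R(1) by simp
    show "continuous_on {- R..R} ?F'"
      by (rule continuous_on_subset[of UNIV])
        (auto intro!: continuous_intros contf cont cont\<phi> test_fun_deriv_continuous t)
    fix x
    have "((\<lambda>x. complex_of_real (\<phi> x)) has_vector_derivative complex_of_real (deriv \<phi> x)) (at x)"
      using test_fun_DERIV[OF t, of x]
      by (intro has_vector_derivative_of_real) (simp add: has_real_derivative_iff_has_vector_derivative)
    from has_vector_derivative_mult[OF der this]
    show "(?F has_vector_derivative ?F' x) (at x within {- R..R})"
      by (simp add: has_vector_derivative_at_within)
  qed
  moreover have "indicator {-R..R} x *\<^sub>R ?F' x = ?F' x" for x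
    using R(2,3)[of x] by (auto simp: indicator_def)
  moreover have "?F R - ?F (- R) = 0" using R by simp
  ultimately have "(LINT x|lborel. ?F' x) = 0"
    by (simp add: has_bochner_integral_iff)
  moreover have "(LINT x|lborel. ?F' x) = (LINT x|lborel. f x * complex_of_real (deriv \<phi> x))
      + (LINT x|lborel. f' x * complex_of_real (\<phi> x))"
    by (intro Bochner_Integration.integral_add integrable_L2_mult f L2_test_fun L2_test_fun_deriv t)
  ultimately have "(LINT x|lborel. f x * complex_of_real (deriv \<phi> x))
      = - (LINT x|lborel. f' x * complex_of_real (\<phi> x))"
    by (simp add: eq_neg_iff_add_eq_0)
  also have "\<dots> = - \<i> * (LINT x|lborel. (- \<i> * f' x) * complex_of_real (\<phi> x))"
    by (simp add: mult.assoc)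
  finally show "(LINT x|lborel. f x * complex_of_real (deriv \<phi> x))
      = - \<i> * (LINT x|lborel. (- \<i> * f' x) * complex_of_real (\<phi> x))" .
qed

lemma ae_eqI_bump:
  assumes "L2 f" "L2 g"
    and eq: "\<And>n a b. 0 < n \<Longrightarrow> a < b \<Longrightarrow> 0 < a \<or> b < 0 \<Longrightarrow>
      (LINT x|lborel. f x * complex_of_real (bump n a b x))
        = (LINT x|lborel. g x * complex_of_real (bump n a b x))"
  shows "ae_eq f g"
proof -
  have "AE x in lborel. f x - g x = 0"
  proof (rule AE_zero_off_origin[OF L2_diff[OF assms(1,2)]])
    fix n a b :: real assume *: "0 < n" "a < b" "0 < a \<or> b < 0"
    then show "(LINT x|lborel. (f x - g x) * complex_of_real (bump n a b x)) = 0"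
      using eq[OF *] integrable_L2_mult[OF _ L2_bump, of f a b n] integrable_L2_mult[OF _ L2_bump, of g a b n] assms
      by (simp add: left_diff_distrib)
  qed
  then show ?thesis by (simp add: ae_eq_def)
qed

lemma ae_eq_refl: "ae_eq f f" by (simp add: ae_eq_def)
lemma ae_eq_sym: "ae_eq f g \<Longrightarrow> ae_eq g f" by (auto simp: ae_eq_def)

lemma ae_eq_trans:
  assumes "ae_eq f g" "ae_eq g h"
  shows "ae_eq f h"
  using assms unfolding ae_eq_def by eventually_elim simp

lemma LINT_ae_eq_mult:
  assumes "ae_eq f f'" "f \<in> borel_measurable borel" "f' \<in> borel_measurable borel" "g \<in> borel_measurable borel"
  shows "(LINT x|lborel. f x * g x) = (LINT x|lborel. f' x * g x)"
  by (rule integral_cong_AE) (use assms in \<open>auto simp: ae_eq_def\<close>)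

lemma p_op_cong:
  assumes "(f, g) \<in> p_op" "L2 f'" "L2 g'" "ae_eq f f'" "ae_eq g g'"
  shows "(f', g') \<in> p_op"
  unfolding p_op_def
proof (clarify, intro conjI allI impI)
  fix \<phi> assume t: "test_fun \<phi>"
  note m = L2D(1)[OF L2_test_fun[OF t]] L2D(1)[OF L2_test_fun_deriv[OF t]]
    L2D(1)[OF p_opD(1)[OF assms(1)]] L2D(1)[OF p_opD(2)[OF assms(1)]] L2D(1)[OF assms(2)] L2D(1)[OF assms(3)]
  show "(LINT x|lborel. f' x * complex_of_real (deriv \<phi> x))
      = - \<i> * (LINT x|lborel. g' x * complex_of_real (\<phi> x))"
    using p_opD(3)[OF assms(1) t]
      LINT_ae_eq_mult[OF assms(4) m(3) m(5) m(2)] LINT_ae_eq_mult[OF assms(5) m(4) m(6) m(1)] by simp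
qed (use assms in auto)

lemma p_op_unique:
  assumes "(f, g) \<in> p_op" "(f', g') \<in> p_op" "ae_eq f f'"
  shows "ae_eq g g'"
proof -
  have p: "(f, g') \<in> p_op"
    by (rule p_op_cong[OF assms(2) p_opD(1)[OF assms(1)] p_opD(2)[OF assms(2)]
          ae_eq_sym[OF assms(3)] ae_eq_refl])
  show ?thesis
  proof (rule ae_eqI_bump)
    fix n a b :: real assume "0 < n" "a < b"
    then have "test_fun (bump n a b)" by (intro test_fun_bump) auto
    from p_opD(3)[OF p this] p_opD(3)[OF assms(1) this]
    show "(LINT x|lborel. g x * complex_of_real (bump n a b x))
        = (LINT x|lborel. g' x * complex_of_real (bump n a b x))" by simp
  qed (rule p_opD[OF assms(1)] p_opD[OF assms(2)])+
qed

section \<open>Weak derivatives tested against weights without compact support\<close>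

text \<open>The limit in the form \<open>0 ^ k\<close> covers both uses: it is 1 for k = 0, where
  the cutoffs tend to 1, and 0 for k = 2, where the derivatives of the cutoffs disappear.\<close>

lemma flat_tendsto_at_top: "(flat k \<longlongrightarrow> 0 ^ k) at_top"
proof -
  have "((\<lambda>y::real. exp (- inverse y) * inverse y ^ k) \<longlongrightarrow> exp (- 0) * 0 ^ k) at_top"
    by (intro tendsto_intros tendsto_inverse_0_at_top filterlim_ident)
  moreover have "\<forall>\<^sub>F y in at_top. exp (- inverse y) * inverse y ^ k = flat k y"
    using eventually_gt_at_top[of 0]
    by eventually_elim (simp add: flat_def field_simps)
  ultimately show ?thesis by (simp add: tendsto_cong)
qed

lemma parabola_at_top: "filterlim (\<lambda>n. (x + real (Suc n)) * (real (Suc n) - x)) at_top sequentially"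
proof (rule filterlim_at_top_mono)
  show "filterlim (\<lambda>n. - x\<^sup>2 + real n) at_top sequentially"
    by (intro filterlim_tendsto_add_at_top[OF tendsto_const] filterlim_real_sequentially)
  show "\<forall>\<^sub>F n in sequentially. - x\<^sup>2 + real n \<le> (x + real (Suc n)) * (real (Suc n) - x)"
  proof (rule always_eventually, rule allI)
    fix n
    have "(x + real (Suc n)) * (real (Suc n) - x) = (real (Suc n))\<^sup>2 - x\<^sup>2"
      by (simp add: algebra_simps power2_eq_square)
    moreover have "real n \<le> (real (Suc n))\<^sup>2" by (simp add: power2_eq_square algebra_simps)
    ultimately show "- x\<^sup>2 + real n \<le> (x + real (Suc n)) * (real (Suc n) - x)" by linarith
  qed
qed

text \<open>The weight w is multiplied by bumps on intervals (-N, N) and N tends to infinity. The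
  derivative of the cutoff is bounded by a multiple of |x| uniformly in N, which is why x w must be
  square integrable.\<close>

lemma p_op_smooth_mult:
  assumes p: "(f, m) \<in> p_op" and w: "smooth_alg w"
    and L2w: "L2 (\<lambda>x. complex_of_real (w x))" "L2 (\<lambda>x. complex_of_real (deriv w x))"
      "L2 (\<lambda>x. complex_of_real (x * w x))"
  shows "(LINT x|lborel. f x * complex_of_real (deriv w x))
      = - \<i> * (LINT x|lborel. m x * complex_of_real (w x))"
proof -
  define cut where "cut n = bump 1 (- real (Suc n)) (real (Suc n))" for n
  define d where "d n x = flat 2 ((x + real (Suc n)) * (real (Suc n) - x)) * (- 2 * x)" for n x
  have d: "(cut n has_real_derivative d n x) (at x)" for n x
  proof -
    have "(bump 1 (- N) N has_real_derivative flat 2 ((x + N) * (N - x)) * (- 2 * x)) (at x)" for N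
      using bump_deriv[of 1 "- N" N x] by simp
    then show ?thesis unfolding cut_def d_def .
  qed
  have sm: "smooth_alg (\<lambda>x. w x * cut n x)" for n
    unfolding cut_def by (intro times w smooth_alg_bump)
  have der: "deriv (\<lambda>x. w x * cut n x) x = deriv w x * cut n x + w x * d n x" for n x
    by (rule DERIV_imp_deriv) (auto intro!: derivative_eq_intros smooth_alg_DERIV w d)
  have test: "test_fun (\<lambda>x. w x * cut n x)" for n
  proof (rule test_fun_smooth_alg[OF sm])
    have "{x. w x * cut n x \<noteq> 0} \<subseteq> {- real (Suc n)<..<real (Suc n)}"
    proof
      fix x assume x: "x \<in> {x. w x * cut n x \<noteq> 0}"
      show "x \<in> {- real (Suc n)<..<real (Suc n)}"
      proof (rule ccontr)
        assume "x \<notin> {- real (Suc n)<..<real (Suc n)}"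
        then have "cut n x = 0" unfolding cut_def by (intro bump_outside) simp_all
        with x show False by simp
      qed
    qed
    then show "bounded {x. w x * cut n x \<noteq> 0}" by (rule bounded_subset[rotated]) simp
  qed
  note f = p_opD(1)[OF p] and m = p_opD(2)[OF p]
  have cut_lim: "(\<lambda>n. cut n x) \<longlonglongrightarrow> 1" for x
    using filterlim_compose[OF flat_tendsto_at_top[of 0] parabola_at_top[of x]]
    by (simp only: cut_def bump_def diff_minus_eq_add mult_1_left power_0)
  have d_lim: "(\<lambda>n. d n x) \<longlonglongrightarrow> 0" for x
    using tendsto_mult[OF filterlim_compose[OF flat_tendsto_at_top[of 2] parabola_at_top[of x]]
        tendsto_const[of "- 2 * x"]]
    by (simp only: d_def zero_power2 mult_zero_left)
  have "(\<lambda>n. LINT x|lborel. f x * complex_of_real (deriv (\<lambda>x. w x * cut n x) x))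
      \<longlonglongrightarrow> (LINT x|lborel. f x * complex_of_real (deriv w x))"
  proof (rule integral_dominated_convergence)
    \<comment> \<open>The constant 4 is the bound 2 for \<open>flat 2\<close> times the factor 2 in
      the derivative \<open>- 2 * x\<close> of the parabola inside the cutoff.\<close>
    show "integrable lborel (\<lambda>x. cmod (f x * complex_of_real (deriv w x)) + 4 * cmod (f x * complex_of_real (x * w x)))"
      using integrable_L2_mult[OF f L2w(2)] integrable_L2_mult[OF f L2w(3)] by auto
    show "(\<lambda>x. f x * complex_of_real (deriv w x)) \<in> borel_measurable lborel"
      using integrable_L2_mult[OF f L2w(2)] by auto
    show "(\<lambda>x. f x * complex_of_real (deriv (\<lambda>x. w x * cut n x) x)) \<in> borel_measurable lborel" for n
      using integrable_L2_mult[OF f L2_test_fun_deriv[OF test]] by auto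
    show "AE x in lborel. (\<lambda>n. f x * complex_of_real (deriv (\<lambda>x. w x * cut n x) x))
        \<longlonglongrightarrow> f x * complex_of_real (deriv w x)"
      unfolding der using tendsto_add[OF tendsto_mult[OF tendsto_const cut_lim] tendsto_mult[OF tendsto_const d_lim]]
      by (intro always_eventually allI tendsto_mult tendsto_const tendsto_of_real) simp
    show "AE x in lborel. norm (f x * complex_of_real (deriv (\<lambda>x. w x * cut n x) x))
        \<le> cmod (f x * complex_of_real (deriv w x)) + 4 * cmod (f x * complex_of_real (x * w x))" for n
    proof (rule always_eventually, rule allI)
      fix x
      have "\<bar>deriv w x * cut n x\<bar> \<le> \<bar>deriv w x\<bar>"
        using bump_bounds[of 1 "- real (Suc n)" "real (Suc n)" x] 
        by (simp add: cut_def abs_mult mult_left_le)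
      moreover have "\<bar>w x * d n x\<bar> \<le> 4 * \<bar>x * w x\<bar>"
      proof -
        have "\<bar>w x * d n x\<bar> = flat 2 ((x + real (Suc n)) * (real (Suc n) - x)) * (2 * \<bar>x * w x\<bar>)"
          using flat_nonneg by (simp add: d_def abs_mult)
        also have "\<dots> \<le> 2 * (2 * \<bar>x * w x\<bar>)"
          by (intro mult_right_mono flat_2_le_2) simp
        finally show ?thesis by simp
      qed
      ultimately have "\<bar>deriv (\<lambda>x. w x * cut n x) x\<bar> \<le> \<bar>deriv w x\<bar> + 4 * \<bar>x * w x\<bar>"
        unfolding der by linarith
      from mult_left_mono[OF this, of "cmod (f x)"]
      show "norm (f x * complex_of_real (deriv (\<lambda>x. w x * cut n x) x))
        \<le> cmod (f x * complex_of_real (deriv w x)) + 4 * cmod (f x * complex_of_real (x * w x))"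
        by (simp add: norm_mult distrib_left mult.assoc[symmetric] abs_mult mult.left_commute)
    qed
  qed
  moreover have "(\<lambda>n. LINT x|lborel. m x * complex_of_real (w x * cut n x))
      \<longlonglongrightarrow> (LINT x|lborel. m x * complex_of_real (w x))"
  proof (rule integral_dominated_convergence)
    show "integrable lborel (\<lambda>x. cmod (m x * complex_of_real (w x)))"
      using integrable_L2_mult[OF m L2w(1)] by auto
    show "(\<lambda>x. m x * complex_of_real (w x)) \<in> borel_measurable lborel"
      using integrable_L2_mult[OF m L2w(1)] by auto
    show "(\<lambda>x. m x * complex_of_real (w x * cut n x)) \<in> borel_measurable lborel" for n
      using integrable_L2_mult[OF m L2_test_fun[OF test]] by auto
    show "AE x in lborel. (\<lambda>n. m x * complex_of_real (w x * cut n x)) \<longlonglongrightarrow> m x * complex_of_real (w x)"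
      using tendsto_mult[OF tendsto_const cut_lim]
      by (intro always_eventually allI tendsto_mult tendsto_const tendsto_of_real) simp
    show "AE x in lborel. norm (m x * complex_of_real (w x * cut n x)) \<le> cmod (m x * complex_of_real (w x))" for n
      using bump_bounds[of 1 "- real (Suc n)" "real (Suc n)"]
      by (intro always_eventually allI)
        (simp add: cut_def norm_mult abs_mult mult_left_le mult.assoc[symmetric])
  qed
  then have "(\<lambda>n. - \<i> * (LINT x|lborel. m x * complex_of_real (w x * cut n x)))
      \<longlonglongrightarrow> - \<i> * (LINT x|lborel. m x * complex_of_real (w x))"
    by (rule tendsto_mult_left)
  ultimately show ?thesis
    unfolding p_opD(3)[OF p test] by (rule LIMSEQ_unique)
qed

section \<open>Exponential polynomials\<close>

definition gbase :: "nat \<Rightarrow> real \<Rightarrow> real \<Rightarrow> complex" where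
  "gbase k \<alpha> u = complex_of_real (u ^ k * exp (- \<alpha> * u))"

text \<open>Generated one term at a time so that properties follow by induction; the same pair of
  exponents may recur, so no index set has to be tracked.\<close>

inductive_set gspan :: "(real \<Rightarrow> complex) set" where
  zero: "(\<lambda>u. 0) \<in> gspan"
| step: "g \<in> gspan \<Longrightarrow> 0 < \<alpha> \<Longrightarrow> \<alpha> < 1 \<Longrightarrow> (\<lambda>u. g u + c * gbase k \<alpha> u) \<in> gspan"

lemma gspan_gbase: "0 < \<alpha> \<Longrightarrow> \<alpha> < 1 \<Longrightarrow> (\<lambda>u. c * gbase k \<alpha> u) \<in> gspan"
  using gspan.step[OF gspan.zero] by simp

lemma gbase_in_gspan: "0 < \<alpha> \<Longrightarrow> \<alpha> < 1 \<Longrightarrow> gbase k \<alpha> \<in> gspan"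
  using gspan_gbase[of \<alpha> 1 k] by simp

lemma gspan_add:
  assumes "g \<in> gspan" "h \<in> gspan"
  shows "(\<lambda>u. g u + h u) \<in> gspan"
  using assms(2)
proof induction
  case (step h \<alpha> c k)
  then show ?case using gspan.step[of "\<lambda>u. g u + h u" \<alpha> c k] by (simp add: add.assoc)
qed (use assms in simp)

lemma gspan_cmult: "g \<in> gspan \<Longrightarrow> (\<lambda>u. c * g u) \<in> gspan"
proof (induction rule: gspan.induct)
  case (step g \<alpha> d k)
  then show ?case using gspan.step[of "\<lambda>u. c * g u" \<alpha> "c * d" k] by (simp add: distrib_left mult.assoc)
qed (simp add: gspan.zero)

lemma gspan_diff: "g \<in> gspan \<Longrightarrow> h \<in> gspan \<Longrightarrow> (\<lambda>u. g u - h u) \<in> gspan"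
  using gspan_add[OF _ gspan_cmult[of h "-1"], of g] by simp

lemma gspan_sum: "(\<And>i. i \<in> I \<Longrightarrow> g i \<in> gspan) \<Longrightarrow> (\<lambda>u. \<Sum>i\<in>I. g i u) \<in> gspan"
  by (induction I rule: infinite_finite_induct) (auto intro: gspan.zero gspan_add)

lemma gspan_cnj: "g \<in> gspan \<Longrightarrow> (\<lambda>u. cnj (g u)) \<in> gspan"
proof (induction rule: gspan.induct)
  case (step g \<alpha> d k)
  then show ?case using gspan.step[of "\<lambda>u. cnj (g u)" \<alpha> "cnj d" k] by (simp add: gbase_def)
qed (simp add: gspan.zero)

lemma gspan_umult: "g \<in> gspan \<Longrightarrow> (\<lambda>u. complex_of_real u * g u) \<in> gspan"
proof (induction rule: gspan.induct)
  case (step g \<alpha> d k)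
  have "complex_of_real u * (g u + d * gbase k \<alpha> u) = complex_of_real u * g u + d * gbase (Suc k) \<alpha> u" for u
    by (simp add: gbase_def distrib_left mult.left_commute)
  then show ?case using gspan.step[OF step.IH step(2,3), of d "Suc k"] by simp
qed (simp add: gspan.zero)

text \<open>An operator on functions, so that the iterates \<open>gd ^^ n\<close> make sense. The
  functions live on the whole line although they are later evaluated only at u \<ge> 0; this avoids
  one-sided derivatives at 0.\<close>

definition gd :: "(real \<Rightarrow> complex) \<Rightarrow> real \<Rightarrow> complex" where
  "gd g u = vector_derivative g (at u)"

lemma gdI: "(\<And>u. (g has_vector_derivative g' u) (at u)) \<Longrightarrow> gd g = g'"
  by (auto simp: gd_def fun_eq_iff intro: vector_derivative_at)

lemma gbase_has_derivative:
  "(gbase k \<alpha> has_vector_derivative (of_nat k * gbase (k - 1) \<alpha> u - of_real \<alpha> * gbase k \<alpha> u)) (at u)"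
proof -
  have "((\<lambda>u. u ^ k * exp (- \<alpha> * u)) has_real_derivative
      real k * (u ^ (k - 1) * exp (- \<alpha> * u)) - \<alpha> * (u ^ k * exp (- \<alpha> * u))) (at u)"
    by (auto intro!: derivative_eq_intros simp: algebra_simps)
  then have "((\<lambda>u. complex_of_real (u ^ k * exp (- \<alpha> * u))) has_vector_derivative
      complex_of_real (real k * (u ^ (k - 1) * exp (- \<alpha> * u)) - \<alpha> * (u ^ k * exp (- \<alpha> * u)))) (at u)"
    by (intro has_vector_derivative_of_real) (simp add: has_real_derivative_iff_has_vector_derivative)
  then show ?thesis by (simp add: gbase_def[abs_def])
qed

lemma gspan_has_derivative_ex:
  "g \<in> gspan \<Longrightarrow> \<exists>g'\<in>gspan. \<forall>u. (g has_vector_derivative g' u) (at u)"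
proof (induction rule: gspan.induct)
  case zero
  show ?case by (rule bexI[of _ "\<lambda>u. 0"]) (auto intro: gspan.zero)
next
  case (step g \<alpha> c k)
  then obtain g' where g': "g' \<in> gspan" "\<forall>u. (g has_vector_derivative g' u) (at u)" by blast
  have "((\<lambda>u. g u + c * gbase k \<alpha> u) has_vector_derivative
      (g' u + c * (of_nat k * gbase (k - 1) \<alpha> u - of_real \<alpha> * gbase k \<alpha> u))) (at u)" for u
    by (intro has_vector_derivative_add has_vector_derivative_mult_right gbase_has_derivative)
      (use g' in blast)
  moreover have "(\<lambda>u. g' u + c * (of_nat k * gbase (k - 1) \<alpha> u - of_real \<alpha> * gbase k \<alpha> u)) \<in> gspan"
    using step by (intro gspan_add g' gspan_cmult gspan_diff) (auto intro: gbase_in_gspan)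
  ultimately show ?case by (rule_tac bexI) auto
qed

lemma gspan_gd: "g \<in> gspan \<Longrightarrow> gd g \<in> gspan"
  using gspan_has_derivative_ex[of g] gdI by metis

lemma gspan_has_derivative: "g \<in> gspan \<Longrightarrow> (g has_vector_derivative gd g u) (at u)"
  using gspan_has_derivative_ex[of g] gdI by metis

lemma gspan_funpow_gd: "g \<in> gspan \<Longrightarrow> (gd ^^ n) g \<in> gspan"
  by (induction n) (auto intro: gspan_gd)

lemma gspan_continuous: "g \<in> gspan \<Longrightarrow> continuous_on A g"
  by (meson gspan_has_derivative has_vector_derivative_continuous continuous_at_imp_continuous_on)

lemma gd_add: "g \<in> gspan \<Longrightarrow> h \<in> gspan \<Longrightarrow> gd (\<lambda>u. g u + h u) = (\<lambda>u. gd g u + gd h u)"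
  by (intro gdI has_vector_derivative_add gspan_has_derivative)

lemma gd_diff: "g \<in> gspan \<Longrightarrow> h \<in> gspan \<Longrightarrow> gd (\<lambda>u. g u - h u) = (\<lambda>u. gd g u - gd h u)"
  by (intro gdI has_vector_derivative_diff gspan_has_derivative)

lemma gd_cmult: "g \<in> gspan \<Longrightarrow> gd (\<lambda>u. c * g u) = (\<lambda>u. c * gd g u)"
  by (intro gdI has_vector_derivative_mult_right gspan_has_derivative)

lemma gd_cnj:
  assumes "g \<in> gspan"
  shows "gd (\<lambda>u. cnj (g u)) = (\<lambda>u. cnj (gd g u))"
proof (rule gdI)
  show "((\<lambda>u. cnj (g u)) has_vector_derivative cnj (gd g u)) (at u)" for u
    by (rule bounded_linear.has_vector_derivative[OF bounded_linear_cnj gspan_has_derivative[OF assms]])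
qed

lemma gd_umult:
  assumes "g \<in> gspan"
  shows "gd (\<lambda>u. of_real u * g u) = (\<lambda>u. g u + of_real u * gd g u)"
proof (rule gdI)
  have "(complex_of_real has_vector_derivative 1) (at u)" for u
    using has_vector_derivative_of_real[of "\<lambda>x. x" 1 "at u"] by (simp add: has_vector_derivative_id)
  from has_vector_derivative_mult[OF this gspan_has_derivative[OF assms]]
  show "((\<lambda>u. of_real u * g u) has_vector_derivative g u + of_real u * gd g u) (at u)" for u
    by (simp add: add.commute)
qed

lemma gd_gbase: "gd (\<lambda>u. gbase k \<alpha> u) = (\<lambda>u. of_nat k * gbase (k - 1) \<alpha> u - of_real \<alpha> * gbase k \<alpha> u)"
  by (intro gdI gbase_has_derivative)

lemma funpow_gd_add:
  "g \<in> gspan \<Longrightarrow> h \<in> gspan \<Longrightarrow> (gd ^^ n) (\<lambda>u. g u + h u) = (\<lambda>u. (gd ^^ n) g u + (gd ^^ n) h u)"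
  by (induction n) (auto simp: gd_add gspan_funpow_gd)

lemma funpow_gd_cmult: "g \<in> gspan \<Longrightarrow> (gd ^^ n) (\<lambda>u. c * g u) = (\<lambda>u. c * (gd ^^ n) g u)"
  by (induction n) (auto simp: gd_cmult gspan_funpow_gd)

lemma funpow_gd_diff:
  "g \<in> gspan \<Longrightarrow> h \<in> gspan \<Longrightarrow> (gd ^^ n) (\<lambda>u. g u - h u) = (\<lambda>u. (gd ^^ n) g u - (gd ^^ n) h u)"
  by (induction n) (auto simp: gd_diff gspan_funpow_gd)

text \<open>The Leibniz rule, in which only the first derivative of the factor u survives. The lower
  order term is the only source of the commutator with \<open>h_symbol\<close>.\<close>

lemma funpow_gd_umult:
  assumes "g \<in> gspan"
  shows "(gd ^^ Suc n) (\<lambda>u. of_real u * g u)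
    = (\<lambda>u. of_real u * (gd ^^ Suc n) g u + of_nat (Suc n) * (gd ^^ n) g u)"
proof (induction n)
  case 0
  then show ?case using gd_umult[OF assms] by (simp add: add.commute)
next
  case (Suc n)
  let ?a = "(gd ^^ Suc n) g" and ?b = "(gd ^^ n) g"
  have mem: "?a \<in> gspan" "?b \<in> gspan" using gspan_funpow_gd[OF assms] by blast+
  have "(gd ^^ Suc (Suc n)) (\<lambda>u. of_real u * g u) = gd (\<lambda>u. of_real u * ?a u + of_nat (Suc n) * ?b u)"
    using Suc by simp
  also have "\<dots> = (\<lambda>u. (?a u + of_real u * gd ?a u) + of_nat (Suc n) * gd ?b u)"
    using mem gspan_umult gspan_cmult by (simp only: gd_add gd_umult gd_cmult)
  also have "\<dots> = (\<lambda>u. of_real u * (gd ^^ Suc (Suc n)) g u + of_nat (Suc (Suc n)) * (gd ^^ Suc n) g u)"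
    by (simp add: fun_eq_iff algebra_simps)
  finally show ?case .
qed

section \<open>Geometric decay of iterated derivatives\<close>

text \<open>Half of the exponential is spent on the power: one term of the series of
  \<open>exp (\<alpha> / 2 * u)\<close> dominates \<open>u ^ k\<close>.\<close>

lemma power_exp_le:
  fixes u \<alpha> :: real
  assumes "0 < \<alpha>" "0 \<le> u"
  shows "u ^ k * exp (- \<alpha> * u) \<le> fact k * (2 / \<alpha>) ^ k * exp (- (\<alpha> / 2) * u)"
proof -
  have "(\<alpha> / 2 * u) ^ k / fact k \<le> exp (\<alpha> / 2 * u)"
    by (rule power_div_fact_le_exp) (use assms in auto)
  then have "u ^ k \<le> fact k * (2 / \<alpha>) ^ k * exp (\<alpha> / 2 * u)"
    using assms by (simp add: field_simps power_mult_distrib power_divide)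
  then have "u ^ k * exp (- \<alpha> * u) \<le> (fact k * (2 / \<alpha>) ^ k * exp (\<alpha> / 2 * u)) * exp (- \<alpha> * u)"
    by (rule mult_right_mono) simp
  also have "\<dots> = fact k * (2 / \<alpha>) ^ k * exp (- (\<alpha> / 2) * u)"
    by (simp add: mult.assoc exp_add[symmetric] field_simps)
  finally show ?thesis .
qed

text \<open>Each derivative of \<open>u\<^sup>k e\<^sup>-\<^sup>\<alpha>\<^sup>u\<close> contributes a factor \<open>\<alpha>\<close> up to lower order terms,
  so any rate \<open>r > \<alpha>\<close> works; here \<open>r = (1 + \<alpha>) / 2\<close>.\<close>
lemma gbase_decay:
  assumes \<alpha>: "0 < \<alpha>" "\<alpha> < 1"
  shows "\<exists>C\<ge>0. \<forall>n. \<forall>u\<ge>0. cmod ((gd ^^ n) (\<lambda>u. gbase k \<alpha> u) u) \<le> C * ((1 + \<alpha>) / 2) ^ n * exp (- (\<alpha> / 2) * u)"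
proof (induction k)
  case 0
  have mem: "(\<lambda>u. gbase 0 \<alpha> u) \<in> gspan" by (rule gbase_in_gspan[OF \<alpha>])
  have g: "(gd ^^ n) (\<lambda>u. gbase 0 \<alpha> u) = (\<lambda>u. (- of_real \<alpha>) ^ n * gbase 0 \<alpha> u)" for n
    by (induction n) (auto simp: gd_cmult[OF mem] gd_gbase[of 0])
  have "cmod ((gd ^^ n) (\<lambda>u. gbase 0 \<alpha> u) u) \<le> 1 * ((1 + \<alpha>) / 2) ^ n * exp (- (\<alpha> / 2) * u)" if "0 \<le> u" for n u
  proof -
    have "cmod ((gd ^^ n) (\<lambda>u. gbase 0 \<alpha> u) u) = \<alpha> ^ n * exp (- \<alpha> * u)"
      unfolding g using \<alpha> by (simp add: gbase_def norm_mult norm_power)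
    also have "\<dots> \<le> ((1 + \<alpha>) / 2) ^ n * exp (- (\<alpha> / 2) * u)"
      using \<alpha> that by (intro mult_mono power_mono) auto
    finally show ?thesis by simp
  qed
  then show ?case by (intro exI[of _ 1]) auto
next
  case (Suc k)
  then obtain C where C: "0 \<le> C"
    "\<And>n u. 0 \<le> u \<Longrightarrow> cmod ((gd ^^ n) (\<lambda>u. gbase k \<alpha> u) u) \<le> C * ((1 + \<alpha>) / 2) ^ n * exp (- (\<alpha> / 2) * u)"
    by blast
  let ?r = "(1 + \<alpha>) / 2"
  \<comment> \<open>The first entry of the maximum covers n = 0. The second is the least value for
    which the bound reproduces itself under one more derivative, (k + 1) C + \<alpha> D \<le> D r,
    and it needs r > \<alpha>.\<close>
  define D where "D = max (fact (Suc k) * (2 / \<alpha>) ^ Suc k) (real (Suc k) * C / (?r - \<alpha>))"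
  have rec: "real (Suc k) * C + \<alpha> * D \<le> D * ?r"
  proof -
    have "real (Suc k) * C / (?r - \<alpha>) \<le> D" by (simp add: D_def)
    moreover have "0 < ?r - \<alpha>" using \<alpha> by simp
    ultimately have "real (Suc k) * C \<le> D * (?r - \<alpha>)" by (simp only: pos_divide_le_eq)
    then show ?thesis by (simp add: algebra_simps)
  qed
  have D0: "0 \<le> D" unfolding D_def using \<alpha> by (simp add: le_max_iff_disj)
  have mem: "(\<lambda>u. gbase j \<alpha> u) \<in> gspan" for j by (rule gbase_in_gspan[OF \<alpha>])
  have "cmod ((gd ^^ n) (\<lambda>u. gbase (Suc k) \<alpha> u) u) \<le> D * ?r ^ n * exp (- (\<alpha> / 2) * u)" if u: "0 \<le> u" for n u
  proof (induction n)
    case 0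
    have "u ^ Suc k * exp (- \<alpha> * u) \<le> fact (Suc k) * (2 / \<alpha>) ^ Suc k * exp (- (\<alpha> / 2) * u)"
      by (rule power_exp_le[OF \<alpha>(1) u])
    also have "\<dots> \<le> D * exp (- (\<alpha> / 2) * u)"
      by (intro mult_right_mono) (auto simp: D_def)
    finally show ?case using u
      by (simp only: funpow_0 gbase_def norm_of_real abs_of_nonneg power_0 mult_1_right
          mult_nonneg_nonneg zero_le_power exp_ge_zero)
  next
    case (Suc n)
    \<comment> \<open>Taking out the innermost derivative gives a recursion in n whose inhomogeneous
      part is already controlled by the bound for the power k.\<close>
    have "(gd ^^ Suc n) (\<lambda>u. gbase (Suc k) \<alpha> u) = (gd ^^ n) (gd (\<lambda>u. gbase (Suc k) \<alpha> u))"
      by (simp add: funpow_swap1)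
    also have "\<dots> = (gd ^^ n) (\<lambda>u. of_nat (Suc k) * gbase k \<alpha> u - of_real \<alpha> * gbase (Suc k) \<alpha> u)"
      by (simp add: gd_gbase)
    also have "\<dots> = (\<lambda>u. of_nat (Suc k) * (gd ^^ n) (\<lambda>u. gbase k \<alpha> u) u - of_real \<alpha> * (gd ^^ n) (\<lambda>u. gbase (Suc k) \<alpha> u) u)"
      by (simp only: funpow_gd_diff[OF gspan_cmult[OF mem] gspan_cmult[OF mem]] funpow_gd_cmult[OF mem])
    finally have eq: "(gd ^^ Suc n) (\<lambda>u. gbase (Suc k) \<alpha> u) u
        = of_nat (Suc k) * (gd ^^ n) (\<lambda>u. gbase k \<alpha> u) u - of_real \<alpha> * (gd ^^ n) (\<lambda>u. gbase (Suc k) \<alpha> u) u"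
      by (rule fun_cong)
    have tri: "cmod (of_nat (Suc k) * a - of_real \<alpha> * b) \<le> real (Suc k) * cmod a + \<alpha> * cmod b" for a b
      using norm_triangle_ineq4[of "of_nat (Suc k) * a" "of_real \<alpha> * b"] \<alpha>(1)
      by (simp only: norm_mult norm_of_nat norm_of_real abs_of_pos)
    have "cmod ((gd ^^ Suc n) (\<lambda>u. gbase (Suc k) \<alpha> u) u)
        \<le> real (Suc k) * cmod ((gd ^^ n) (\<lambda>u. gbase k \<alpha> u) u) + \<alpha> * cmod ((gd ^^ n) (\<lambda>u. gbase (Suc k) \<alpha> u) u)"
      unfolding eq by (rule tri)
    also have "\<dots> \<le> real (Suc k) * (C * ?r ^ n * exp (- (\<alpha> / 2) * u)) + \<alpha> * (D * ?r ^ n * exp (- (\<alpha> / 2) * u))"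
      using \<alpha> C(2)[OF u] Suc by (intro add_mono mult_left_mono) auto
    also have "\<dots> = (real (Suc k) * C + \<alpha> * D) * (?r ^ n * exp (- (\<alpha> / 2) * u))"
      by (simp only: distrib_right mult.assoc)
    also have "\<dots> \<le> (D * ?r) * (?r ^ n * exp (- (\<alpha> / 2) * u))"
      using \<alpha> by (intro mult_right_mono[OF rec]) auto
    finally show ?case by (simp add: mult.assoc mult.left_commute)
  qed
  then show ?case using D0 by blast
qed

text \<open>A finite sum inherits the largest rate r and the smallest \<beta> among its terms. The
  factor \<open>r ^ n\<close> will make the series converge, while the exponential in u becomes a
  Gaussian in x and keeps everything in L2.\<close>

lemma gspan_decay:
  "g \<in> gspan \<Longrightarrow> \<exists>C r \<beta>. 0 \<le> C \<and> 0 < r \<and> r < 1 \<and> 0 < \<beta> \<and>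
     (\<forall>n. \<forall>u\<ge>0. cmod ((gd ^^ n) g u) \<le> C * r ^ n * exp (- \<beta> * u))"
proof (induction rule: gspan.induct)
  case zero
  have "(gd ^^ n) (\<lambda>u. 0) = (\<lambda>u. 0)" for n
    by (induction n) (auto intro!: gdI)
  then show ?case by (intro exI[of _ 0] exI[of _ "1/2"] exI[of _ 1]) auto
next
  case (step g \<alpha> c k)
  obtain C r \<beta> where g: "0 \<le> C" "0 < r" "r < 1" "0 < \<beta>"
    "\<And>n u. 0 \<le> u \<Longrightarrow> cmod ((gd ^^ n) g u) \<le> C * r ^ n * exp (- \<beta> * u)"
    using step.IH by blast
  obtain D where D: "0 \<le> D"
    "\<And>n u. 0 \<le> u \<Longrightarrow> cmod ((gd ^^ n) (\<lambda>u. gbase k \<alpha> u) u) \<le> D * ((1 + \<alpha>) / 2) ^ n * exp (- (\<alpha> / 2) * u)"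
    using gbase_decay[OF step(2,3), of k] by blast
  have mem: "(\<lambda>u. gbase k \<alpha> u) \<in> gspan" by (rule gbase_in_gspan[OF step(2,3)])
  define s where "s = max r ((1 + \<alpha>) / 2)"
  define \<gamma> where "\<gamma> = min \<beta> (\<alpha> / 2)"
  have "cmod ((gd ^^ n) (\<lambda>u. g u + c * gbase k \<alpha> u) u) \<le> (C + cmod c * D) * s ^ n * exp (- \<gamma> * u)"
    if u: "0 \<le> u" for n u
  proof -
    have "(gd ^^ n) (\<lambda>u. g u + c * gbase k \<alpha> u) u = (gd ^^ n) g u + c * (gd ^^ n) (\<lambda>u. gbase k \<alpha> u) u"
      by (simp only: funpow_gd_add[OF step(1) gspan_cmult[OF mem]] funpow_gd_cmult[OF mem])
    then have "cmod ((gd ^^ n) (\<lambda>u. g u + c * gbase k \<alpha> u) u)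
        \<le> cmod ((gd ^^ n) g u) + cmod c * cmod ((gd ^^ n) (\<lambda>u. gbase k \<alpha> u) u)"
      by (metis norm_mult norm_triangle_ineq)
    also have "\<dots> \<le> C * r ^ n * exp (- \<beta> * u) + cmod c * (D * ((1 + \<alpha>) / 2) ^ n * exp (- (\<alpha> / 2) * u))"
      using g(5)[OF u] D(2)[OF u] by (intro add_mono mult_left_mono) auto
    also have "\<dots> \<le> C * (s ^ n * exp (- \<gamma> * u)) + cmod c * (D * (s ^ n * exp (- \<gamma> * u)))"
    proof -
      have "r ^ n * exp (- \<beta> * u) \<le> s ^ n * exp (- \<gamma> * u)"
        using u g by (intro mult_mono power_mono) (simp_all add: s_def \<gamma>_def mult_right_mono)
      moreover have "((1 + \<alpha>) / 2) ^ n * exp (- (\<alpha> / 2) * u) \<le> s ^ n * exp (- \<gamma> * u)"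
        using u step(2) g(2) mult_right_mono[of \<gamma> "\<alpha> / 2" u]
        by (intro mult_mono power_mono) (simp_all add: s_def \<gamma>_def)
      ultimately show ?thesis
        using g(1) D(1) by (simp only: mult.assoc) (intro add_mono mult_left_mono; simp)
    qed
    finally show ?thesis by (simp add: algebra_simps)
  qed
  then show ?case using g D step(2,3)
    by (intro exI[of _ "C + cmod c * D"] exI[of _ s] exI[of _ \<gamma>]) (auto simp: s_def \<gamma>_def)
qed

section \<open>Exponential polynomials in the square of the position\<close>

definition lift :: "real \<Rightarrow> nat \<Rightarrow> (real \<Rightarrow> complex) \<Rightarrow> real \<Rightarrow> complex" where
  "lift \<epsilon> \<sigma> g x = complex_of_real (x ^ \<sigma>) * g (x\<^sup>2 / (2 * sqrt \<epsilon>))"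

text \<open>This is d/dx of \<open>lift\<close>, which flips the parity. The factor 2 u in the odd
  case is x du/dx for u = x^2 / (2 sqrt \<epsilon>), rewritten so that the result is again a
  lift.\<close>

definition lift_deriv :: "real \<Rightarrow> nat \<Rightarrow> (real \<Rightarrow> complex) \<Rightarrow> real \<Rightarrow> complex" where
  "lift_deriv \<epsilon> \<sigma> g = (if \<sigma> = 0 then lift \<epsilon> 1 (\<lambda>u. of_real (1 / sqrt \<epsilon>) * gd g u)
     else lift \<epsilon> 0 (\<lambda>u. g u + 2 * (of_real u * gd g u)))"

lemma lift_add: "lift \<epsilon> \<sigma> (\<lambda>u. g u + h u) x = lift \<epsilon> \<sigma> g x + lift \<epsilon> \<sigma> h x"
  by (simp add: lift_def distrib_left)

lemma lift_diff: "lift \<epsilon> \<sigma> (\<lambda>u. g u - h u) x = lift \<epsilon> \<sigma> g x - lift \<epsilon> \<sigma> h x"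
  by (simp add: lift_def right_diff_distrib)

lemma lift_cmult: "lift \<epsilon> \<sigma> (\<lambda>u. c * g u) x = c * lift \<epsilon> \<sigma> g x"
  by (simp add: lift_def mult.left_commute)

lemma lift_cnj: "lift \<epsilon> \<sigma> (\<lambda>u. cnj (g u)) x = cnj (lift \<epsilon> \<sigma> g x)"
  by (simp add: lift_def)

lemma lift_sum: "lift \<epsilon> \<sigma> (\<lambda>u. \<Sum>i\<in>I. g i u) x = (\<Sum>i\<in>I. lift \<epsilon> \<sigma> (g i) x)"
  by (simp add: lift_def sum_distrib_left)

lemma lift_minus: "lift \<epsilon> \<sigma> g (- x) = (- 1) ^ \<sigma> * lift \<epsilon> \<sigma> g x"
  by (simp add: lift_def power_minus[of x])

text \<open>Up to normalisation this is the density of the normal distribution with variance 1 / (2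
  c).\<close>

lemma gaussian_integrable:
  assumes "0 < c"
  shows "integrable lborel (\<lambda>x::real. exp (- c * x\<^sup>2))"
proof -
  define s where "s = sqrt (1 / (2 * c))"
  have s: "0 < s" "s\<^sup>2 = 1 / (2 * c)" using assms by (auto simp: s_def)
  have "integrable lborel (\<lambda>x. sqrt (2 * pi * s\<^sup>2) * normal_density 0 s x)"
    using s by auto
  moreover have "sqrt (2 * pi * s\<^sup>2) * normal_density 0 s x = exp (- c * x\<^sup>2)" for x
    using s assms by (simp add: normal_density_def field_simps)
  ultimately show ?thesis by simp
qed

context
  fixes \<epsilon> :: real
  assumes eps: "0 < \<epsilon>"
begin

lemma sqrt_eps_pos: "0 < sqrt \<epsilon>" using eps by simp

lemma complex_sqrt_eps_square: "complex_of_real (sqrt \<epsilon>) * complex_of_real (sqrt \<epsilon>) = complex_of_real \<epsilon>"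
  using eps by (metis of_real_mult real_sqrt_mult_self abs_of_pos)

lemma lift_continuous: "g \<in> gspan \<Longrightarrow> continuous_on A (lift \<epsilon> \<sigma> g)"
  unfolding lift_def
  by (intro continuous_intros continuous_on_compose2[OF gspan_continuous[of g UNIV]]) (use eps in auto)

lemma lift_measurable: "g \<in> gspan \<Longrightarrow> lift \<epsilon> \<sigma> g \<in> borel_measurable borel"
  by (intro borel_measurable_continuous_onI lift_continuous)

lemma lift_umult:
  "lift \<epsilon> \<sigma> (\<lambda>u. of_real u * g u) x = of_real (x\<^sup>2 / (2 * sqrt \<epsilon>)) * lift \<epsilon> \<sigma> g x"
  by (simp add: lift_def)

text \<open>Reduces square integrability of odd lifts to that of even ones: |x| \<le> 1 + x^2, and
  x^2 = 2 sqrt \<epsilon> u acts as a multiplication under which \<open>gspan\<close> is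
  closed.\<close>

lemma lift_1_bound: "cmod (lift \<epsilon> 1 g x)
  \<le> cmod (lift \<epsilon> 0 g x) + cmod (of_real (2 * sqrt \<epsilon>) * lift \<epsilon> 0 (\<lambda>u. of_real u * g u) x)"
proof -
  have "\<bar>x\<bar> \<le> 1 + x\<^sup>2"
    using zero_le_power2[of "\<bar>x\<bar> - 1"] by (simp add: power2_eq_square algebra_simps)
  then have "\<bar>x\<bar> * cmod (lift \<epsilon> 0 g x) \<le> (1 + x\<^sup>2) * cmod (lift \<epsilon> 0 g x)"
    by (rule mult_right_mono) simp
  moreover have "complex_of_real (2 * sqrt \<epsilon>) * lift \<epsilon> 0 (\<lambda>u. of_real u * g u) x = of_real (x\<^sup>2) * lift \<epsilon> 0 g x"
    using sqrt_eps_pos unfolding lift_umult by simp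
  moreover have "cmod (lift \<epsilon> 1 g x) = \<bar>x\<bar> * cmod (lift \<epsilon> 0 g x)"
    by (simp add: lift_def norm_mult)
  moreover have "cmod (of_real (x\<^sup>2) * lift \<epsilon> 0 g x) = x\<^sup>2 * cmod (lift \<epsilon> 0 g x)"
    by (simp only: norm_mult norm_of_real abs_of_nonneg zero_le_power2)
  ultimately show ?thesis by (simp add: distrib_right)
qed

lemma L2_gaussian_envelope:
  assumes "0 < \<beta>"
  shows "L2 (\<lambda>x. complex_of_real (C * exp (- \<beta> * (x\<^sup>2 / (2 * sqrt \<epsilon>)))))"
proof -
  have "(cmod (complex_of_real (C * exp (- \<beta> * (x\<^sup>2 / (2 * sqrt \<epsilon>))))))\<^sup>2 = C\<^sup>2 * exp (- (\<beta> / sqrt \<epsilon>) * x\<^sup>2)" for x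
    by (simp only: norm_of_real power2_abs power_mult_distrib exp_double[symmetric])
      (use eps in \<open>simp add: field_simps\<close>)
  moreover have "integrable lborel (\<lambda>x. C\<^sup>2 * exp (- (\<beta> / sqrt \<epsilon>) * x\<^sup>2))"
    by (intro integrable_mult_right gaussian_integrable) (use assms eps in auto)
  ultimately show ?thesis unfolding L2_def by auto
qed

lemma L2_lift_0:
  assumes "g \<in> gspan"
  shows "L2 (lift \<epsilon> 0 g)"
proof -
  obtain C r \<beta> where g: "0 \<le> C" "0 < \<beta>"
    "\<And>n u. 0 \<le> u \<Longrightarrow> cmod ((gd ^^ n) g u) \<le> C * r ^ n * exp (- \<beta> * u)"
    using gspan_decay[OF assms] by blast
  show ?thesis
  proof (rule L2_dominated[OF lift_measurable[OF assms] L2_gaussian_envelope[OF g(2), of C]])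
    fix x
    have "0 \<le> x\<^sup>2 / (2 * sqrt \<epsilon>)" using eps by simp
    from g(3)[OF this, of 0] show "cmod (lift \<epsilon> 0 g x)
        \<le> cmod (complex_of_real (C * exp (- \<beta> * (x\<^sup>2 / (2 * sqrt \<epsilon>)))))"
      using g(1) by (simp add: lift_def norm_mult)
  qed
qed

lemma L2_lift_1:
  assumes "g \<in> gspan"
  shows "L2 (lift \<epsilon> 1 g)"
proof (rule L2_dominated[OF lift_measurable[OF assms]])
  show "L2 (\<lambda>x. of_real (cmod (lift \<epsilon> 0 g x)) + of_real (cmod (of_real (2 * sqrt \<epsilon>) * lift \<epsilon> 0 (\<lambda>u. of_real u * g u) x)))"
    using L2_lift_0[OF assms] L2_cmult[OF L2_lift_0[OF gspan_umult[OF assms]], of "of_real (2 * sqrt \<epsilon>)"]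
    by (intro L2_add) (auto simp: L2_def)
  show "cmod (lift \<epsilon> 1 g x) \<le> cmod (of_real (cmod (lift \<epsilon> 0 g x))
      + of_real (cmod (of_real (2 * sqrt \<epsilon>) * lift \<epsilon> 0 (\<lambda>u. of_real u * g u) x)))" for x
    using lift_1_bound[of g x] by (simp only: of_real_add[symmetric] norm_of_real)
qed

lemma L2_lift: "g \<in> gspan \<Longrightarrow> \<sigma> \<le> 1 \<Longrightarrow> L2 (lift \<epsilon> \<sigma> g)"
  using L2_lift_0 L2_lift_1 by (cases \<sigma>) auto

lemma lift_deriv_0: "lift_deriv \<epsilon> 0 g = lift \<epsilon> 1 (\<lambda>u. of_real (1 / sqrt \<epsilon>) * gd g u)"
  and lift_deriv_1: "lift_deriv \<epsilon> 1 g = lift \<epsilon> 0 (\<lambda>u. g u + 2 * (of_real u * gd g u))"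
  by (simp_all add: lift_deriv_def)

lemma lift_0_has_derivative:
  assumes "g \<in> gspan"
  shows "(lift \<epsilon> 0 g has_vector_derivative lift_deriv \<epsilon> 0 g x) (at x)"
proof -
  have "((\<lambda>x. x\<^sup>2 / (2 * sqrt \<epsilon>)) has_vector_derivative x / sqrt \<epsilon>) (at x)"
    unfolding has_real_derivative_iff_has_vector_derivative[symmetric]
    using sqrt_eps_pos by (auto intro!: derivative_eq_intros simp: field_simps)
  from vector_diff_chain_at[OF this gspan_has_derivative[OF assms]]
  show ?thesis
    by (simp add: lift_deriv_0 lift_def[abs_def] o_def scaleR_conv_of_real mult_ac)
qed

lemma lift_1_has_derivative:
  assumes "g \<in> gspan"
  shows "(lift \<epsilon> 1 g has_vector_derivative lift_deriv \<epsilon> 1 g x) (at x)"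
proof -
  have id: "(complex_of_real has_vector_derivative 1) (at x)"
    using has_vector_derivative_of_real[of "\<lambda>x. x" 1 "at x"] by (simp add: has_vector_derivative_id)
  have "(\<lambda>x. of_real x * lift \<epsilon> 0 g x) = lift \<epsilon> 1 g"
    by (simp add: lift_def fun_eq_iff)
  moreover have "of_real x * lift_deriv \<epsilon> 0 g x + 1 * lift \<epsilon> 0 g x = lift_deriv \<epsilon> 1 g x"
    unfolding lift_deriv_0 lift_deriv_1 using sqrt_eps_pos
    by (simp add: lift_def field_simps power2_eq_square)
  ultimately show ?thesis
    using has_vector_derivative_mult[OF id lift_0_has_derivative[OF assms]] by simp
qed

lemma lift_has_derivative:
  "g \<in> gspan \<Longrightarrow> \<sigma> \<le> 1 \<Longrightarrow> (lift \<epsilon> \<sigma> g has_vector_derivative lift_deriv \<epsilon> \<sigma> g x) (at x)"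
  using lift_0_has_derivative lift_1_has_derivative by (cases "\<sigma> = 0") (auto simp: le_Suc_eq)

lemma lift_deriv_lift:
  assumes "g \<in> gspan" "\<sigma> \<le> 1"
  shows "\<exists>h\<in>gspan. \<exists>\<tau>\<le>1. lift_deriv \<epsilon> \<sigma> g = lift \<epsilon> \<tau> h"
proof (cases "\<sigma> = 0")
  case True
  then show ?thesis using gspan_cmult[OF gspan_gd[OF assms(1)]] lift_deriv_0 by blast
next
  case False
  then have "\<sigma> = 1" using assms by simp
  then show ?thesis
    using gspan_add[OF assms(1) gspan_cmult[OF gspan_umult[OF gspan_gd[OF assms(1)]]]] lift_deriv_1
    by (metis zero_le)
qed

lemma L2_lift_deriv: "g \<in> gspan \<Longrightarrow> \<sigma> \<le> 1 \<Longrightarrow> L2 (lift_deriv \<epsilon> \<sigma> g)"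
  using lift_deriv_lift L2_lift by metis

lemma lift_p_op: "g \<in> gspan \<Longrightarrow> \<sigma> \<le> 1 \<Longrightarrow> (lift \<epsilon> \<sigma> g, \<lambda>x. - \<i> * lift_deriv \<epsilon> \<sigma> g x) \<in> p_op"
  using lift_deriv_lift[of g \<sigma>] lift_continuous[of _ UNIV]
  by (intro p_opI L2_lift L2_lift_deriv lift_has_derivative) auto

lemma lift_deriv_add:
  "g \<in> gspan \<Longrightarrow> h \<in> gspan \<Longrightarrow>
    lift_deriv \<epsilon> \<sigma> (\<lambda>u. g u + h u) x = lift_deriv \<epsilon> \<sigma> g x + lift_deriv \<epsilon> \<sigma> h x"
  by (simp add: lift_deriv_def gd_add lift_def algebra_simps)

lemma lift_deriv_cmult:
  "g \<in> gspan \<Longrightarrow> lift_deriv \<epsilon> \<sigma> (\<lambda>u. c * g u) x = c * lift_deriv \<epsilon> \<sigma> g x"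
  by (simp add: lift_deriv_def gd_cmult lift_def algebra_simps)

text \<open>\<open>p_op_smooth_mult\<close> takes real weights, so single base functions come first.
  Its condition on x w holds because multiplication by x changes the parity and, for \<sigma> = 1,
  turns x^2 into a multiple of u.\<close>

lemma p_op_gbase:
  assumes p: "(f, m) \<in> p_op" and \<sigma>: "\<sigma> \<le> 1" and \<alpha>: "0 < \<alpha>" "\<alpha> < 1"
  shows "(LINT x|lborel. f x * lift_deriv \<epsilon> \<sigma> (gbase k \<alpha>) x)
      = - \<i> * (LINT x|lborel. m x * lift \<epsilon> \<sigma> (gbase k \<alpha>) x)"
proof -
  note g = gbase_in_gspan[OF \<alpha>, of k]
  define w where "w x = x ^ \<sigma> * ((1 / (2 * sqrt \<epsilon>) * x\<^sup>2) ^ k * exp ((- \<alpha> / (2 * sqrt \<epsilon>)) * x\<^sup>2))" for x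
  have sm: "smooth_alg w"
    unfolding w_def by (intro times smooth_alg_power ident const exp_comp)
  have w: "complex_of_real (w x) = lift \<epsilon> \<sigma> (gbase k \<alpha>) x" for x
    by (simp add: w_def lift_def gbase_def)
  have "((\<lambda>x. complex_of_real (w x)) has_vector_derivative complex_of_real (deriv w x)) (at x)" for x
    using smooth_alg_DERIV[OF sm, of x]
    by (intro has_vector_derivative_of_real) (simp add: has_real_derivative_iff_has_vector_derivative)
  then have w': "complex_of_real (deriv w x) = lift_deriv \<epsilon> \<sigma> (gbase k \<alpha>) x" for x
    using lift_has_derivative[OF g \<sigma>, of x] vector_derivative_unique_at unfolding w by metis
  have xw: "L2 (\<lambda>x. complex_of_real (x * w x))"
  proof (cases "\<sigma> = 0")
    case True
    then have "(\<lambda>x. complex_of_real (x * w x)) = lift \<epsilon> 1 (gbase k \<alpha>)"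
      by (simp add: w lift_def fun_eq_iff)
    then show ?thesis using L2_lift_1[OF g] by simp
  next
    case False
    then have "\<sigma> = 1" using \<sigma> by simp
    then have "(\<lambda>x. complex_of_real (x * w x))
        = (\<lambda>x. complex_of_real (2 * sqrt \<epsilon>) * lift \<epsilon> 0 (\<lambda>u. of_real u * gbase k \<alpha> u) x)"
      using sqrt_eps_pos unfolding of_real_mult[of _ "w _"] w by (simp add: lift_def fun_eq_iff power2_eq_square)
    then show ?thesis using L2_cmult[OF L2_lift_0[OF gspan_umult[OF g]]] by simp
  qed
  have "(LINT x|lborel. f x * complex_of_real (deriv w x))
      = - \<i> * (LINT x|lborel. m x * complex_of_real (w x))"
    by (rule p_op_smooth_mult[OF p sm]) (use xw L2_lift[OF g \<sigma>] L2_lift_deriv[OF g \<sigma>] in \<open>simp_all only: w w'\<close>)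
  then show ?thesis by (simp only: w w')
qed

text \<open>Extension to complex coefficients by linearity. As in \<open>p_op\<close>, the pairing
  is bilinear without conjugation, so inner products are treated by passing to the conjugate of g
  first.\<close>

lemma p_op_lift:
  assumes p: "(f, m) \<in> p_op" and \<sigma>: "\<sigma> \<le> 1" and g: "g \<in> gspan"
  shows "(LINT x|lborel. f x * lift_deriv \<epsilon> \<sigma> g x) = - \<i> * (LINT x|lborel. m x * lift \<epsilon> \<sigma> g x)"
  using g
proof induction
  case zero
  have "gd (\<lambda>u. 0) = (\<lambda>u. 0)" by (intro gdI) simp
  then show ?case by (simp add: lift_deriv_def lift_def)
next
  case (step g \<alpha> c k)
  note b = gbase_in_gspan[OF step(2,3), of k]
  note f = p_opD(1)[OF p] and m = p_opD(2)[OF p]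
  have "(LINT x|lborel. f x * lift_deriv \<epsilon> \<sigma> (\<lambda>u. g u + c * gbase k \<alpha> u) x)
      = (LINT x|lborel. f x * lift_deriv \<epsilon> \<sigma> g x + c * (f x * lift_deriv \<epsilon> \<sigma> (gbase k \<alpha>) x))"
    by (simp only: lift_deriv_add[OF step(1) gspan_cmult[OF b]] lift_deriv_cmult[OF b] distrib_left mult.left_commute)
  also have "\<dots> = (LINT x|lborel. f x * lift_deriv \<epsilon> \<sigma> g x) + c * (LINT x|lborel. f x * lift_deriv \<epsilon> \<sigma> (gbase k \<alpha>) x)"
    using integrable_L2_mult[OF f L2_lift_deriv[OF step(1) \<sigma>]] integrable_L2_mult[OF f L2_lift_deriv[OF b \<sigma>]]
    by simp
  also have "\<dots> = - \<i> * ((LINT x|lborel. m x * lift \<epsilon> \<sigma> g x) + c * (LINT x|lborel. m x * lift \<epsilon> \<sigma> (gbase k \<alpha>) x))"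
    unfolding step.IH p_op_gbase[OF p \<sigma> step(2,3)] by (simp add: algebra_simps)
  also have "(LINT x|lborel. m x * lift \<epsilon> \<sigma> g x) + c * (LINT x|lborel. m x * lift \<epsilon> \<sigma> (gbase k \<alpha>) x)
      = (LINT x|lborel. m x * lift \<epsilon> \<sigma> g x + c * (m x * lift \<epsilon> \<sigma> (gbase k \<alpha>) x))"
    using integrable_L2_mult[OF m L2_lift[OF step(1) \<sigma>]] integrable_L2_mult[OF m L2_lift[OF b \<sigma>]]
    by simp
  also have "\<dots> = (LINT x|lborel. m x * lift \<epsilon> \<sigma> (\<lambda>u. g u + c * gbase k \<alpha> u) x)"
    by (simp only: lift_add lift_cmult distrib_left mult.left_commute)
  finally show ?case .
qed

end

section \<open>Linear operators up to almost everywhere equality\<close>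

text \<open>What makes a graph a linear operator on classes modulo null sets, stated for
  representatives. The last two clauses matter most: \<open>op_app\<close> selects an arbitrary
  value, and a form built on it is well defined only if that choice cannot be seen by
  integrals.\<close>

definition linear_ae_op :: "((real \<Rightarrow> complex) \<times> (real \<Rightarrow> complex)) set \<Rightarrow> bool" where
  "linear_ae_op A \<longleftrightarrow>
    (\<forall>f g. (f, g) \<in> A \<longrightarrow> L2 f \<and> L2 g) \<and>
    (\<forall>f g f' g'. (f, g) \<in> A \<longrightarrow> (f', g') \<in> A \<longrightarrow> (\<lambda>x. f x + f' x, \<lambda>x. g x + g' x) \<in> A) \<and>
    (\<forall>c f g. (f, g) \<in> A \<longrightarrow> (\<lambda>x. c * f x, \<lambda>x. c * g x) \<in> A) \<and>
    (\<forall>f g f' g'. (f, g) \<in> A \<longrightarrow> L2 f' \<longrightarrow> L2 g' \<longrightarrow> ae_eq f f' \<longrightarrow> ae_eq g g' \<longrightarrow> (f', g') \<in> A) \<and>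
    (\<forall>f g f' g'. (f, g) \<in> A \<longrightarrow> (f', g') \<in> A \<longrightarrow> ae_eq f f' \<longrightarrow> ae_eq g g')"

lemma linear_ae_opI:
  assumes "\<And>f g. (f, g) \<in> A \<Longrightarrow> L2 f" "\<And>f g. (f, g) \<in> A \<Longrightarrow> L2 g"
    and "\<And>f g f' g'. (f, g) \<in> A \<Longrightarrow> (f', g') \<in> A \<Longrightarrow> (\<lambda>x. f x + f' x, \<lambda>x. g x + g' x) \<in> A"
    and "\<And>c f g. (f, g) \<in> A \<Longrightarrow> (\<lambda>x. c * f x, \<lambda>x. c * g x) \<in> A"
    and "\<And>f g f' g'. (f, g) \<in> A \<Longrightarrow> L2 f' \<Longrightarrow> L2 g' \<Longrightarrow> ae_eq f f' \<Longrightarrow> ae_eq g g' \<Longrightarrow> (f', g') \<in> A"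
    and "\<And>f g f' g'. (f, g) \<in> A \<Longrightarrow> (f', g') \<in> A \<Longrightarrow> ae_eq f f' \<Longrightarrow> ae_eq g g'"
  shows "linear_ae_op A"
  unfolding linear_ae_op_def by (intro conjI allI impI) (fact assms)+

lemma linear_ae_opD:
  assumes "linear_ae_op A"
  shows "(f, g) \<in> A \<Longrightarrow> L2 f" "(f, g) \<in> A \<Longrightarrow> L2 g"
    and "(f, g) \<in> A \<Longrightarrow> (f', g') \<in> A \<Longrightarrow> (\<lambda>x. f x + f' x, \<lambda>x. g x + g' x) \<in> A"
    and "(f, g) \<in> A \<Longrightarrow> (\<lambda>x. c * f x, \<lambda>x. c * g x) \<in> A"
    and "(f, g) \<in> A \<Longrightarrow> L2 f' \<Longrightarrow> L2 g' \<Longrightarrow> ae_eq f f' \<Longrightarrow> ae_eq g g' \<Longrightarrow> (f', g') \<in> A"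
    and "(f, g) \<in> A \<Longrightarrow> (f', g') \<in> A \<Longrightarrow> ae_eq f f' \<Longrightarrow> ae_eq g g'"
  using assms unfolding linear_ae_op_def by meson+

lemma linear_ae_op_comp:
  assumes A: "linear_ae_op A" and B: "linear_ae_op B"
  shows "linear_ae_op (A O B)"
proof (rule linear_ae_opI)
  note a = linear_ae_opD[OF A] and b = linear_ae_opD[OF B]
  fix f g assume "(f, g) \<in> A O B"
  then obtain m where m: "(f, m) \<in> A" "(m, g) \<in> B" by blast
  show "L2 f" by (rule a(1)[OF m(1)])
  show "L2 g" by (rule b(2)[OF m(2)])
  show "(\<lambda>x. c * f x, \<lambda>x. c * g x) \<in> A O B" for c
    using a(4)[OF m(1)] b(4)[OF m(2)] by blast
  show "(f', g') \<in> A O B" if "L2 f'" "L2 g'" "ae_eq f f'" "ae_eq g g'" for f' g'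
    using a(5)[OF m(1) that(1) a(2)[OF m(1)] that(3) ae_eq_refl]
      b(5)[OF m(2) b(1)[OF m(2)] that(2) ae_eq_refl that(4)] by blast
  fix f' g' assume "(f', g') \<in> A O B"
  then obtain m' where m': "(f', m') \<in> A" "(m', g') \<in> B" by blast
  show "(\<lambda>x. f x + f' x, \<lambda>x. g x + g' x) \<in> A O B"
    using a(3)[OF m(1) m'(1)] b(3)[OF m(2) m'(2)] by blast
  assume "ae_eq f f'"
  from b(6)[OF m(2) m'(2) a(6)[OF m(1) m'(1) this]] show "ae_eq g g'" .
qed

text \<open>The zeroth power is excluded because \<open>Id\<close> also relates functions outside L2
  and is not closed under almost everywhere equality. The series uses odd powers, which are
  covered.\<close>

lemma linear_ae_op_relpow: "linear_ae_op A \<Longrightarrow> linear_ae_op (A ^^ Suc n)"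
proof (induction n)
  case (Suc n)
  then show ?case using linear_ae_op_comp[of "A ^^ Suc n" A] by simp
qed simp

lemma ae_eq_add: "ae_eq f f' \<Longrightarrow> ae_eq g g' \<Longrightarrow> ae_eq (\<lambda>x. f x + g x) (\<lambda>x. f' x + g' x)"
  unfolding ae_eq_def by (elim AE_mp) (auto elim!: AE_mp)

lemma ae_eq_cmult: "ae_eq f f' \<Longrightarrow> ae_eq (\<lambda>x. c * f x) (\<lambda>x. c * f' x)"
  unfolding ae_eq_def by (elim AE_mp) auto

lemma ae_eq_cnj: "ae_eq f f' \<Longrightarrow> ae_eq (\<lambda>x. cnj (f x)) (\<lambda>x. cnj (f' x))"
  unfolding ae_eq_def by (elim AE_mp) auto

lemma linear_ae_op_p_op: "linear_ae_op p_op"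
proof (rule linear_ae_opI)
  fix f g f' g' assume p: "(f, g) \<in> p_op"
  show "(\<lambda>x. c * f x, \<lambda>x. c * g x) \<in> p_op" for c
    using p_opD[OF p] by (auto simp: p_op_def L2_cmult mult.assoc)
  show "(f', g') \<in> p_op" if "L2 f'" "L2 g'" "ae_eq f f'" "ae_eq g g'"
    by (rule p_op_cong[OF p that])
  assume p': "(f', g') \<in> p_op"
  show "ae_eq g g'" if "ae_eq f f'"
    by (rule p_op_unique[OF p p' that])
  show "(\<lambda>x. f x + f' x, \<lambda>x. g x + g' x) \<in> p_op"
    unfolding p_op_def
  proof (clarify, intro conjI allI impI)
    fix \<phi> assume t: "test_fun \<phi>"
    note i = integrable_L2_mult[OF _ L2_test_fun[OF t]] integrable_L2_mult[OF _ L2_test_fun_deriv[OF t]]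
    show "(LINT x|lborel. (f x + f' x) * complex_of_real (deriv \<phi> x))
        = - \<i> * (LINT x|lborel. (g x + g' x) * complex_of_real (\<phi> x))"
      using p_opD[OF p] p_opD[OF p'] t i by (simp add: distrib_right distrib_left)
  qed (auto intro!: L2_add p_opD[OF p] p_opD[OF p'])
qed (auto intro: p_opD)

lemma qinv_op_iff: "(m, h) \<in> qinv_op \<longleftrightarrow> L2 m \<and> L2 h \<and> (AE x in lborel. m x = complex_of_real x * h x)"
  by (auto simp: qinv_op_def q_op_def)

lemma linear_ae_op_q_op: "linear_ae_op q_op"
proof (rule linear_ae_opI)
  fix f g f' g' assume p: "(f, g) \<in> q_op"
  then have g: "AE x in lborel. g x = complex_of_real x * f x" by (simp add: q_op_def)
  show "(\<lambda>x. c * f x, \<lambda>x. c * g x) \<in> q_op" for c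
    using p by (auto simp: q_op_def L2_cmult mult.left_commute elim!: AE_mp)
  show "(f', g') \<in> q_op" if "L2 f'" "L2 g'" "ae_eq f f'" "ae_eq g g'"
  proof -
    have "AE x in lborel. g' x = complex_of_real x * f' x"
      using g that(3,4) unfolding ae_eq_def by eventually_elim simp
    then show ?thesis using that by (simp add: q_op_def)
  qed
  assume p': "(f', g') \<in> q_op"
  then have g': "AE x in lborel. g' x = complex_of_real x * f' x" by (simp add: q_op_def)
  show "ae_eq g g'" if "ae_eq f f'"
    using g g' that unfolding ae_eq_def by eventually_elim simp
  have "AE x in lborel. g x + g' x = complex_of_real x * (f x + f' x)"
    using g g' by eventually_elim (simp add: distrib_left)
  then show "(\<lambda>x. f x + f' x, \<lambda>x. g x + g' x) \<in> q_op"
    using p p' by (simp add: q_op_def L2_add)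
qed (auto simp: q_op_def)

lemma linear_ae_op_qinv_op: "linear_ae_op qinv_op"
proof (rule linear_ae_opI)
  note q = linear_ae_opD[OF linear_ae_op_q_op]
  fix f g f' g' assume p: "(f, g) \<in> qinv_op"
  then have p_: "(g, f) \<in> q_op" by (simp add: qinv_op_def)
  show "L2 f" "L2 g" using q(1,2)[OF p_] by auto
  show "(\<lambda>x. c * f x, \<lambda>x. c * g x) \<in> qinv_op" for c
    using q(4)[OF p_] by (simp add: qinv_op_def)
  show "(f', g') \<in> qinv_op" if "L2 f'" "L2 g'" "ae_eq f f'" "ae_eq g g'"
    using q(5)[OF p_ that(2,1,4,3)] by (simp add: qinv_op_def)
  assume p': "(f', g') \<in> qinv_op"
  then have p'_: "(g', f') \<in> q_op" by (simp add: qinv_op_def)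
  show "(\<lambda>x. f x + f' x, \<lambda>x. g x + g' x) \<in> qinv_op"
    using q(3)[OF p_ p'_] by (simp add: qinv_op_def)
  assume e: "ae_eq f f'"
  have "AE x in lborel. f x = complex_of_real x * g x" "AE x in lborel. f' x = complex_of_real x * g' x"
    using p p' by (simp_all add: qinv_op_iff)
  moreover have "AE x in lborel. x \<noteq> (0::real)" by (rule AE_lborel_singleton)
  ultimately show "ae_eq g g'"
    using e unfolding ae_eq_def by eventually_elim auto
qed

lemma linear_ae_op_t_op: "linear_ae_op t_op"
  unfolding t_op_def by (intro linear_ae_op_comp linear_ae_op_p_op linear_ae_op_qinv_op)

text \<open>The derivative of the bump vanishes outside (a, b), which has a positive distance
  \<delta> from 0, so the division by x costs at most a factor 1 / \<delta>. This supplies enough of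
  the domain of \<open>t_op\<close> to make its adjoint single-valued.\<close>

lemma bump_t_op:
  assumes n: "0 < n" and ab: "a < b" "0 < a \<or> b < 0"
  shows "\<exists>h. (\<lambda>x. complex_of_real (bump n a b x), h) \<in> t_op"
proof -
  let ?f = "\<lambda>x. complex_of_real (bump n a b x)"
  let ?f' = "\<lambda>x. complex_of_real (deriv (bump n a b) x)"
  have t: "test_fun (bump n a b)" using n ab by (intro test_fun_bump) auto
  have cont: "continuous_on UNIV (deriv (bump n a b))"
    by (intro smooth_alg_continuous smooth_alg_deriv smooth_alg_bump)
  have "(?f has_vector_derivative ?f' x) (at x)" for x
    using test_fun_DERIV[OF t, of x]
    by (intro has_vector_derivative_of_real) (simp add: has_real_derivative_iff_has_vector_derivative)
  then have p: "(?f, \<lambda>x. - \<i> * ?f' x) \<in> p_op"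
    using cont by (intro p_opI L2_test_fun L2_test_fun_deriv t continuous_intros)
  obtain \<delta> where \<delta>: "0 < \<delta>" "\<And>x. x \<in> {a<..<b} \<Longrightarrow> \<delta> \<le> \<bar>x\<bar>"
    using ab(2)
  proof
    assume "0 < a"
    then show ?thesis by (intro that[of a]) auto
  next
    assume "b < 0"
    then show ?thesis by (intro that[of "- b"]) auto
  qed
  let ?h = "\<lambda>x. (- \<i> * ?f' x) / complex_of_real x"
  have "L2 ?h"
  proof (rule L2_dominated)
    show "?h \<in> borel_measurable borel"
      using borel_measurable_continuous_onI[OF cont] by measurable
    show "L2 (\<lambda>x. complex_of_real (1 / \<delta>) * ?f' x)"
      by (intro L2_cmult L2_test_fun_deriv t)
    fix x
    show "cmod (?h x) \<le> cmod (complex_of_real (1 / \<delta>) * ?f' x)"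
    proof (cases "x \<in> {a<..<b}")
      case True
      have "\<bar>deriv (bump n a b) x\<bar> / \<bar>x\<bar> \<le> \<bar>deriv (bump n a b) x\<bar> / \<delta>"
        using \<delta>(1) \<delta>(2)[OF True] by (intro divide_left_mono) auto
      then show ?thesis using \<delta>(1) by (simp add: norm_mult norm_divide)
    next
      case False
      then have "deriv (bump n a b) x = 0" using n ab by (intro deriv_bump_outside) auto
      then show ?thesis by simp
    qed
  qed
  moreover have "AE x in lborel. - \<i> * ?f' x = complex_of_real x * ?h x"
    using AE_lborel_singleton[of 0] by eventually_elim simp
  ultimately have "(\<lambda>x. - \<i> * ?f' x, ?h) \<in> qinv_op"
    unfolding qinv_op_iff using p_opD(2)[OF p] by blast
  then show ?thesis using p unfolding t_op_def by blast
qed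

lemma l2_inner_cong:
  assumes "ae_eq f f'" "ae_eq g g'" "L2 f" "L2 f'" "L2 g" "L2 g'"
  shows "l2_inner f g = l2_inner f' g'"
  unfolding l2_inner_def
proof (rule integral_cong_AE)
  show "(\<lambda>x. cnj (f x) * g x) \<in> borel_measurable lborel" "(\<lambda>x. cnj (f' x) * g' x) \<in> borel_measurable lborel"
    using integrable_L2_mult[OF L2_cnj, of f g] integrable_L2_mult[OF L2_cnj, of f' g'] assms by auto
  show "AE x in lborel. cnj (f x) * g x = cnj (f' x) * g' x"
    using assms(1,2) unfolding ae_eq_def by eventually_elim simp
qed

lemma l2_inner_add_right: "L2 f \<Longrightarrow> L2 g \<Longrightarrow> L2 h \<Longrightarrow> l2_inner f (\<lambda>x. g x + h x) = l2_inner f g + l2_inner f h"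
  unfolding l2_inner_def using integrable_L2_mult[OF L2_cnj] by (simp add: distrib_left)

lemma l2_inner_add_left: "L2 f \<Longrightarrow> L2 g \<Longrightarrow> L2 h \<Longrightarrow> l2_inner (\<lambda>x. f x + g x) h = l2_inner f h + l2_inner g h"
  unfolding l2_inner_def using integrable_L2_mult[OF L2_cnj] by (simp add: distrib_right)

lemma l2_inner_diff_right: "L2 f \<Longrightarrow> L2 g \<Longrightarrow> L2 h \<Longrightarrow> l2_inner f (\<lambda>x. g x - h x) = l2_inner f g - l2_inner f h"
  unfolding l2_inner_def using integrable_L2_mult[OF L2_cnj] by (simp add: right_diff_distrib)

lemma l2_inner_cmult_right: "l2_inner f (\<lambda>x. c * g x) = c * l2_inner f g"
  unfolding l2_inner_def by (simp add: mult.left_commute)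

lemma l2_inner_cmult_left: "l2_inner (\<lambda>x. c * f x) g = cnj c * l2_inner f g"
  unfolding l2_inner_def by (simp add: mult.assoc)

lemma cnj_l2_inner: "cnj (l2_inner f g) = l2_inner g f"
  unfolding l2_inner_def by (subst Bochner_Integration.integral_cnj[symmetric]) (simp add: mult.commute)

lemma adjoint_opD:
  assumes "(u, v) \<in> adjoint_op A"
  shows "L2 u" "L2 v" "(f, g) \<in> A \<Longrightarrow> l2_inner u g = l2_inner v f"
  using assms by (auto simp: adjoint_op_def)

text \<open>The hypothesis \<open>dense\<close> stands in for density of the domain: v is determined
  almost everywhere by its pairings with bumps off the origin, by
  \<open>ae_eqI_bump\<close>.\<close>

lemma linear_ae_op_adjoint:
  assumes A: "linear_ae_op A"
    and dense: "\<And>n a b. 0 < n \<Longrightarrow> a < b \<Longrightarrow> 0 < a \<or> b < 0 \<Longrightarrow> \<exists>h. (\<lambda>x. complex_of_real (bump n a b x), h) \<in> A"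
  shows "linear_ae_op (adjoint_op A)"
proof (rule linear_ae_opI)
  note a = linear_ae_opD[OF A]
  fix u v u' v' assume uv: "(u, v) \<in> adjoint_op A"
  note d = adjoint_opD[OF uv]
  show "L2 u" "L2 v" by (fact d)+
  show "(\<lambda>x. c * u x, \<lambda>x. c * v x) \<in> adjoint_op A" for c
    using d by (auto simp: adjoint_op_def L2_cmult l2_inner_cmult_left)
  show cong: "(u', v') \<in> adjoint_op A" if uv: "(u, v) \<in> adjoint_op A" and *: "L2 u'" "L2 v'" "ae_eq u u'" "ae_eq v v'"
    for u v u' v'
  proof -
    note d = adjoint_opD[OF uv]
    have "l2_inner u' g = l2_inner v' f" if fg: "(f, g) \<in> A" for f g
      using d(3)[OF fg] l2_inner_cong[OF *(3) ae_eq_refl d(1) *(1) a(2)[OF fg] a(2)[OF fg]]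
        l2_inner_cong[OF *(4) ae_eq_refl d(2) *(2) a(1)[OF fg] a(1)[OF fg]] by simp
    then show ?thesis using * by (auto simp: adjoint_op_def)
  qed
  assume uv': "(u', v') \<in> adjoint_op A"
  note d' = adjoint_opD[OF uv']
  have "l2_inner (\<lambda>x. u x + u' x) g = l2_inner (\<lambda>x. v x + v' x) f" if fg: "(f, g) \<in> A" for f g
    using d(3)[OF fg] d'(3)[OF fg] a(1,2)[OF fg] d d' by (simp add: l2_inner_add_left)
  then show "(\<lambda>x. u x + u' x, \<lambda>x. v x + v' x) \<in> adjoint_op A"
    using d d' by (auto simp: adjoint_op_def L2_add)
  assume e: "ae_eq u u'"
  \<comment> \<open>The inner product is antilinear in its first slot, so pairing with the real
    bumps tests the conjugates.\<close>
  have "ae_eq (\<lambda>x. cnj (v x)) (\<lambda>x. cnj (v' x))"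
  proof (rule ae_eqI_bump)
    fix n a b :: real assume "0 < n" "a < b" "0 < a \<or> b < 0"
    from dense[OF this] obtain h where h: "(\<lambda>x. complex_of_real (bump n a b x), h) \<in> A" by blast
    have "l2_inner u h = l2_inner u' h"
      by (rule l2_inner_cong[OF e ae_eq_refl d(1) d'(1)]) (rule a(2)[OF h])+
    then have "l2_inner v (\<lambda>x. complex_of_real (bump n a b x)) = l2_inner v' (\<lambda>x. complex_of_real (bump n a b x))"
      using d(3)[OF h] d'(3)[OF h] by simp
    then show "(LINT x|lborel. cnj (v x) * complex_of_real (bump n a b x))
        = (LINT x|lborel. cnj (v' x) * complex_of_real (bump n a b x))"
      by (simp add: l2_inner_def)
  qed (intro L2_cnj d d')+
  from ae_eq_cnj[OF this] show "ae_eq v v'" by simp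
qed

section \<open>Convergence in norm and the operators defined by the series\<close>

definition l2_tendsto :: "(nat \<Rightarrow> real \<Rightarrow> complex) \<Rightarrow> (real \<Rightarrow> complex) \<Rightarrow> bool" where
  "l2_tendsto F L \<longleftrightarrow> (\<lambda>N. l2_norm (\<lambda>x. F N x - L x)) \<longlonglongrightarrow> 0"

lemma l2_tendsto_iff:
  "l2_tendsto F L \<longleftrightarrow> (\<lambda>N. LINT x|lborel. (cmod (F N x - L x))\<^sup>2) \<longlonglongrightarrow> 0"
proof
  assume "l2_tendsto F L"
  from tendsto_power[OF this[unfolded l2_tendsto_def], of 2]
  show "(\<lambda>N. LINT x|lborel. (cmod (F N x - L x))\<^sup>2) \<longlonglongrightarrow> 0"
    by (simp add: l2_norm_def)
next
  assume "(\<lambda>N. LINT x|lborel. (cmod (F N x - L x))\<^sup>2) \<longlonglongrightarrow> 0"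
  from tendsto_real_sqrt[OF this] show "l2_tendsto F L"
    by (simp add: l2_norm_def l2_tendsto_def)
qed

text \<open>The factor 2 replaces the triangle inequality of the norm; this is enough for statements
  about convergence to 0.\<close>

lemma l2_square_add_le:
  assumes "L2 f" "L2 g"
  shows "(LINT x|lborel. (cmod (f x + g x))\<^sup>2)
    \<le> 2 * (LINT x|lborel. (cmod (f x))\<^sup>2) + 2 * (LINT x|lborel. (cmod (g x))\<^sup>2)"
proof -
  have "(LINT x|lborel. (cmod (f x + g x))\<^sup>2)
      \<le> (LINT x|lborel. 2 * (cmod (f x))\<^sup>2 + 2 * (cmod (g x))\<^sup>2)"
    using L2D(2)[OF L2_add[OF assms]] assms cmod_add_square_le
    by (intro integral_mono) (auto simp: L2_def)
  then show ?thesis using assms by (simp add: L2_def)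
qed

lemma l2_tendsto_add:
  assumes F: "l2_tendsto F L" "\<And>N. L2 (F N)" "L2 L" and G: "l2_tendsto G M" "\<And>N. L2 (G N)" "L2 M"
  shows "l2_tendsto (\<lambda>N x. F N x + G N x) (\<lambda>x. L x + M x)"
  unfolding l2_tendsto_iff
proof (rule tendsto_sandwich[where f = "\<lambda>_. 0" and h = "\<lambda>N. 2 * (LINT x|lborel. (cmod (F N x - L x))\<^sup>2) + 2 * (LINT x|lborel. (cmod (G N x - M x))\<^sup>2)"])
  show "(\<lambda>N. 2 * (LINT x|lborel. (cmod (F N x - L x))\<^sup>2) + 2 * (LINT x|lborel. (cmod (G N x - M x))\<^sup>2)) \<longlonglongrightarrow> 0"
    using F(1) G(1) unfolding l2_tendsto_iff by (auto intro!: tendsto_eq_intros)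
  show "\<forall>\<^sub>F N in sequentially. (LINT x|lborel. (cmod (F N x + G N x - (L x + M x)))\<^sup>2)
      \<le> 2 * (LINT x|lborel. (cmod (F N x - L x))\<^sup>2) + 2 * (LINT x|lborel. (cmod (G N x - M x))\<^sup>2)"
    using l2_square_add_le[OF L2_diff[OF F(2,3)] L2_diff[OF G(2,3)]]
    by (intro always_eventually allI) (simp add: algebra_simps)
qed auto

lemma l2_tendsto_cmult: "l2_tendsto F L \<Longrightarrow> l2_tendsto (\<lambda>N x. c * F N x) (\<lambda>x. c * L x)"
  unfolding l2_tendsto_iff right_diff_distrib[symmetric] norm_mult power_mult_distrib
  using tendsto_mult_left[of _ 0 _ "(cmod c)\<^sup>2"] by simp

text \<open>The differences F N - G N vanish almost everywhere and converge to L - M, so the squared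
  norm of L - M is a constant sequence with limit 0.\<close>

lemma l2_tendsto_unique:
  assumes F: "l2_tendsto F L" "\<And>N. L2 (F N)" "L2 L" and G: "l2_tendsto G M" "\<And>N. L2 (G N)" "L2 M"
    and eq: "\<And>N. ae_eq (F N) (G N)"
  shows "ae_eq L M"
proof -
  have zero: "ae_eq (\<lambda>x. F N x - G N x) (\<lambda>x. 0)" for N
    using eq[of N] by (simp add: ae_eq_def)
  have "l2_tendsto (\<lambda>N x. F N x + (- 1) * G N x) (\<lambda>x. L x + (- 1) * M x)"
    by (rule l2_tendsto_add[OF F l2_tendsto_cmult[OF G(1)] L2_cmult[OF G(2)] L2_cmult[OF G(3)]])
  then have "(\<lambda>N. LINT x|lborel. (cmod ((F N x - G N x) - (L x - M x)))\<^sup>2) \<longlonglongrightarrow> 0"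
    by (simp add: l2_tendsto_iff)
  moreover have "(LINT x|lborel. (cmod ((F N x - G N x) - (L x - M x)))\<^sup>2) = (LINT x|lborel. (cmod (L x - M x))\<^sup>2)" for N
  proof (rule integral_cong_AE)
    show "(\<lambda>x. (cmod ((F N x - G N x) - (L x - M x)))\<^sup>2) \<in> borel_measurable lborel"
      "(\<lambda>x. (cmod (L x - M x))\<^sup>2) \<in> borel_measurable lborel"
      by (intro borel_measurable_integrable L2D(2) L2_diff F G)+
    show "AE x in lborel. (cmod ((F N x - G N x) - (L x - M x)))\<^sup>2 = (cmod (L x - M x))\<^sup>2"
      using zero[of N] unfolding ae_eq_def by eventually_elim (simp add: norm_minus_commute)
  qed
  ultimately have "(LINT x|lborel. (cmod (L x - M x))\<^sup>2) = 0"
    by (simp add: LIMSEQ_const_iff)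
  then have "AE x in lborel. (cmod (L x - M x))\<^sup>2 = 0"
    using integral_nonneg_eq_0_iff_AE[OF L2D(2)[OF L2_diff[OF F(3) G(3)]]] by simp
  then show ?thesis by (simp add: ae_eq_def)
qed

lemma S_gen_iff:
  "(f, g) \<in> S_gen \<epsilon> T P \<longleftrightarrow> P f \<and>
     (\<exists>u L. (\<forall>n. (f, u n) \<in> T ^^ Suc (2 * n)) \<and> L2 L \<and>
        l2_tendsto (\<lambda>N x. \<Sum>n\<le>N. complex_of_real ((-1) ^ n / real (2 * n + 1) * sqrt \<epsilon> ^ (2 * n + 1)) * u n x) L \<and>
        L2 g \<and> ae_eq g (\<lambda>x. - complex_of_real (1 / sqrt \<epsilon>) * L x))"
  unfolding S_gen_def l2_tendsto_def by simp

text \<open>The positive powers of T are single-valued almost everywhere, hence so are the partial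
  sums and, by uniqueness of limits in norm, the sum of the series. The conditions on P are met by
  the even and by the odd subspace.\<close>

lemma linear_ae_op_S_gen:
  assumes T: "linear_ae_op T"
    and P: "\<And>f. P f \<Longrightarrow> L2 f" "\<And>f g. P f \<Longrightarrow> P g \<Longrightarrow> P (\<lambda>x. f x + g x)" "\<And>c f. P f \<Longrightarrow> P (\<lambda>x. c * f x)"
      "\<And>f g. P f \<Longrightarrow> L2 g \<Longrightarrow> ae_eq f g \<Longrightarrow> P g"
  shows "linear_ae_op (S_gen \<epsilon> T P)"
proof (rule linear_ae_opI)
  define c where "c n = complex_of_real ((-1) ^ n / real (2 * n + 1) * sqrt \<epsilon> ^ (2 * n + 1))" for n :: nat
  define s where "s u N x = (\<Sum>n\<le>N. c n * u n x)" for u :: "nat \<Rightarrow> real \<Rightarrow> complex" and N x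
  note iff = S_gen_iff[where \<epsilon> = \<epsilon> and T = T and P = P, folded c_def s_def]
  note t = linear_ae_opD[OF linear_ae_op_relpow[OF T]]
  have L2s: "L2 (s u N)" if "\<forall>n. (f, u n) \<in> T ^^ Suc (2 * n)" for f u N
    unfolding s_def by (intro L2_sum L2_cmult t(2)[OF spec[OF that]])
  have scal: "s (\<lambda>n x. k * u n x) = (\<lambda>N x. k * s u N x)" for k u
    by (simp add: s_def[abs_def] sum_distrib_left mult.left_commute)
  have add: "s (\<lambda>n x. u n x + v n x) = (\<lambda>N x. s u N x + s v N x)" for u v
    by (simp add: s_def[abs_def] sum.distrib distrib_left)
  fix f g assume "(f, g) \<in> S_gen \<epsilon> T P"
  then obtain u L where f: "P f" and u: "\<forall>n. (f, u n) \<in> T ^^ Suc (2 * n)" and L: "L2 L" "l2_tendsto (s u) L"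
    and g: "L2 g" "ae_eq g (\<lambda>x. - complex_of_real (1 / sqrt \<epsilon>) * L x)"
    unfolding iff by blast
  show "L2 f" by (rule P(1)[OF f])
  show "L2 g" by (rule g(1))
  show "(\<lambda>x. k * f x, \<lambda>x. k * g x) \<in> S_gen \<epsilon> T P" for k
    unfolding iff
  proof (intro conjI exI allI)
    show "P (\<lambda>x. k * f x)" by (rule P(3)[OF f])
    show "L2 (\<lambda>x. k * L x)" "L2 (\<lambda>x. k * g x)" by (intro L2_cmult L g)+
    show "(\<lambda>x. k * f x, (\<lambda>n x. k * u n x) n) \<in> T ^^ Suc (2 * n)" for n
      by (rule t(4)[OF spec[OF u]])
    show "l2_tendsto (s (\<lambda>n x. k * u n x)) (\<lambda>x. k * L x)"
      unfolding scal by (rule l2_tendsto_cmult[OF L(2)])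
    show "ae_eq (\<lambda>x. k * g x) (\<lambda>x. - complex_of_real (1 / sqrt \<epsilon>) * (k * L x))"
      using ae_eq_cmult[OF g(2), of k] by (simp add: mult.left_commute)
  qed
  show "(f', g') \<in> S_gen \<epsilon> T P" if *: "L2 f'" "L2 g'" "ae_eq f f'" "ae_eq g g'" for f' g'
    unfolding iff
  proof (intro conjI exI allI)
    show "P f'" by (rule P(4)[OF f *(1,3)])
    show "(f', u n) \<in> T ^^ Suc (2 * n)" for n
      by (rule t(5)[OF spec[OF u] *(1) t(2)[OF spec[OF u]] *(3) ae_eq_refl])
    show "L2 L" "l2_tendsto (s u) L" "L2 g'" by fact+
    show "ae_eq g' (\<lambda>x. - complex_of_real (1 / sqrt \<epsilon>) * L x)"
      by (rule ae_eq_trans[OF ae_eq_sym[OF *(4)] g(2)])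
  qed
  fix f' g' assume "(f', g') \<in> S_gen \<epsilon> T P"
  then obtain u' L' where f': "P f'" and u': "\<forall>n. (f', u' n) \<in> T ^^ Suc (2 * n)" and L': "L2 L'" "l2_tendsto (s u') L'"
    and g': "L2 g'" "ae_eq g' (\<lambda>x. - complex_of_real (1 / sqrt \<epsilon>) * L' x)"
    unfolding iff by blast
  show "(\<lambda>x. f x + f' x, \<lambda>x. g x + g' x) \<in> S_gen \<epsilon> T P"
    unfolding iff
  proof (intro conjI exI allI)
    show "P (\<lambda>x. f x + f' x)" by (rule P(2)[OF f f'])
    show "L2 (\<lambda>x. L x + L' x)" "L2 (\<lambda>x. g x + g' x)" by (intro L2_add L L' g g')+
    show "(\<lambda>x. f x + f' x, (\<lambda>n x. u n x + u' n x) n) \<in> T ^^ Suc (2 * n)" for n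
      by (rule t(3)[OF spec[OF u] spec[OF u']])
    show "l2_tendsto (s (\<lambda>n x. u n x + u' n x)) (\<lambda>x. L x + L' x)"
      unfolding add by (rule l2_tendsto_add[OF L(2) L2s[OF u] L(1) L'(2) L2s[OF u'] L'(1)])
    show "ae_eq (\<lambda>x. g x + g' x) (\<lambda>x. - complex_of_real (1 / sqrt \<epsilon>) * (L x + L' x))"
      using ae_eq_add[OF g(2) g'(2)] by (simp only: distrib_left)
  qed
  assume e: "ae_eq f f'"
  have "ae_eq (u n) (u' n)" for n
    by (rule t(6)[OF spec[OF u] spec[OF u'] e])
  \<comment> \<open>The countably many exceptional null sets are merged, so that a single one serves
    every partial sum.\<close>
  then have "AE x in lborel. \<forall>n. u n x = u' n x"
    by (simp add: ae_eq_def AE_all_countable)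
  then have "ae_eq (s u N) (s u' N)" for N
    unfolding ae_eq_def s_def by eventually_elim simp
  then have "ae_eq L L'"
    by (rule l2_tendsto_unique[OF L(2) L2s[OF u] L(1) L'(2) L2s[OF u'] L'(1)])
  then show "ae_eq g g'"
    by (rule ae_eq_trans[OF g(2) ae_eq_trans[OF ae_eq_cmult ae_eq_sym[OF g'(2)]]])
qed

section \<open>Even and odd subspaces\<close>

lemma ae_eq_reflect:
  assumes "ae_eq f g"
  shows "ae_eq (\<lambda>x. f (- x)) (\<lambda>x. g (- x))"
proof -
  have "AE x in distr lborel borel uminus. f x = g x"
    unfolding lborel_distr_uminus using assms by (simp add: ae_eq_def)
  then show ?thesis
    unfolding ae_eq_def by (rule AE_distrD[rotated]) simp_all
qed

lemma L2_even_cong: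
  assumes "L2_even f" "L2 g" "ae_eq f g"
  shows "L2_even g"
proof -
  have "AE x in lborel. f (- x) = f x" using assms(1) by (simp add: L2_even_def)
  then have "AE x in lborel. g (- x) = g x"
    using ae_eq_reflect[OF assms(3)] assms(3) unfolding ae_eq_def by eventually_elim simp
  then show ?thesis using assms by (simp add: L2_even_def)
qed

lemma L2_even_add:
  assumes "L2_even f" "L2_even g"
  shows "L2_even (\<lambda>x. f x + g x)"
proof -
  have "AE x in lborel. f (- x) = f x" "AE x in lborel. g (- x) = g x"
    using assms by (simp_all add: L2_even_def)
  then have "AE x in lborel. f (- x) + g (- x) = f x + g x" by eventually_elim simp
  then show ?thesis using assms by (simp add: L2_even_def L2_add)
qed

lemma L2_even_cmult: "L2_even f \<Longrightarrow> L2_even (\<lambda>x. c * f x)"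
  by (auto simp: L2_even_def L2_cmult elim!: AE_mp)

lemma L2_odd_cong:
  assumes "L2_odd f" "L2 g" "ae_eq f g"
  shows "L2_odd g"
proof -
  have "AE x in lborel. f (- x) = - f x" using assms(1) by (simp add: L2_odd_def)
  then have "AE x in lborel. g (- x) = - g x"
    using ae_eq_reflect[OF assms(3)] assms(3) unfolding ae_eq_def by eventually_elim simp
  then show ?thesis using assms by (simp add: L2_odd_def)
qed

lemma L2_odd_add:
  assumes "L2_odd f" "L2_odd g"
  shows "L2_odd (\<lambda>x. f x + g x)"
proof -
  have "AE x in lborel. f (- x) = - f x" "AE x in lborel. g (- x) = - g x"
    using assms by (simp_all add: L2_odd_def)
  then have "AE x in lborel. f (- x) + g (- x) = - (f x + g x)" by eventually_elim simp
  then show ?thesis using assms by (simp add: L2_odd_def L2_add)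
qed

lemma L2_odd_cmult: "L2_odd f \<Longrightarrow> L2_odd (\<lambda>x. c * f x)"
  by (auto simp: L2_odd_def L2_cmult elim!: AE_mp)

lemma linear_ae_op_S_eps: "linear_ae_op (S_eps \<epsilon>)"
  unfolding S_eps_def
  by (rule linear_ae_op_S_gen[OF linear_ae_op_t_op _ L2_even_add L2_even_cmult L2_even_cong])
    (simp_all add: L2_even_def)

lemma linear_ae_op_t_star: "linear_ae_op (adjoint_op t_op)"
  by (rule linear_ae_op_adjoint[OF linear_ae_op_t_op bump_t_op])

lemma linear_ae_op_S_star_eps: "linear_ae_op (S_star_eps \<epsilon>)"
  unfolding S_star_eps_def
  by (rule linear_ae_op_S_gen[OF linear_ae_op_t_star _ L2_odd_add L2_odd_cmult L2_odd_cong])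
    (simp_all add: L2_odd_def)

section \<open>The arctangent series\<close>

text \<open>A square integrable majorant gives both kinds of convergence at once: 2 B dominates the
  differences for the norm, and |f| B dominates the integrands of the inner products.\<close>

lemma l2_dominated_convergence:
  assumes F: "\<And>N. L2 (F N)" and B: "L2 (\<lambda>x. complex_of_real (B x))"
    and lim: "\<And>x. (\<lambda>N. F N x) \<longlonglongrightarrow> L x" and bound: "\<And>N x. cmod (F N x) \<le> B x"
  shows "L2 L" "l2_tendsto F L" "L2 f \<Longrightarrow> (\<lambda>N. l2_inner f (F N)) \<longlonglongrightarrow> l2_inner f L"
proof -
  have bL: "cmod (L x) \<le> B x" for x
    by (rule LIMSEQ_le_const2[OF tendsto_norm[OF lim]]) (use bound in blast)
  have B0: "0 \<le> B x" for x using norm_ge_zero[of "F 0 x"] bound[of 0 x] by linarith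
  have mL: "L \<in> borel_measurable borel"
    by (rule borel_measurable_LIMSEQ_metric[OF L2D(1)[OF F] lim])
  show L: "L2 L"
    by (rule L2_dominated[OF mL B]) (use bL B0 in simp)
  have mB: "integrable lborel (\<lambda>x. (2 * B x)\<^sup>2)"
    using L2D(2)[OF B] by (simp add: power_mult_distrib)
  have "(\<lambda>N. LINT x|lborel. (cmod (F N x - L x))\<^sup>2) \<longlonglongrightarrow> (LINT x|(lborel :: real measure). (0::real))"
  proof (rule integral_dominated_convergence[where w = "\<lambda>x. (2 * B x)\<^sup>2"])
    show "(\<lambda>x. (cmod (F N x - L x))\<^sup>2) \<in> borel_measurable lborel" for N
      by (intro borel_measurable_integrable L2D(2) L2_diff F L)
    have "(\<lambda>N. (cmod (F N x - L x))\<^sup>2) \<longlonglongrightarrow> 0" for x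
      using tendsto_power[OF tendsto_norm[OF tendsto_diff[OF lim[of x] tendsto_const[of "L x"]]], of 2] by simp
    then show "AE x in lborel. (\<lambda>N. (cmod (F N x - L x))\<^sup>2) \<longlonglongrightarrow> 0" by simp
    have "cmod (F N x - L x) \<le> 2 * B x" for N x
      using norm_triangle_ineq4[of "F N x" "L x"] bound[of N x] bL[of x] by linarith
    then have "norm ((cmod (F N x - L x))\<^sup>2) \<le> (2 * B x)\<^sup>2" for N x
      unfolding real_norm_def abs_of_nonneg[OF zero_le_power2] by (rule power_mono) simp
    then show "AE x in lborel. norm ((cmod (F N x - L x))\<^sup>2) \<le> (2 * B x)\<^sup>2" for N
      by (rule AE_I2)
  qed (use mB in simp_all)
  then show "l2_tendsto F L" by (simp add: l2_tendsto_iff)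
  assume f: "L2 f"
  show "(\<lambda>N. l2_inner f (F N)) \<longlonglongrightarrow> l2_inner f L"
    unfolding l2_inner_def
  proof (rule integral_dominated_convergence[where w = "\<lambda>x. cmod (cnj (f x) * complex_of_real (B x))"])
    show "(\<lambda>x. cnj (f x) * L x) \<in> borel_measurable lborel"
      "\<And>N. (\<lambda>x. cnj (f x) * F N x) \<in> borel_measurable lborel"
      by (intro borel_measurable_integrable integrable_L2_mult L2_cnj f L F)+
    show "integrable lborel (\<lambda>x. cmod (cnj (f x) * complex_of_real (B x)))"
      by (intro integrable_norm integrable_L2_mult L2_cnj f B)
    show "AE x in lborel. (\<lambda>N. cnj (f x) * F N x) \<longlonglongrightarrow> cnj (f x) * L x"
      by (intro always_eventually allI tendsto_mult tendsto_const lim)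
    show "AE x in lborel. norm (cnj (f x) * F N x) \<le> cmod (cnj (f x) * complex_of_real (B x))" for N
      using bound B0 by (intro always_eventually allI) (auto simp: norm_mult intro!: mult_left_mono)
  qed
qed

text \<open>Indexing by \<sigma> lets \<open>t_op\<close> on even functions and its adjoint on odd
  functions share one argument, since both act on lifts as the same multiple of d/du.\<close>

definition t_block :: "nat \<Rightarrow> ((real \<Rightarrow> complex) \<times> (real \<Rightarrow> complex)) set" where
  "t_block \<sigma> = (if \<sigma> = 0 then t_op else adjoint_op t_op)"

definition S_block :: "real \<Rightarrow> nat \<Rightarrow> ((real \<Rightarrow> complex) \<times> (real \<Rightarrow> complex)) set" where
  "S_block \<epsilon> \<sigma> = (if \<sigma> = 0 then S_eps \<epsilon> else S_star_eps \<epsilon>)"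

lemma linear_ae_op_S_block: "linear_ae_op (S_block \<epsilon> \<sigma>)"
  by (simp add: S_block_def linear_ae_op_S_eps linear_ae_op_S_star_eps)

lemma S_block_alt:
  "S_block \<epsilon> \<sigma> = S_gen \<epsilon> (t_block \<sigma>) (if \<sigma> = 0 then L2_even else L2_odd)"
  by (simp add: S_block_def t_block_def S_eps_def S_star_eps_def)

definition artanh_sum :: "nat \<Rightarrow> (real \<Rightarrow> complex) \<Rightarrow> real \<Rightarrow> complex" where
  "artanh_sum N g u = (\<Sum>n\<le>N. of_real (1 / real (2 * n + 1)) * (gd ^^ (2 * n + 1)) g u)"

text \<open>The series is summed pointwise in x. For g in \<open>gspan\<close> and \<sigma> \<le> 1
  it converges absolutely and \<open>artanh_lift_limits\<close> identifies the sum as the limit in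
  norm, so the default value of a divergent \<open>suminf\<close> does not arise.\<close>

definition artanh_lift :: "real \<Rightarrow> nat \<Rightarrow> (real \<Rightarrow> complex) \<Rightarrow> real \<Rightarrow> complex" where
  "artanh_lift \<epsilon> \<sigma> g x = (\<Sum>n. of_real (1 / real (2 * n + 1)) * lift \<epsilon> \<sigma> ((gd ^^ (2 * n + 1)) g) x)"

lemma artanh_sum_gspan: "g \<in> gspan \<Longrightarrow> artanh_sum N g \<in> gspan"
  unfolding artanh_sum_def by (intro gspan_sum gspan_cmult gspan_funpow_gd)

lemma lift_artanh_sum:
  "lift \<epsilon> \<sigma> (artanh_sum N g) x = (\<Sum>n\<le>N. of_real (1 / real (2 * n + 1)) * lift \<epsilon> \<sigma> ((gd ^^ (2 * n + 1)) g) x)"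
  unfolding artanh_sum_def[abs_def] lift_sum lift_cmult ..

text \<open>By the chain rule for u = x^2 / (2 sqrt \<epsilon>) and \<sigma> \<le> 1, the second
  x-derivative of \<open>lift \<epsilon> \<sigma> g\<close> is 2 / sqrt \<epsilon> times the lift of
  u g'' + (1/2 + \<sigma>) g', while x^2 / 2 = sqrt \<epsilon> u.\<close>

definition h_symbol :: "real \<Rightarrow> nat \<Rightarrow> (real \<Rightarrow> complex) \<Rightarrow> real \<Rightarrow> complex" where
  "h_symbol \<epsilon> \<sigma> g u = of_real (sqrt \<epsilon>) *
     (of_real u * g u - of_real u * (gd ^^ 2) g u - of_real (1 / 2 + real \<sigma>) * gd g u)"

lemma h_symbol_gspan: "g \<in> gspan \<Longrightarrow> h_symbol \<epsilon> \<sigma> g \<in> gspan"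
  unfolding h_symbol_def[abs_def]
  by (intro gspan_cmult gspan_diff gspan_umult gspan_gd gspan_funpow_gd)

lemma h_symbol_add: "g \<in> gspan \<Longrightarrow> h \<in> gspan \<Longrightarrow>
    h_symbol \<epsilon> \<sigma> (\<lambda>u. g u + h u) u = h_symbol \<epsilon> \<sigma> g u + h_symbol \<epsilon> \<sigma> h u"
  by (simp only: h_symbol_def funpow_gd_add gd_add) (simp add: algebra_simps)

lemma h_symbol_cmult: "g \<in> gspan \<Longrightarrow> h_symbol \<epsilon> \<sigma> (\<lambda>u. c * g u) u = c * h_symbol \<epsilon> \<sigma> g u"
  by (simp only: h_symbol_def funpow_gd_cmult gd_cmult) (simp add: algebra_simps)

lemma h_symbol_cnj: "g \<in> gspan \<Longrightarrow> h_symbol \<epsilon> \<sigma> (\<lambda>u. cnj (g u)) u = cnj (h_symbol \<epsilon> \<sigma> g u)"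
  by (simp add: h_symbol_def numeral_2_eq_2 gd_cnj gspan_gd)

text \<open>Derivatives commute with each other, so only the two multiplications by u contribute,
  each through \<open>funpow_gd_umult\<close>. The first order term of \<open>h_symbol\<close>, the
  only one that contains \<sigma>, drops out; hence both parities give the same commutator.\<close>

lemma funpow_gd_h_symbol:
  assumes g: "g \<in> gspan"
  shows "(gd ^^ Suc m) (h_symbol \<epsilon> \<sigma> g) u - h_symbol \<epsilon> \<sigma> ((gd ^^ Suc m) g) u
    = of_real (sqrt \<epsilon>) * of_nat (Suc m) * ((gd ^^ m) g u - (gd ^^ (m + 2)) g u)"
proof -
  note mem = gspan_umult[OF g] gspan_umult[OF gspan_funpow_gd[OF g]] gspan_gd[OF g] gspan_funpow_gd[OF g]
  have e1: "(gd ^^ Suc m) (gd g) = (gd ^^ (m + 2)) g" "(gd ^^ Suc m) ((gd ^^ 2) g) = (gd ^^ (m + 3)) g"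
    "(gd ^^ m) ((gd ^^ 2) g) = (gd ^^ (m + 2)) g"
    "(gd ^^ 2) ((gd ^^ Suc m) g) = (gd ^^ (m + 3)) g" "gd ((gd ^^ Suc m) g) = (gd ^^ (m + 2)) g"
    by (simp_all add: funpow_swap1 numeral_2_eq_2 numeral_3_eq_3)
  have "(gd ^^ Suc m) (h_symbol \<epsilon> \<sigma> g) = (\<lambda>u. of_real (sqrt \<epsilon>) *
      ((gd ^^ Suc m) (\<lambda>u. of_real u * g u) u - (gd ^^ Suc m) (\<lambda>u. of_real u * (gd ^^ 2) g u) u
        - of_real (1 / 2 + real \<sigma>) * (gd ^^ Suc m) (gd g) u))"
    unfolding h_symbol_def[abs_def]
    using mem by (simp only: funpow_gd_cmult funpow_gd_diff gspan_diff gspan_cmult)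
  then show ?thesis
    unfolding funpow_gd_umult[OF g] funpow_gd_umult[OF gspan_funpow_gd[OF g]] h_symbol_def e1
    by (simp only:) (simp add: algebra_simps del: funpow.simps)
qed

text \<open>The Taylor weight 1 / (2 n + 1) cancels the factor 2 n + 1 of the commutator. What
  remains is the difference of the derivatives of orders 2 n and 2 n + 2, and these
  telescope.\<close>

lemma artanh_sum_h_symbol:
  assumes g: "g \<in> gspan"
  shows "artanh_sum N (h_symbol \<epsilon> \<sigma> g) u - h_symbol \<epsilon> \<sigma> (artanh_sum N g) u
    = of_real (sqrt \<epsilon>) * (g u - (gd ^^ (2 * N + 2)) g u)"
proof -
  define c where "c n = complex_of_real (1 / real (2 * n + 1))" for n
  have c: "c n * of_nat (Suc (2 * n)) = 1" for n
  proof -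
    have "c n * of_nat (Suc (2 * n)) = complex_of_real (1 / real (2 * n + 1) * real (Suc (2 * n)))"
      unfolding c_def by (simp only: of_real_mult of_real_of_nat_eq)
    then show ?thesis by simp
  qed
  have key: "c n * (gd ^^ Suc (2 * n)) (h_symbol \<epsilon> \<sigma> g) u - c n * h_symbol \<epsilon> \<sigma> ((gd ^^ Suc (2 * n)) g) u
      = of_real (sqrt \<epsilon>) * ((gd ^^ (2 * n)) g u - (gd ^^ (2 * n + 2)) g u)" for n
  proof -
    have "c n * (gd ^^ Suc (2 * n)) (h_symbol \<epsilon> \<sigma> g) u - c n * h_symbol \<epsilon> \<sigma> ((gd ^^ Suc (2 * n)) g) u
        = (c n * of_nat (Suc (2 * n))) * (of_real (sqrt \<epsilon>) * ((gd ^^ (2 * n)) g u - (gd ^^ (2 * n + 2)) g u))"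
      unfolding right_diff_distrib[symmetric] funpow_gd_h_symbol[OF g] by (simp only: mult_ac)
    then show ?thesis by (simp only: c mult_1_left)
  qed
  show ?thesis
  proof (induction N)
    case 0
    have "artanh_sum 0 h = (\<lambda>u. c 0 * (gd ^^ Suc (2 * 0)) h u)" for h
      by (simp add: artanh_sum_def fun_eq_iff c_def)
    then show ?case
      using key[of 0] by (simp only: h_symbol_cmult[OF gspan_funpow_gd[OF g]]) simp
  next
    case (Suc N)
    have s: "artanh_sum (Suc N) h = (\<lambda>u. artanh_sum N h u + c (Suc N) * (gd ^^ Suc (2 * Suc N)) h u)" for h
      unfolding artanh_sum_def[abs_def] sum.atMost_Suc c_def by (simp only: Suc_eq_plus1)
    have mem: "(\<lambda>u. c (Suc N) * (gd ^^ Suc (2 * Suc N)) g u) \<in> gspan"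
      by (intro gspan_cmult gspan_funpow_gd g)
    have e: "2 * Suc N = 2 * N + 2" by simp
    have "artanh_sum (Suc N) (h_symbol \<epsilon> \<sigma> g) u - h_symbol \<epsilon> \<sigma> (artanh_sum (Suc N) g) u
        = (artanh_sum N (h_symbol \<epsilon> \<sigma> g) u - h_symbol \<epsilon> \<sigma> (artanh_sum N g) u)
        + (c (Suc N) * (gd ^^ Suc (2 * Suc N)) (h_symbol \<epsilon> \<sigma> g) u - c (Suc N) * h_symbol \<epsilon> \<sigma> ((gd ^^ Suc (2 * Suc N)) g) u)"
      unfolding s h_symbol_add[OF artanh_sum_gspan[OF g] mem] h_symbol_cmult[OF gspan_funpow_gd[OF g]]
      by (simp only: diff_add_eq add_diff_eq diff_diff_eq ac_simps)
    also have "\<dots> = of_real (sqrt \<epsilon>) * (g u - (gd ^^ (2 * N + 2)) g u)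
        + of_real (sqrt \<epsilon>) * ((gd ^^ (2 * Suc N)) g u - (gd ^^ (2 * Suc N + 2)) g u)"
      unfolding Suc key ..
    also have "\<dots> = of_real (sqrt \<epsilon>) * (g u - (gd ^^ (2 * Suc N + 2)) g u)"
      unfolding e distrib_left[symmetric] by simp
    finally show ?case .
  qed
qed

definition t_symbol_coeff :: "real \<Rightarrow> complex" where
  "t_symbol_coeff \<epsilon> = - \<i> * of_real (1 / sqrt \<epsilon>)"

context
  fixes \<epsilon> :: real
  assumes eps: "0 < \<epsilon>"
begin

text \<open>The x-derivative of g(u) carries an explicit factor x, which \<open>qinv_op\<close>
  removes.\<close>

lemma t_op_lift:
  assumes g: "g \<in> gspan"
  shows "(lift \<epsilon> 0 g, lift \<epsilon> 0 (\<lambda>u. t_symbol_coeff \<epsilon> * gd g u)) \<in> t_op"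
proof -
  have "(\<lambda>x. - \<i> * lift_deriv \<epsilon> 0 g x, lift \<epsilon> 0 (\<lambda>u. t_symbol_coeff \<epsilon> * gd g u)) \<in> qinv_op"
    unfolding qinv_op_iff
  proof (intro conjI L2_cmult L2_lift_deriv[OF eps] L2_lift[OF eps] gspan_cmult gspan_gd g)
    show "AE x in lborel. - \<i> * lift_deriv \<epsilon> 0 g x
        = complex_of_real x * lift \<epsilon> 0 (\<lambda>u. t_symbol_coeff \<epsilon> * gd g u) x"
      by (simp add: lift_deriv_0[OF eps] lift_def t_symbol_coeff_def)
  qed auto
  then show ?thesis
    unfolding t_op_def using lift_p_op[OF eps g, of 0] by blast
qed

text \<open>Pairing x g(u) with \<open>q^{-1} p f\<close> cancels the factor x against
  \<open>q^{-1}\<close>, leaving the pairing of g(u) with p f. Then \<open>p_op_lift\<close>,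
  applied to the conjugate of g, moves the derivative over to g(u) for an arbitrary f in the
  domain.\<close>

lemma adjoint_t_op_lift:
  assumes g: "g \<in> gspan"
  shows "(lift \<epsilon> 1 g, lift \<epsilon> 1 (\<lambda>u. t_symbol_coeff \<epsilon> * gd g u)) \<in> adjoint_op t_op"
proof -
  have L: "L2 (lift \<epsilon> 1 g)" "L2 (lift \<epsilon> 1 (\<lambda>u. t_symbol_coeff \<epsilon> * gd g u))"
    by (intro L2_lift_1[OF eps] gspan_cmult gspan_gd g)+
  have "l2_inner (lift \<epsilon> 1 g) h = l2_inner (lift \<epsilon> 1 (\<lambda>u. t_symbol_coeff \<epsilon> * gd g u)) f" if fh: "(f, h) \<in> t_op" for f h
  proof -
    obtain m where p: "(f, m) \<in> p_op" and q: "(m, h) \<in> qinv_op"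
      using fh unfolding t_op_def by blast
    have m: "L2 m" "L2 h" "AE x in lborel. m x = complex_of_real x * h x"
      using q by (auto simp: qinv_op_iff)
    note gc = gspan_cnj[OF g]
    have "l2_inner (lift \<epsilon> 1 g) h = (LINT x|lborel. m x * lift \<epsilon> 0 (\<lambda>u. cnj (g u)) x)"
      unfolding l2_inner_def
    proof (rule integral_cong_AE)
      show "(\<lambda>x. cnj (lift \<epsilon> 1 g x) * h x) \<in> borel_measurable lborel"
        "(\<lambda>x. m x * lift \<epsilon> 0 (\<lambda>u. cnj (g u)) x) \<in> borel_measurable lborel"
        by (intro borel_measurable_integrable integrable_L2_mult L2_cnj L m L2_lift_0[OF eps] gc)+
      show "AE x in lborel. cnj (lift \<epsilon> 1 g x) * h x = m x * lift \<epsilon> 0 (\<lambda>u. cnj (g u)) x"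
        using m(3) by eventually_elim (simp add: lift_def)
    qed
    also have "\<dots> = \<i> * (LINT x|lborel. f x * lift_deriv \<epsilon> 0 (\<lambda>u. cnj (g u)) x)"
      using p_op_lift[OF eps p _ gc, of 0] by simp
    also have "\<dots> = (LINT x|lborel. \<i> * (f x * lift_deriv \<epsilon> 0 (\<lambda>u. cnj (g u)) x))"
      by simp
    also have "\<dots> = l2_inner (lift \<epsilon> 1 (\<lambda>u. t_symbol_coeff \<epsilon> * gd g u)) f"
      unfolding l2_inner_def lift_deriv_0[OF eps] gd_cnj[OF g]
      by (rule Bochner_Integration.integral_cong) (simp_all add: lift_def t_symbol_coeff_def)
    finally show ?thesis .
  qed
  then show ?thesis using L by (auto simp: adjoint_op_def)
qed

lemma t_block_lift:
  assumes "g \<in> gspan" "\<sigma> \<le> 1"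
  shows "(lift \<epsilon> \<sigma> g, lift \<epsilon> \<sigma> (\<lambda>u. t_symbol_coeff \<epsilon> * gd g u)) \<in> t_block \<sigma>"
  using t_op_lift[OF assms(1)] adjoint_t_op_lift[OF assms(1)] assms(2)
  by (cases "\<sigma> = 0") (auto simp: t_block_def le_Suc_eq)

lemma t_block_relpow_lift:
  assumes g: "g \<in> gspan" and \<sigma>: "\<sigma> \<le> 1"
  shows "(lift \<epsilon> \<sigma> g, lift \<epsilon> \<sigma> (\<lambda>u. t_symbol_coeff \<epsilon> ^ k * (gd ^^ k) g u)) \<in> t_block \<sigma> ^^ k"
proof (induction k)
  case (Suc k)
  note mem = gspan_funpow_gd[OF g, of k]
  have "(\<lambda>u. t_symbol_coeff \<epsilon> * gd (\<lambda>u. t_symbol_coeff \<epsilon> ^ k * (gd ^^ k) g u) u)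
      = (\<lambda>u. t_symbol_coeff \<epsilon> ^ Suc k * (gd ^^ Suc k) g u)"
    by (simp add: gd_cmult[OF mem] mult.assoc)
  then show ?case
    using relpow_Suc_I[OF Suc t_block_lift[OF gspan_cmult[OF mem] \<sigma>]] by simp
qed simp

text \<open>One majorant B for all orders n, with the geometric factor split off; it serves the
  summation of the series as well as the vanishing of the remainder.\<close>

lemma lift_envelope:
  assumes g: "g \<in> gspan" and \<sigma>: "\<sigma> \<le> 1"
  obtains r B where "0 < r" "r < 1" "L2 (\<lambda>x. complex_of_real (B x))" "\<And>x. 0 \<le> B x"
    "\<And>n x. cmod (lift \<epsilon> \<sigma> ((gd ^^ n) g) x) \<le> r ^ n * B x"
proof -
  obtain C r \<beta> where d: "0 \<le> C" "0 < r" "r < 1" "0 < \<beta>"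
    "\<And>n u. 0 \<le> u \<Longrightarrow> cmod ((gd ^^ n) g u) \<le> C * r ^ n * exp (- \<beta> * u)"
    using gspan_decay[OF g] by blast
  \<comment> \<open>The cap 1/2 keeps \<gamma> below 1, so that the majorant is itself the modulus
    of a lift from \<open>gspan\<close> and its square integrability is already known.\<close>
  define \<gamma> where "\<gamma> = min \<beta> (1 / 2)"
  have \<gamma>: "0 < \<gamma>" "\<gamma> < 1" "\<gamma> \<le> \<beta>" using d(4) by (auto simp: \<gamma>_def)
  define B where "B x = C * cmod (lift \<epsilon> \<sigma> (gbase 0 \<gamma>) x)" for x
  note L = L2_lift[OF eps gbase_in_gspan[OF \<gamma>(1,2), of 0] \<sigma>]
  have "L2 (\<lambda>x. complex_of_real (B x))"
  proof (rule L2_dominated)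
    show "(\<lambda>x. complex_of_real (B x)) \<in> borel_measurable borel"
      using L2D(1)[OF L] unfolding B_def by simp
    show "L2 (\<lambda>x. of_real C * lift \<epsilon> \<sigma> (gbase 0 \<gamma>) x)" by (rule L2_cmult[OF L])
    show "cmod (complex_of_real (B x)) \<le> cmod (of_real C * lift \<epsilon> \<sigma> (gbase 0 \<gamma>) x)" for x
      using d(1) by (simp add: B_def norm_mult)
  qed
  moreover have "0 \<le> B x" for x using d(1) by (simp add: B_def)
  moreover have "cmod (lift \<epsilon> \<sigma> ((gd ^^ n) g) x) \<le> r ^ n * B x" for n x
  proof -
    let ?u = "x\<^sup>2 / (2 * sqrt \<epsilon>)"
    have u: "0 \<le> ?u" using eps by simp
    have "exp (- \<beta> * ?u) \<le> exp (- \<gamma> * ?u)"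
      using mult_right_mono[OF \<gamma>(3) u] by (simp only: exp_le_cancel_iff mult_minus_left neg_le_iff_le)
    then have "C * r ^ n * exp (- \<beta> * ?u) \<le> C * r ^ n * exp (- \<gamma> * ?u)"
      using d by (intro mult_left_mono) auto
    with d(5)[OF u, of n] have "cmod ((gd ^^ n) g ?u) \<le> C * r ^ n * exp (- \<gamma> * ?u)" by linarith
    from mult_left_mono[OF this, of "\<bar>x\<bar> ^ \<sigma>"]
    show ?thesis
      by (simp add: lift_def B_def gbase_def norm_mult norm_power power_abs mult_ac)
  qed
  ultimately show ?thesis using that d(2,3) by blast
qed

text \<open>The terms are bounded by \<open>r ^ n * B x\<close>, so every partial sum is bounded by
  B / (1 - r); this majorant is square integrable and \<open>l2_dominated_convergence\<close>
  applies.\<close>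

lemma artanh_lift_limits:
  assumes g: "g \<in> gspan" and \<sigma>: "\<sigma> \<le> 1"
  shows "L2 (artanh_lift \<epsilon> \<sigma> g)" "l2_tendsto (\<lambda>N. lift \<epsilon> \<sigma> (artanh_sum N g)) (artanh_lift \<epsilon> \<sigma> g)"
    "L2 f \<Longrightarrow> (\<lambda>N. l2_inner f (lift \<epsilon> \<sigma> (artanh_sum N g))) \<longlonglongrightarrow> l2_inner f (artanh_lift \<epsilon> \<sigma> g)"
proof -
  obtain r B where B: "0 < r" "r < 1" "L2 (\<lambda>x. complex_of_real (B x))" "\<And>x. 0 \<le> B x"
    "\<And>n x. cmod (lift \<epsilon> \<sigma> ((gd ^^ n) g) x) \<le> r ^ n * B x"
    using lift_envelope[OF g \<sigma>] by metis
  define a where "a x n = complex_of_real (1 / real (2 * n + 1)) * lift \<epsilon> \<sigma> ((gd ^^ (2 * n + 1)) g) x" for x n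
  have a: "cmod (a x n) \<le> r ^ n * B x" for x n
  proof -
    have "cmod (complex_of_real (1 / real (2 * n + 1))) \<le> 1"
      unfolding norm_of_real by simp
    then have "cmod (a x n) \<le> 1 * cmod (lift \<epsilon> \<sigma> ((gd ^^ (2 * n + 1)) g) x)"
      unfolding a_def norm_mult by (rule mult_right_mono) simp
    also have "\<dots> \<le> r ^ (2 * n + 1) * B x" using B(5)[of "2 * n + 1" x] by simp
    also have "\<dots> \<le> r ^ n * B x"
      using B by (intro mult_right_mono power_decreasing) auto
    finally show ?thesis .
  qed
  have geo: "summable (\<lambda>n. r ^ n * B x)" for x
    using B by (intro summable_mult2 summable_geometric) auto
  have sum: "summable (a x)" for x
    by (rule summable_comparison_test[OF _ geo[of x]]) (use a in blast)
  have "(\<lambda>N. lift \<epsilon> \<sigma> (artanh_sum N g) x) \<longlonglongrightarrow> artanh_lift \<epsilon> \<sigma> g x" for x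
    using summable_LIMSEQ'[OF sum[of x]] by (simp add: lift_artanh_sum artanh_lift_def a_def[abs_def])
  moreover have "cmod (lift \<epsilon> \<sigma> (artanh_sum N g) x) \<le> 1 / (1 - r) * B x" for N x
  proof -
    have "cmod (lift \<epsilon> \<sigma> (artanh_sum N g) x) \<le> (\<Sum>n\<le>N. cmod (a x n))"
      unfolding lift_artanh_sum a_def by (rule norm_sum)
    also have "\<dots> \<le> (\<Sum>n\<le>N. r ^ n * B x)" by (intro sum_mono a)
    also have "\<dots> \<le> (\<Sum>n. r ^ n * B x)"
      using B by (intro sum_le_suminf geo) auto
    also have "\<dots> = 1 / (1 - r) * B x"
      using B by (simp add: suminf_mult2[symmetric] suminf_geometric summable_geometric)
    finally show ?thesis .
  qed
  moreover have "L2 (\<lambda>x. complex_of_real (1 / (1 - r) * B x))"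
    using L2_cmult[OF B(3), of "complex_of_real (1 / (1 - r))"] by (simp only: of_real_mult)
  ultimately show "L2 (artanh_lift \<epsilon> \<sigma> g)" "l2_tendsto (\<lambda>N. lift \<epsilon> \<sigma> (artanh_sum N g)) (artanh_lift \<epsilon> \<sigma> g)"
    "L2 f \<Longrightarrow> (\<lambda>N. l2_inner f (lift \<epsilon> \<sigma> (artanh_sum N g))) \<longlonglongrightarrow> l2_inner f (artanh_lift \<epsilon> \<sigma> g)"
    using l2_dominated_convergence[where F = "\<lambda>N. lift \<epsilon> \<sigma> (artanh_sum N g)" and L = "artanh_lift \<epsilon> \<sigma> g"
        and B = "\<lambda>x. 1 / (1 - r) * B x"] L2_lift[OF eps artanh_sum_gspan[OF g] \<sigma>]
    by blast+
qed

text \<open>Disposes of the remainder left by the telescoping in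
  \<open>artanh_sum_h_symbol\<close>.\<close>

lemma lift_funpow_gd_tendsto_zero:
  assumes g: "g \<in> gspan" and \<sigma>: "\<sigma> \<le> 1" and f: "L2 f"
  shows "(\<lambda>N. l2_inner f (lift \<epsilon> \<sigma> ((gd ^^ (2 * N + 2)) g))) \<longlonglongrightarrow> 0"
proof -
  obtain r B where B: "0 < r" "r < 1" "L2 (\<lambda>x. complex_of_real (B x))" "\<And>x. 0 \<le> B x"
    "\<And>n x. cmod (lift \<epsilon> \<sigma> ((gd ^^ n) g) x) \<le> r ^ n * B x"
    using lift_envelope[OF g \<sigma>] by metis
  have "cmod (lift \<epsilon> \<sigma> ((gd ^^ (2 * N + 2)) g) x) \<le> r ^ N * B x" for N x
  proof -
    have "r ^ (2 * N + 2) * B x \<le> r ^ N * B x"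
      using B by (intro mult_right_mono power_decreasing) auto
    then show ?thesis using B(5)[of "2 * N + 2" x] by linarith
  qed
  note b = this
  have "(\<lambda>N. r ^ N * B x) \<longlonglongrightarrow> 0" for x
    using B by (intro tendsto_mult_left_zero LIMSEQ_power_zero) auto
  then have "(\<lambda>N. lift \<epsilon> \<sigma> ((gd ^^ (2 * N + 2)) g) x) \<longlonglongrightarrow> 0" for x
    by (rule Lim_null_comparison[rotated]) (use b in \<open>blast intro: always_eventually\<close>)
  moreover have "cmod (lift \<epsilon> \<sigma> ((gd ^^ (2 * N + 2)) g) x) \<le> B x" for N x
  proof -
    have "r ^ N * B x \<le> 1 * B x" using B by (intro mult_right_mono power_le_one) auto
    then show ?thesis using b[of N x] by simp
  qed
  ultimately have "(\<lambda>N. l2_inner f (lift \<epsilon> \<sigma> ((gd ^^ (2 * N + 2)) g))) \<longlonglongrightarrow> l2_inner f (\<lambda>x. 0)"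
    by (intro l2_dominated_convergence(3)[where B = B] L2_lift[OF eps] gspan_funpow_gd g \<sigma> B f) auto
  then show ?thesis by (simp add: l2_inner_def)
qed

end

section \<open>The commutation relation\<close>

text \<open>The part of \<open>lift_deriv\<close> that depends on u alone, without its power of x.
  With it a second derivative can be written as \<open>lift_deriv\<close> at the flipped parity 1 -
  \<sigma>.\<close>

definition deriv_symbol :: "real \<Rightarrow> nat \<Rightarrow> (real \<Rightarrow> complex) \<Rightarrow> real \<Rightarrow> complex" where
  "deriv_symbol \<epsilon> \<sigma> g u = (if \<sigma> = 0 then of_real (1 / sqrt \<epsilon>) * gd g u else g u + 2 * (of_real u * gd g u))"

context
  fixes \<epsilon> :: real
  assumes eps: "0 < \<epsilon>"
begin

lemma lift_parity:
  assumes "g \<in> gspan" "\<sigma> \<le> 1"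
  shows "(if \<sigma> = 0 then L2_even else L2_odd) (lift \<epsilon> \<sigma> g)"
  using L2_lift[OF eps assms] assms(2)
  by (cases "\<sigma> = 0") (auto simp: L2_even_def L2_odd_def lift_minus le_Suc_eq)

text \<open>With sqrt \<epsilon> t = -\<i> d/du the sign (-1)^n of the arctangent series is
  cancelled by (-\<i>)^(2n+1) = -\<i> (-1)^n. The sum is -\<i> artanh(d/du), and the prefactor -1 /
  sqrt \<epsilon> turns -\<i> into \<i> / sqrt \<epsilon>.\<close>

lemma S_block_lift:
  assumes g: "g \<in> gspan" and \<sigma>: "\<sigma> \<le> 1"
  shows "(lift \<epsilon> \<sigma> g, \<lambda>x. \<i> * of_real (1 / sqrt \<epsilon>) * artanh_lift \<epsilon> \<sigma> g x) \<in> S_block \<epsilon> \<sigma>"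
proof -
  note A = artanh_lift_limits[OF eps g \<sigma>]
  define u where "u n = lift \<epsilon> \<sigma> (\<lambda>u. t_symbol_coeff \<epsilon> ^ Suc (2 * n) * (gd ^^ Suc (2 * n)) g u)" for n
  have coeff: "complex_of_real ((-1) ^ n / real (2 * n + 1) * sqrt \<epsilon> ^ (2 * n + 1)) * t_symbol_coeff \<epsilon> ^ Suc (2 * n)
      = - \<i> * of_real (1 / real (2 * n + 1))" for n
  proof -
    have "complex_of_real (sqrt \<epsilon>) * t_symbol_coeff \<epsilon> = - \<i>"
      using eps by (simp add: t_symbol_coeff_def)
    then have "complex_of_real (sqrt \<epsilon>) ^ Suc (2 * n) * t_symbol_coeff \<epsilon> ^ Suc (2 * n) = (- \<i>) ^ Suc (2 * n)"
      by (simp only: power_mult_distrib[symmetric])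
    also have "\<dots> = - \<i> * (- 1) ^ n"
      by (simp add: power_mult)
    finally have *: "complex_of_real (sqrt \<epsilon>) ^ Suc (2 * n) * t_symbol_coeff \<epsilon> ^ Suc (2 * n) = - \<i> * (- 1) ^ n" .
    have "complex_of_real ((-1) ^ n / real (2 * n + 1) * sqrt \<epsilon> ^ (2 * n + 1)) * t_symbol_coeff \<epsilon> ^ Suc (2 * n)
        = complex_of_real ((-1) ^ n / real (2 * n + 1)) * (complex_of_real (sqrt \<epsilon>) ^ Suc (2 * n) * t_symbol_coeff \<epsilon> ^ Suc (2 * n))"
      by (simp only: of_real_mult of_real_power Suc_eq_plus1 mult.assoc)
    also have "\<dots> = - \<i> * (complex_of_real ((-1) ^ n / real (2 * n + 1) * (-1) ^ n))"
      unfolding * by (simp only: of_real_mult of_real_power of_real_minus of_real_1 mult_ac)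
    also have "(-1) ^ n / real (2 * n + 1) * (-1) ^ n = 1 / real (2 * n + 1)"
      by (simp add: power_mult_distrib[symmetric] del: of_nat_add of_nat_mult)
    finally show ?thesis .
  qed
  have s: "(\<lambda>N x. \<Sum>n\<le>N. complex_of_real ((-1) ^ n / real (2 * n + 1) * sqrt \<epsilon> ^ (2 * n + 1)) * u n x)
      = (\<lambda>N x. - \<i> * lift \<epsilon> \<sigma> (artanh_sum N g) x)"
    unfolding u_def lift_cmult mult.assoc[symmetric] coeff lift_artanh_sum sum_distrib_left
    by (simp only: Suc_eq_plus1)
  show ?thesis
    unfolding S_block_alt S_gen_iff
  proof (intro conjI exI allI)
    show "(if \<sigma> = 0 then L2_even else L2_odd) (lift \<epsilon> \<sigma> g)" by (rule lift_parity[OF g \<sigma>])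
    show "(lift \<epsilon> \<sigma> g, u n) \<in> t_block \<sigma> ^^ Suc (2 * n)" for n
      unfolding u_def by (rule t_block_relpow_lift[OF eps g \<sigma>])
    show "L2 (\<lambda>x. - \<i> * artanh_lift \<epsilon> \<sigma> g x)" by (rule L2_cmult[OF A(1)])
    show "l2_tendsto (\<lambda>N x. \<Sum>n\<le>N. complex_of_real ((-1) ^ n / real (2 * n + 1) * sqrt \<epsilon> ^ (2 * n + 1)) * u n x)
        (\<lambda>x. - \<i> * artanh_lift \<epsilon> \<sigma> g x)"
      unfolding s by (rule l2_tendsto_cmult[OF A(2)])
    show "L2 (\<lambda>x. \<i> * of_real (1 / sqrt \<epsilon>) * artanh_lift \<epsilon> \<sigma> g x)" by (rule L2_cmult[OF A(1)])
    show "ae_eq (\<lambda>x. \<i> * of_real (1 / sqrt \<epsilon>) * artanh_lift \<epsilon> \<sigma> g x)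
        (\<lambda>x. - complex_of_real (1 / sqrt \<epsilon>) * (- \<i> * artanh_lift \<epsilon> \<sigma> g x))"
      by (simp add: ae_eq_def)
  qed
qed

lemma deriv_symbol_gspan:
  assumes "g \<in> gspan"
  shows "deriv_symbol \<epsilon> \<sigma> g \<in> gspan"
proof -
  have "(\<lambda>u. of_real (1 / sqrt \<epsilon>) * gd g u) \<in> gspan" "(\<lambda>u. g u + 2 * (of_real u * gd g u)) \<in> gspan"
    by (intro gspan_cmult gspan_add gspan_umult gspan_gd assms)+
  then show ?thesis by (cases "\<sigma> = 0") (simp_all only: deriv_symbol_def[abs_def] simp_thms if_True if_False)
qed

lemma lift_deriv_eq: "\<sigma> \<le> 1 \<Longrightarrow> lift_deriv \<epsilon> \<sigma> g = lift \<epsilon> (1 - \<sigma>) (deriv_symbol \<epsilon> \<sigma> g)"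
  by (cases "\<sigma> = 0") (auto simp: lift_deriv_def deriv_symbol_def[abs_def])

lemma lift_h_symbol:
  assumes g: "g \<in> gspan" and \<sigma>: "\<sigma> \<le> 1"
  shows "lift \<epsilon> \<sigma> (h_symbol \<epsilon> \<sigma> g) x
    = (of_real (x\<^sup>2) * lift \<epsilon> \<sigma> g x - of_real \<epsilon> * lift_deriv \<epsilon> (1 - \<sigma>) (deriv_symbol \<epsilon> \<sigma> g) x) / 2"
proof -
  define s where "s = complex_of_real (sqrt \<epsilon>)"
  have s: "s \<noteq> 0" "complex_of_real \<epsilon> = s * s"
    using eps complex_sqrt_eps_square[OF eps] by (auto simp: s_def)
  have mem: "gd g \<in> gspan" by (rule gspan_gd[OF g])
  show ?thesis
  proof (cases "\<sigma> = 0")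
    case True
    have e: "gd (deriv_symbol \<epsilon> 0 g) = (\<lambda>u. of_real (1 / sqrt \<epsilon>) * gd (gd g) u)"
      by (simp only: deriv_symbol_def[abs_def] if_True simp_thms gd_cmult[OF mem])
    show ?thesis using s(1)
      unfolding True s(2) by (simp add: lift_deriv_def e lift_def h_symbol_def deriv_symbol_def numeral_2_eq_2 s_def[symmetric] field_simps)
  next
    case False
    then have \<sigma>1: "\<sigma> = 1" using \<sigma> by simp
    have "gd (deriv_symbol \<epsilon> 1 g) = gd (\<lambda>u. g u + 2 * (of_real u * gd g u))"
      by (simp add: deriv_symbol_def[abs_def])
    also have "\<dots> = (\<lambda>u. gd g u + 2 * (gd g u + of_real u * gd (gd g) u))"
      by (simp only: gd_add[OF g gspan_cmult[OF gspan_umult[OF mem]]] gd_cmult[OF gspan_umult[OF mem]] gd_umult[OF mem])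
    finally have e: "gd (deriv_symbol \<epsilon> 1 g) = (\<lambda>u. gd g u + 2 * (gd g u + of_real u * gd (gd g) u))" .
    show ?thesis using s(1)
      unfolding \<sigma>1 s(2) by (simp add: lift_deriv_def e[simplified] lift_def h_symbol_def numeral_2_eq_2 s_def[symmetric] field_simps)
  qed
qed

lemma L2_square_mult_lift:
  assumes g: "g \<in> gspan" and \<sigma>: "\<sigma> \<le> 1"
  shows "L2 (\<lambda>x. of_real (x\<^sup>2) * lift \<epsilon> \<sigma> g x)" "L2 (\<lambda>x. of_real x * lift \<epsilon> \<sigma> g x)"
proof -
  have 2: "(\<lambda>x. of_real (x\<^sup>2) * lift \<epsilon> \<sigma> g x) = (\<lambda>x. of_real (2 * sqrt \<epsilon>) * lift \<epsilon> \<sigma> (\<lambda>u. of_real u * g u) x)"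
    using eps by (simp add: lift_umult[OF eps] fun_eq_iff)
  show "L2 (\<lambda>x. of_real (x\<^sup>2) * lift \<epsilon> \<sigma> g x)"
    unfolding 2 by (intro L2_cmult L2_lift[OF eps] gspan_umult g \<sigma>)
  show "L2 (\<lambda>x. of_real x * lift \<epsilon> \<sigma> g x)"
  proof (cases "\<sigma> = 0")
    case True
    have "(\<lambda>x. of_real x * lift \<epsilon> 0 g x) = lift \<epsilon> 1 g" by (simp add: lift_def fun_eq_iff)
    then show ?thesis using L2_lift_1[OF eps g] True by simp
  next
    case False
    then have "\<sigma> = 1" using \<sigma> by simp
    then have "(\<lambda>x. of_real x * lift \<epsilon> \<sigma> g x) = (\<lambda>x. of_real (2 * sqrt \<epsilon>) * lift \<epsilon> 0 (\<lambda>u. of_real u * g u) x)"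
      using eps by (simp add: lift_def fun_eq_iff power2_eq_square)
    then show ?thesis using L2_cmult[OF L2_lift_0[OF eps gspan_umult[OF g]]] by simp
  qed
qed

lemma h_op_lift:
  assumes g: "g \<in> gspan" and \<sigma>: "\<sigma> \<le> 1"
  shows "(lift \<epsilon> \<sigma> g, lift \<epsilon> \<sigma> (h_symbol \<epsilon> \<sigma> g)) \<in> h_op \<epsilon>"
proof -
  note d = deriv_symbol_gspan[OF g, of \<sigma>]
  have "(lift \<epsilon> \<sigma> g, \<lambda>x. - \<i> * lift \<epsilon> (1 - \<sigma>) (deriv_symbol \<epsilon> \<sigma> g) x) \<in> p_op"
    using lift_p_op[OF eps g \<sigma>] by (simp add: lift_deriv_eq[OF \<sigma>])
  moreover have "(\<lambda>x. - \<i> * lift \<epsilon> (1 - \<sigma>) (deriv_symbol \<epsilon> \<sigma> g) x,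
      \<lambda>x. - \<i> * (- \<i> * lift_deriv \<epsilon> (1 - \<sigma>) (deriv_symbol \<epsilon> \<sigma> g) x)) \<in> p_op"
    by (rule linear_ae_opD(4)[OF linear_ae_op_p_op lift_p_op[OF eps d]]) simp
  ultimately have p: "(lift \<epsilon> \<sigma> g, \<lambda>x. - \<i> * (- \<i> * lift_deriv \<epsilon> (1 - \<sigma>) (deriv_symbol \<epsilon> \<sigma> g) x)) \<in> p_op O p_op"
    by blast
  have "(lift \<epsilon> \<sigma> g, \<lambda>x. of_real x * lift \<epsilon> \<sigma> g x) \<in> q_op"
    by (simp add: q_op_def L2_lift[OF eps g \<sigma>] L2_square_mult_lift[OF g \<sigma>])
  moreover have "(\<lambda>x. of_real x * lift \<epsilon> \<sigma> g x, \<lambda>x. of_real (x\<^sup>2) * lift \<epsilon> \<sigma> g x) \<in> q_op"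
    using L2_square_mult_lift[OF g \<sigma>] by (simp add: q_op_def power2_eq_square mult.assoc)
  ultimately have q: "(lift \<epsilon> \<sigma> g, \<lambda>x. of_real (x\<^sup>2) * lift \<epsilon> \<sigma> g x) \<in> q_op O q_op" by blast
  have "ae_eq (lift \<epsilon> \<sigma> (h_symbol \<epsilon> \<sigma> g)) (\<lambda>x. (complex_of_real \<epsilon> *
      (- \<i> * (- \<i> * lift_deriv \<epsilon> (1 - \<sigma>) (deriv_symbol \<epsilon> \<sigma> g) x)) + of_real (x\<^sup>2) * lift \<epsilon> \<sigma> g x) / 2)"
    unfolding ae_eq_def lift_h_symbol[OF g \<sigma>] by (intro AE_I2) (simp add: algebra_simps)
  then show ?thesis
    unfolding h_op_def using p q L2_lift[OF eps h_symbol_gspan[OF g] \<sigma>] by blast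
qed

text \<open>The potential term is symmetric as it stands, and one integration by parts turns the
  kinetic term into an integral of a product of first derivatives, which is symmetric too.\<close>

lemma h_symbol_symmetric:
  assumes g: "g \<in> gspan" and h: "h \<in> gspan" and \<sigma>: "\<sigma> \<le> 1"
  shows "l2_inner (lift \<epsilon> \<sigma> (h_symbol \<epsilon> \<sigma> g)) (lift \<epsilon> \<sigma> h) = l2_inner (lift \<epsilon> \<sigma> g) (lift \<epsilon> \<sigma> (h_symbol \<epsilon> \<sigma> h))"
proof -
  \<comment> \<open>A lift is itself in the domain of \<open>p_op\<close>, so
    \<open>p_op_lift\<close> may be used with a lift in both roles.\<close>
  have swap: "(LINT x|lborel. lift \<epsilon> \<sigma> a x * lift_deriv \<epsilon> (1 - \<sigma>) (deriv_symbol \<epsilon> \<sigma> b) x)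
      = - (LINT x|lborel. lift_deriv \<epsilon> \<sigma> a x * lift_deriv \<epsilon> \<sigma> b x)" if "a \<in> gspan" "b \<in> gspan" for a b
    using p_op_lift[OF eps lift_p_op[OF eps that(1) \<sigma>] _ deriv_symbol_gspan[OF that(2)], of "1 - \<sigma>" \<sigma>]
    by (simp add: lift_deriv_eq[OF \<sigma>, of b] mult.assoc)
  \<comment> \<open>Conjugating g first makes the pairing bilinear; \<open>h_symbol\<close> has real
    coefficients and commutes with the conjugation.\<close>
  let ?a = "\<lambda>u. cnj (g u)"
  have ga: "?a \<in> gspan" by (rule gspan_cnj[OF g])
  have d: "1 - \<sigma> \<le> 1" by simp
  note I = integrable_L2_mult[OF L2_lift[OF eps _ \<sigma>] L2_lift_deriv[OF eps deriv_symbol_gspan d]]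
    integrable_L2_mult[OF L2_square_mult_lift(1)[OF _ \<sigma>] L2_lift[OF eps _ \<sigma>]]
  have expand: "(LINT x|lborel. lift \<epsilon> \<sigma> (h_symbol \<epsilon> \<sigma> b) x * lift \<epsilon> \<sigma> a x)
      = ((LINT x|lborel. of_real (x\<^sup>2) * lift \<epsilon> \<sigma> b x * lift \<epsilon> \<sigma> a x)
        - of_real \<epsilon> * (LINT x|lborel. lift \<epsilon> \<sigma> a x * lift_deriv \<epsilon> (1 - \<sigma>) (deriv_symbol \<epsilon> \<sigma> b) x)) / 2"
    if "a \<in> gspan" "b \<in> gspan" for a b
  proof -
    have "(LINT x|lborel. lift \<epsilon> \<sigma> (h_symbol \<epsilon> \<sigma> b) x * lift \<epsilon> \<sigma> a x)
        = (LINT x|lborel. (of_real (x\<^sup>2) * lift \<epsilon> \<sigma> b x * lift \<epsilon> \<sigma> a x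
          - of_real \<epsilon> * (lift \<epsilon> \<sigma> a x * lift_deriv \<epsilon> (1 - \<sigma>) (deriv_symbol \<epsilon> \<sigma> b) x)) / 2)"
      unfolding lift_h_symbol[OF that(2) \<sigma>]
      by (rule Bochner_Integration.integral_cong) (simp_all add: field_simps)
    then show ?thesis using I(1)[OF that(1,2)] I(2)[OF that(2,1)] by simp
  qed
  have "l2_inner (lift \<epsilon> \<sigma> (h_symbol \<epsilon> \<sigma> g)) (lift \<epsilon> \<sigma> h)
      = (LINT x|lborel. lift \<epsilon> \<sigma> (h_symbol \<epsilon> \<sigma> ?a) x * lift \<epsilon> \<sigma> h x)"
    unfolding l2_inner_def h_symbol_cnj[OF g, abs_def] by (simp add: lift_def h_symbol_cnj[OF g])
  also have "\<dots> = (LINT x|lborel. lift \<epsilon> \<sigma> (h_symbol \<epsilon> \<sigma> h) x * lift \<epsilon> \<sigma> ?a x)"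
    unfolding expand[OF h ga] expand[OF ga h] swap[OF h ga] swap[OF ga h] by (simp only: mult_ac)
  also have "\<dots> = l2_inner (lift \<epsilon> \<sigma> g) (lift \<epsilon> \<sigma> (h_symbol \<epsilon> \<sigma> h))"
    unfolding l2_inner_def lift_cnj by (simp only: mult.commute)
  finally show ?thesis .
qed

text \<open>For each N, symmetry moves \<open>h_symbol\<close> from g onto the partial sum, where
  the telescoped commutator applies; then N tends to infinity inside the inner products. The
  unbounded operator thus never meets the limit of the series.\<close>

lemma artanh_lift_commutator:
  assumes g: "g \<in> gspan" and h: "h \<in> gspan" and \<sigma>: "\<sigma> \<le> 1"
  shows "l2_inner (lift \<epsilon> \<sigma> (h_symbol \<epsilon> \<sigma> g)) (artanh_lift \<epsilon> \<sigma> h)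
      - l2_inner (lift \<epsilon> \<sigma> g) (artanh_lift \<epsilon> \<sigma> (h_symbol \<epsilon> \<sigma> h))
    = - of_real (sqrt \<epsilon>) * l2_inner (lift \<epsilon> \<sigma> g) (lift \<epsilon> \<sigma> h)"
proof -
  let ?K = "h_symbol \<epsilon> \<sigma>"
  note Lg = L2_lift[OF eps g \<sigma>] and Lh = L2_lift[OF eps h \<sigma>]
  have step: "l2_inner (lift \<epsilon> \<sigma> (?K g)) (lift \<epsilon> \<sigma> (artanh_sum N h))
      - l2_inner (lift \<epsilon> \<sigma> g) (lift \<epsilon> \<sigma> (artanh_sum N (?K h)))
    = - of_real (sqrt \<epsilon>) * (l2_inner (lift \<epsilon> \<sigma> g) (lift \<epsilon> \<sigma> h)
        - l2_inner (lift \<epsilon> \<sigma> g) (lift \<epsilon> \<sigma> ((gd ^^ (2 * N + 2)) h)))" for N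
  proof -
    have A: "artanh_sum N h \<in> gspan" "artanh_sum N (?K h) \<in> gspan"
      by (intro artanh_sum_gspan h_symbol_gspan h)+
    have "lift \<epsilon> \<sigma> (?K (artanh_sum N h)) x - lift \<epsilon> \<sigma> (artanh_sum N (?K h)) x
        = - of_real (sqrt \<epsilon>) * (lift \<epsilon> \<sigma> h x - lift \<epsilon> \<sigma> ((gd ^^ (2 * N + 2)) h) x)" for x
    proof -
      have "lift \<epsilon> \<sigma> (?K (artanh_sum N h)) x - lift \<epsilon> \<sigma> (artanh_sum N (?K h)) x
          = - lift \<epsilon> \<sigma> (\<lambda>u. artanh_sum N (?K h) u - ?K (artanh_sum N h) u) x"
        by (simp only: lift_diff minus_diff_eq)
      also have "\<dots> = - (of_real (sqrt \<epsilon>) * (lift \<epsilon> \<sigma> h x - lift \<epsilon> \<sigma> ((gd ^^ (2 * N + 2)) h) x))"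
        by (simp only: artanh_sum_h_symbol[OF h] lift_cmult lift_diff)
      finally show ?thesis by (simp only: mult_minus_left)
    qed
    then have e: "(\<lambda>x. lift \<epsilon> \<sigma> (?K (artanh_sum N h)) x - lift \<epsilon> \<sigma> (artanh_sum N (?K h)) x)
        = (\<lambda>x. - of_real (sqrt \<epsilon>) * (lift \<epsilon> \<sigma> h x - lift \<epsilon> \<sigma> ((gd ^^ (2 * N + 2)) h) x))"
      by (rule ext)
    have "l2_inner (lift \<epsilon> \<sigma> (?K g)) (lift \<epsilon> \<sigma> (artanh_sum N h))
        - l2_inner (lift \<epsilon> \<sigma> g) (lift \<epsilon> \<sigma> (artanh_sum N (?K h)))
        = l2_inner (lift \<epsilon> \<sigma> g) (\<lambda>x. lift \<epsilon> \<sigma> (?K (artanh_sum N h)) x - lift \<epsilon> \<sigma> (artanh_sum N (?K h)) x)"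
      unfolding h_symbol_symmetric[OF g A(1) \<sigma>]
      by (rule l2_inner_diff_right[symmetric, OF Lg L2_lift[OF eps h_symbol_gspan[OF A(1)] \<sigma>] L2_lift[OF eps A(2) \<sigma>]])
    also have "\<dots> = - of_real (sqrt \<epsilon>) * (l2_inner (lift \<epsilon> \<sigma> g) (lift \<epsilon> \<sigma> h)
        - l2_inner (lift \<epsilon> \<sigma> g) (lift \<epsilon> \<sigma> ((gd ^^ (2 * N + 2)) h)))"
      unfolding e l2_inner_cmult_right
      by (subst l2_inner_diff_right[OF Lg Lh L2_lift[OF eps gspan_funpow_gd[OF h] \<sigma>]]) (rule refl)
    finally show ?thesis .
  qed
  have "(\<lambda>N. l2_inner (lift \<epsilon> \<sigma> (?K g)) (lift \<epsilon> \<sigma> (artanh_sum N h))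
      - l2_inner (lift \<epsilon> \<sigma> g) (lift \<epsilon> \<sigma> (artanh_sum N (?K h))))
    \<longlonglongrightarrow> l2_inner (lift \<epsilon> \<sigma> (?K g)) (artanh_lift \<epsilon> \<sigma> h) - l2_inner (lift \<epsilon> \<sigma> g) (artanh_lift \<epsilon> \<sigma> (?K h))"
    by (intro tendsto_diff artanh_lift_limits(3)[OF eps] h h_symbol_gspan \<sigma> L2_lift[OF eps] g)
  moreover have "(\<lambda>N. - of_real (sqrt \<epsilon>) * (l2_inner (lift \<epsilon> \<sigma> g) (lift \<epsilon> \<sigma> h)
        - l2_inner (lift \<epsilon> \<sigma> g) (lift \<epsilon> \<sigma> ((gd ^^ (2 * N + 2)) h))))
    \<longlonglongrightarrow> - of_real (sqrt \<epsilon>) * (l2_inner (lift \<epsilon> \<sigma> g) (lift \<epsilon> \<sigma> h) - 0)"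
    by (intro tendsto_mult tendsto_const tendsto_diff lift_funpow_gd_tendsto_zero[OF eps h \<sigma> Lg])
  ultimately show ?thesis
    unfolding step using LIMSEQ_unique by fastforce
qed

end

section \<open>The sesquilinear form\<close>

lemma op_app_in: "f \<in> Domain A \<Longrightarrow> (f, op_app A f) \<in> A"
  unfolding op_app_def Domain_iff by (rule someI_ex[of "\<lambda>g. (f, g) \<in> A"])

text \<open>One parity of \<open>t_form\<close> for an abstract operator. The symmetrisation makes
  it Hermitian by construction, so linearity in the second slot follows from antilinearity in the
  first.\<close>

definition block_form :: "((real \<Rightarrow> complex) \<times> (real \<Rightarrow> complex)) set \<Rightarrow>
    (real \<Rightarrow> complex) \<Rightarrow> (real \<Rightarrow> complex) \<Rightarrow> complex" where
  "block_form A \<psi> \<phi> = (l2_inner \<psi> (op_app A \<phi>) + l2_inner (op_app A \<psi>) \<phi>) / 2"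

lemma t_form_block_form:
  "t_form \<epsilon> \<psi> \<phi> = block_form (S_block \<epsilon> 0) (even_part \<psi>) (even_part \<phi>)
     + block_form (S_block \<epsilon> 1) (odd_part \<psi>) (odd_part \<phi>)"
  by (simp add: t_form_def block_form_def S_block_def)

lemma cnj_block_form: "cnj (block_form A \<psi> \<phi>) = block_form A \<phi> \<psi>"
  by (simp add: block_form_def cnj_l2_inner add.commute)

text \<open>Frees the form from the choice made in \<open>op_app\<close>: any two values of the
  operator agree almost everywhere and give the same inner products.\<close>

lemma block_form_eq:
  assumes A: "linear_ae_op A" and "(\<psi>, s) \<in> A" "(\<phi>, r) \<in> A"
  shows "block_form A \<psi> \<phi> = (l2_inner \<psi> r + l2_inner s \<phi>) / 2"
proof -
  note a = linear_ae_opD[OF A]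
  have \<psi>: "(\<psi>, op_app A \<psi>) \<in> A" and \<phi>: "(\<phi>, op_app A \<phi>) \<in> A"
    using assms by (auto intro: op_app_in)
  have "l2_inner \<psi> (op_app A \<phi>) = l2_inner \<psi> r"
    by (rule l2_inner_cong[OF ae_eq_refl a(6)[OF \<phi> assms(3) ae_eq_refl]])
      (rule a(1)[OF \<psi>] a(2)[OF \<phi>] a(2)[OF assms(3)])+
  moreover have "l2_inner (op_app A \<psi>) \<phi> = l2_inner s \<phi>"
    by (rule l2_inner_cong[OF a(6)[OF \<psi> assms(2) ae_eq_refl] ae_eq_refl])
      (rule a(1)[OF \<phi>] a(2)[OF \<psi>] a(2)[OF assms(2)])+
  ultimately show ?thesis by (simp add: block_form_def)
qed

lemma block_form_add_left:
  assumes A: "linear_ae_op A" and "\<psi> \<in> Domain A" "\<psi>' \<in> Domain A" "\<phi> \<in> Domain A"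
  shows "block_form A (\<lambda>x. \<psi> x + \<psi>' x) \<phi> = block_form A \<psi> \<phi> + block_form A \<psi>' \<phi>"
proof -
  note a = linear_ae_opD[OF A]
  obtain s s' r where m: "(\<psi>, s) \<in> A" "(\<psi>', s') \<in> A" "(\<phi>, r) \<in> A" using assms(2-4) by blast
  show ?thesis
    unfolding block_form_eq[OF A a(3)[OF m(1,2)] m(3)] block_form_eq[OF A m(1,3)] block_form_eq[OF A m(2,3)]
      l2_inner_add_left[OF a(1)[OF m(1)] a(1)[OF m(2)] a(2)[OF m(3)]]
      l2_inner_add_left[OF a(2)[OF m(1)] a(2)[OF m(2)] a(1)[OF m(3)]]
    by (simp add: field_simps)
qed

lemma block_form_cmult_left:
  assumes A: "linear_ae_op A" and "\<psi> \<in> Domain A" "\<phi> \<in> Domain A"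
  shows "block_form A (\<lambda>x. c * \<psi> x) \<phi> = cnj c * block_form A \<psi> \<phi>"
proof -
  note a = linear_ae_opD[OF A]
  obtain s r where m: "(\<psi>, s) \<in> A" "(\<phi>, r) \<in> A" using assms(2-3) by blast
  show ?thesis
    unfolding block_form_eq[OF A a(4)[OF m(1)] m(2)] block_form_eq[OF A m] l2_inner_cmult_left
    by (simp add: field_simps)
qed

lemma Domain_ae_cong:
  assumes "linear_ae_op A" "\<psi> \<in> Domain A" "L2 \<psi>'" "ae_eq \<psi> \<psi>'"
  shows "\<psi>' \<in> Domain A"
  using linear_ae_opD(2,5)[OF assms(1)] assms(2-4) ae_eq_refl by (metis Domain.simps)

text \<open>The commutation relation inserts an arbitrary representative of the image under
  \<open>h_op\<close> into the form, so invariance in that slot is required.\<close>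

lemma block_form_cong_left:
  assumes A: "linear_ae_op A" and "\<psi> \<in> Domain A" "\<phi> \<in> Domain A" "L2 \<psi>'" "ae_eq \<psi> \<psi>'"
  shows "block_form A \<psi>' \<phi> = block_form A \<psi> \<phi>"
proof -
  note a = linear_ae_opD[OF A]
  obtain s r where m: "(\<psi>, s) \<in> A" "(\<phi>, r) \<in> A" using assms(2-3) by blast
  have m': "(\<psi>', s) \<in> A"
    by (rule a(5)[OF m(1) assms(4) a(2)[OF m(1)] assms(5) ae_eq_refl])
  have "l2_inner \<psi>' r = l2_inner \<psi> r"
    by (rule l2_inner_cong[OF ae_eq_sym[OF assms(5)] ae_eq_refl assms(4) a(1)[OF m(1)] a(2)[OF m(2)] a(2)[OF m(2)]])
  then show ?thesis unfolding block_form_eq[OF A m' m(2)] block_form_eq[OF A m] by simp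
qed

lemma even_part_add: "even_part (\<lambda>x. f x + g x) = (\<lambda>x. even_part f x + even_part g x)"
  by (simp add: even_part_def fun_eq_iff field_simps)

lemma odd_part_add: "odd_part (\<lambda>x. f x + g x) = (\<lambda>x. odd_part f x + odd_part g x)"
  by (simp add: odd_part_def fun_eq_iff field_simps)

lemma even_part_cmult: "even_part (\<lambda>x. c * f x) = (\<lambda>x. c * even_part f x)"
  by (simp add: even_part_def fun_eq_iff field_simps)

lemma odd_part_cmult: "odd_part (\<lambda>x. c * f x) = (\<lambda>x. c * odd_part f x)"
  by (simp add: odd_part_def fun_eq_iff field_simps)

lemma ae_eq_parts:
  assumes "ae_eq f g"
  shows "ae_eq (even_part f) (even_part g)" "ae_eq (odd_part f) (odd_part g)"
  using ae_eq_reflect[OF assms] assms unfolding ae_eq_def even_part_def odd_part_def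
  by (eventually_elim, simp)+

lemma L2_parts:
  assumes "L2 f"
  shows "L2 (even_part f)" "L2 (odd_part f)"
proof -
  have "L2 (\<lambda>x. 1 / 2 * (f x + f (- x)))" "L2 (\<lambda>x. 1 / 2 * (f x - f (- x)))"
    by (intro L2_cmult L2_add L2_diff L2_reflect assms)+
  then show "L2 (even_part f)" "L2 (odd_part f)"
    by (simp_all add: even_part_def[abs_def] odd_part_def[abs_def])
qed

lemma frakD_iff:
  "\<psi> \<in> frakD \<epsilon> \<longleftrightarrow> L2 \<psi> \<and> even_part \<psi> \<in> Domain (S_block \<epsilon> 0) \<and> odd_part \<psi> \<in> Domain (S_block \<epsilon> 1)"
  by (simp add: frakD_def S_block_def)

lemma frakD_add: "f \<in> frakD \<epsilon> \<Longrightarrow> g \<in> frakD \<epsilon> \<Longrightarrow> (\<lambda>x. f x + g x) \<in> frakD \<epsilon>"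
  unfolding frakD_iff even_part_add odd_part_add
  using linear_ae_opD(3)[OF linear_ae_op_S_block] L2_add by (meson Domain.simps)

lemma frakD_cmult: "f \<in> frakD \<epsilon> \<Longrightarrow> (\<lambda>x. c * f x) \<in> frakD \<epsilon>"
  unfolding frakD_iff even_part_cmult odd_part_cmult
  using linear_ae_opD(4)[OF linear_ae_op_S_block] L2_cmult by (meson Domain.simps)

lemma frakD_ae_cong:
  assumes "f \<in> frakD \<epsilon>" "L2 g" "ae_eq f g"
  shows "g \<in> frakD \<epsilon>"
  unfolding frakD_iff
proof (intro conjI)
  show "even_part g \<in> Domain (S_block \<epsilon> 0)"
    by (rule Domain_ae_cong[OF linear_ae_op_S_block _ L2_parts(1)[OF assms(2)] ae_eq_parts(1)[OF assms(3)]])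
      (use assms(1) in \<open>simp add: frakD_iff\<close>)
  show "odd_part g \<in> Domain (S_block \<epsilon> 1)"
    by (rule Domain_ae_cong[OF linear_ae_op_S_block _ L2_parts(2)[OF assms(2)] ae_eq_parts(2)[OF assms(3)]])
      (use assms(1) in \<open>simp add: frakD_iff\<close>)
qed (fact assms(2))

lemma cnj_t_form: "cnj (t_form \<epsilon> \<psi> \<phi>) = t_form \<epsilon> \<phi> \<psi>"
  by (simp add: t_form_block_form cnj_block_form)

lemma t_form_add_left:
  "\<psi> \<in> frakD \<epsilon> \<Longrightarrow> \<psi>' \<in> frakD \<epsilon> \<Longrightarrow> \<phi> \<in> frakD \<epsilon> \<Longrightarrow>
    t_form \<epsilon> (\<lambda>x. \<psi> x + \<psi>' x) \<phi> = t_form \<epsilon> \<psi> \<phi> + t_form \<epsilon> \<psi>' \<phi>"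
  by (simp add: frakD_iff t_form_block_form even_part_add odd_part_add
      block_form_add_left[OF linear_ae_op_S_block])

lemma t_form_cmult_left:
  "\<psi> \<in> frakD \<epsilon> \<Longrightarrow> \<phi> \<in> frakD \<epsilon> \<Longrightarrow> t_form \<epsilon> (\<lambda>x. c * \<psi> x) \<phi> = cnj c * t_form \<epsilon> \<psi> \<phi>"
  by (simp add: frakD_iff t_form_block_form even_part_cmult odd_part_cmult
      block_form_cmult_left[OF linear_ae_op_S_block] distrib_left)

lemma t_form_cong_left:
  assumes "\<psi> \<in> frakD \<epsilon>" "\<phi> \<in> frakD \<epsilon>" "L2 \<psi>'" "ae_eq \<psi> \<psi>'"
  shows "t_form \<epsilon> \<psi>' \<phi> = t_form \<epsilon> \<psi> \<phi>"
  using assms(1,2)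
    block_form_cong_left[OF linear_ae_op_S_block _ _ L2_parts(1)[OF assms(3)] ae_eq_parts(1)[OF assms(4)]]
    block_form_cong_left[OF linear_ae_op_S_block _ _ L2_parts(2)[OF assms(3)] ae_eq_parts(2)[OF assms(4)]]
  by (simp add: frakD_iff t_form_block_form)

lemma sesquilinear_t_form: "sesquilinear_on (frakD \<epsilon>) (frakD \<epsilon>) (t_form \<epsilon>)"
  unfolding sesquilinear_on_def
proof (intro conjI ballI allI)
  fix \<phi> \<psi> \<psi>' c assume m: "\<phi> \<in> frakD \<epsilon>" "\<psi> \<in> frakD \<epsilon>" "\<psi>' \<in> frakD \<epsilon>"
  show "t_form \<epsilon> \<phi> (\<lambda>x. \<psi> x + \<psi>' x) = t_form \<epsilon> \<phi> \<psi> + t_form \<epsilon> \<phi> \<psi>'"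
    using arg_cong[OF t_form_add_left[OF m(2,3,1)], of cnj] by (simp add: cnj_t_form)
next
  fix \<phi> \<psi> c assume m: "\<phi> \<in> frakD \<epsilon>" "\<psi> \<in> frakD \<epsilon>"
  show "t_form \<epsilon> \<phi> (\<lambda>x. c * \<psi> x) = c * t_form \<epsilon> \<phi> \<psi>"
    using arg_cong[OF t_form_cmult_left[OF m(2,1)], of cnj] by (simp add: cnj_t_form)
qed (simp_all add: t_form_add_left t_form_cmult_left)

text \<open>\<open>ultra_weak_time_op\<close> quantifies over every value that the graph assigns;
  uniqueness almost everywhere reduces these to the explicit image given by
  \<open>h_symbol\<close>.\<close>

lemma linear_ae_op_h_op: "linear_ae_op (h_op \<epsilon>)"
proof (rule linear_ae_opI)
  note pp = linear_ae_opD[OF linear_ae_op_comp[OF linear_ae_op_p_op linear_ae_op_p_op]]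
  note qq = linear_ae_opD[OF linear_ae_op_comp[OF linear_ae_op_q_op linear_ae_op_q_op]]
  have iff: "(f, g) \<in> h_op \<epsilon> \<longleftrightarrow> (\<exists>a b. (f, a) \<in> p_op O p_op \<and> (f, b) \<in> q_op O q_op \<and> L2 g \<and>
      (AE x in lborel. g x = (complex_of_real \<epsilon> * a x + b x) / 2))" for f g
    by (simp add: h_op_def ae_eq_def)
  fix f g assume "(f, g) \<in> h_op \<epsilon>"
  then obtain a b where a: "(f, a) \<in> p_op O p_op" and b: "(f, b) \<in> q_op O q_op" and g: "L2 g"
    "AE x in lborel. g x = (complex_of_real \<epsilon> * a x + b x) / 2"
    unfolding iff by blast
  show "L2 f" by (rule pp(1)[OF a])
  show "L2 g" by (rule g(1))
  show "(\<lambda>x. c * f x, \<lambda>x. c * g x) \<in> h_op \<epsilon>" for c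
  proof -
    have "AE x in lborel. c * g x = (complex_of_real \<epsilon> * (c * a x) + c * b x) / 2"
      using g(2) by eventually_elim (simp add: field_simps)
    then show ?thesis
      unfolding iff using pp(4)[OF a, of c] qq(4)[OF b, of c] L2_cmult[OF g(1)] by blast
  qed
  show "(f', g') \<in> h_op \<epsilon>" if *: "L2 f'" "L2 g'" "ae_eq f f'" "ae_eq g g'" for f' g'
  proof -
    have "AE x in lborel. g' x = (complex_of_real \<epsilon> * a x + b x) / 2"
      using g(2) *(4) unfolding ae_eq_def by eventually_elim simp
    then show ?thesis
      unfolding iff using pp(5)[OF a *(1) pp(2)[OF a] *(3) ae_eq_refl]
        qq(5)[OF b *(1) qq(2)[OF b] *(3) ae_eq_refl] *(2) by blast
  qed
  fix f' g' assume "(f', g') \<in> h_op \<epsilon>"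
  then obtain a' b' where a': "(f', a') \<in> p_op O p_op" and b': "(f', b') \<in> q_op O q_op" and g': "L2 g'"
    "AE x in lborel. g' x = (complex_of_real \<epsilon> * a' x + b' x) / 2"
    unfolding iff by blast
  show "(\<lambda>x. f x + f' x, \<lambda>x. g x + g' x) \<in> h_op \<epsilon>"
  proof -
    have "AE x in lborel. g x + g' x = (complex_of_real \<epsilon> * (a x + a' x) + (b x + b' x)) / 2"
      using g(2) g'(2) by eventually_elim (simp add: field_simps)
    then show ?thesis
      unfolding iff using pp(3)[OF a a'] qq(3)[OF b b'] L2_add[OF g(1) g'(1)] by blast
  qed
  assume e: "ae_eq f f'"
  show "ae_eq g g'"
    using g(2) g'(2) pp(6)[OF a a' e] qq(6)[OF b b' e] unfolding ae_eq_def by eventually_elim (simp only:)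
qed

text \<open>Makes lifts of opposite parity orthogonal.\<close>

lemma integral_odd_zero:
  fixes F :: "real \<Rightarrow> complex"
  assumes "\<And>x. F (- x) = - F x"
  shows "(LINT x|lborel. F x) = 0"
proof -
  have "(LINT x|lborel. F x) = - (LINT x|lborel. F x)"
    using lborel_integral_real_affine[of "-1" F 0] assms by simp
  then show ?thesis by simp
qed

section \<open>The CCR domain in terms of lifts\<close>

text \<open>The common shape of \<open>frakM0\<close> and \<open>frakM1\<close>, isolated to compare
  an explicit finite sum with the inductively generated \<open>gspan\<close> only once.\<close>

definition weighted_span :: "(nat \<Rightarrow> real \<Rightarrow> real \<Rightarrow> complex) \<Rightarrow> (real \<Rightarrow> complex) set" where
  "weighted_span W = {f. \<exists>F c. finite F \<and> (\<forall>(n, \<alpha>) \<in> F. 0 < \<alpha> \<and> \<alpha> < 1) \<and>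
      f = (\<lambda>x. \<Sum>(n, \<alpha>) \<in> F. c (n, \<alpha>) * W n \<alpha> x)}"

lemma weighted_span_step:
  assumes f: "f \<in> weighted_span W" and \<alpha>: "0 < \<alpha>" "\<alpha> < 1"
  shows "(\<lambda>x. f x + d * W k \<alpha> x) \<in> weighted_span W"
proof -
  obtain F c where F: "finite F" "\<forall>(n, \<alpha>) \<in> F. 0 < \<alpha> \<and> \<alpha> < 1"
    "f = (\<lambda>x. \<Sum>(n, \<alpha>) \<in> F. c (n, \<alpha>) * W n \<alpha> x)"
    using f unfolding weighted_span_def by blast
  let ?G = "insert (k, \<alpha>) F"
  \<comment> \<open>The pair may already occur in F, so the old and the new coefficients are added
    pointwise; c is arbitrary outside F and must be cut to 0 there.\<close>
  define c1 where "c1 p = (if p \<in> F then c p else 0)" for p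
  define c2 where "c2 p = (if p = (k, \<alpha>) then d else 0)" for p
  have "(\<Sum>p\<in>?G. (c1 p + c2 p) * W (fst p) (snd p) x) = f x + d * W k \<alpha> x" for x
  proof -
    have "(\<Sum>p\<in>?G. c1 p * W (fst p) (snd p) x) = (\<Sum>p\<in>F. c p * W (fst p) (snd p) x)"
      using F(1) by (intro sum.mono_neutral_cong_right) (auto simp: c1_def)
    moreover have "(\<Sum>p\<in>?G. c2 p * W (fst p) (snd p) x) = (\<Sum>p\<in>{(k, \<alpha>)}. d * W k \<alpha> x)"
      using F(1) by (intro sum.mono_neutral_cong_right) (auto simp: c2_def)
    ultimately show ?thesis
      by (simp add: F(3) distrib_right sum.distrib case_prod_beta)
  qed
  then have eq: "(\<lambda>x. f x + d * W k \<alpha> x) = (\<lambda>x. \<Sum>(n, \<alpha>) \<in> ?G. (c1 (n, \<alpha>) + c2 (n, \<alpha>)) * W n \<alpha> x)"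
    by (simp add: case_prod_beta fun_eq_iff)
  have G: "finite ?G" "\<forall>(n, \<alpha>) \<in> ?G. 0 < \<alpha> \<and> \<alpha> < 1" using F \<alpha> by auto
  show ?thesis
    unfolding weighted_span_def mem_Collect_eq
    by (intro exI[of _ ?G] exI[of _ "\<lambda>p. c1 p + c2 p"] conjI G eq)
qed

context
  fixes \<epsilon> :: real
  assumes eps: "0 < \<epsilon>"
begin

text \<open>With s = 2 sqrt \<epsilon> one has x^(2 n) = s^n u^n, so the two families of generators
  differ only by nonzero factors.\<close>

lemma weighted_span_lift:
  "weighted_span (\<lambda>n \<alpha> x. complex_of_real (x ^ (2 * n + \<sigma>) * exp (- \<alpha> * x\<^sup>2 / (2 * sqrt \<epsilon>))))
    = lift \<epsilon> \<sigma> ` gspan" (is "weighted_span ?W = _")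
proof -
  define s where "s = 2 * sqrt \<epsilon>"
  have s: "s \<noteq> 0" using eps by (simp add: s_def)
  have W: "?W n \<alpha> x = of_real (s ^ n) * lift \<epsilon> \<sigma> (gbase n \<alpha>) x" for n \<alpha> x
  proof -
    have "x ^ (2 * n + \<sigma>) = s ^ n * (x ^ \<sigma> * (x\<^sup>2 / s) ^ n)"
    proof -
      have "x ^ (2 * n) = s ^ n * (x\<^sup>2 / s) ^ n"
        using s by (simp add: power_mult power_divide)
      then show ?thesis by (simp only: power_add mult_ac)
    qed
    moreover have "- \<alpha> * x\<^sup>2 / (2 * sqrt \<epsilon>) = - \<alpha> * (x\<^sup>2 / s)" by (simp add: s_def)
    ultimately show ?thesis
      unfolding lift_def gbase_def s_def[symmetric] by (simp only: of_real_mult mult_ac)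
  qed
  show ?thesis
  proof (intro equalityI subsetI)
    fix f assume "f \<in> weighted_span ?W"
    then obtain F c where F: "finite F" "\<forall>(n, \<alpha>) \<in> F. 0 < \<alpha> \<and> \<alpha> < 1"
      "f = (\<lambda>x. \<Sum>(n, \<alpha>) \<in> F. c (n, \<alpha>) * ?W n \<alpha> x)"
      unfolding weighted_span_def by blast
    have "(\<lambda>u. \<Sum>p\<in>F. (c p * of_real (s ^ fst p)) * gbase (fst p) (snd p) u) \<in> gspan"
      using F(2) by (intro gspan_sum gspan_gbase) auto
    moreover have "f = lift \<epsilon> \<sigma> (\<lambda>u. \<Sum>p\<in>F. (c p * of_real (s ^ fst p)) * gbase (fst p) (snd p) u)"
      unfolding F(3) W by (rule ext, unfold lift_sum lift_cmult mult.assoc, rule sum.cong) auto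
    ultimately show "f \<in> lift \<epsilon> \<sigma> ` gspan" by blast
  next
    have "lift \<epsilon> \<sigma> g \<in> weighted_span ?W" if "g \<in> gspan" for g
      using that
    proof induction
      case zero
      have "lift \<epsilon> \<sigma> (\<lambda>u. 0) = (\<lambda>x. 0)" by (simp add: lift_def fun_eq_iff)
      then show ?case unfolding weighted_span_def by (auto intro!: exI[of _ "{}"])
    next
      case (step g \<alpha> c k)
      have "(\<lambda>x. lift \<epsilon> \<sigma> g x + (c / of_real (s ^ k)) * ?W k \<alpha> x) \<in> weighted_span ?W"
        by (rule weighted_span_step[OF step.IH step(2,3)])
      moreover have "lift \<epsilon> \<sigma> (\<lambda>u. g u + c * gbase k \<alpha> u)
          = (\<lambda>x. lift \<epsilon> \<sigma> g x + (c / of_real (s ^ k)) * ?W k \<alpha> x)"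
        unfolding W using s by (simp add: fun_eq_iff lift_add lift_cmult)
      ultimately show ?case by simp
    qed
    then show "f \<in> weighted_span ?W" if "f \<in> lift \<epsilon> \<sigma> ` gspan" for f
      using that by blast
  qed
qed

lemma frakM_eq: "frakM \<epsilon> = {\<lambda>x. lift \<epsilon> 0 g x + lift \<epsilon> 1 h x | g h. g \<in> gspan \<and> h \<in> gspan}"
proof -
  have "frakM0 \<epsilon> = lift \<epsilon> 0 ` gspan"
    using weighted_span_lift[of 0] by (simp add: weighted_span_def frakM0_def)
  moreover have "frakM1 \<epsilon> = lift \<epsilon> 1 ` gspan"
    using weighted_span_lift[of 1] by (simp add: weighted_span_def frakM1_def)
  ultimately show ?thesis by (simp only: frakM_def) (auto simp: image_iff; blast)
qed

lemma parts_lift: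
  "even_part (\<lambda>x. lift \<epsilon> 0 g x + lift \<epsilon> 1 h x) = lift \<epsilon> 0 g"
  "odd_part (\<lambda>x. lift \<epsilon> 0 g x + lift \<epsilon> 1 h x) = lift \<epsilon> 1 h"
  by (simp_all add: even_part_def odd_part_def lift_minus fun_eq_iff)

lemma lift_Domain: "g \<in> gspan \<Longrightarrow> \<sigma> \<le> 1 \<Longrightarrow> lift \<epsilon> \<sigma> g \<in> Domain (S_block \<epsilon> \<sigma>)"
  using S_block_lift[OF eps] by blast

lemma frakM_subset_frakD: "frakM \<epsilon> \<subseteq> frakD \<epsilon>"
proof
  fix f assume "f \<in> frakM \<epsilon>"
  then obtain g h where m: "g \<in> gspan" "h \<in> gspan" and f: "f = (\<lambda>x. lift \<epsilon> 0 g x + lift \<epsilon> 1 h x)"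
    unfolding frakM_eq by blast
  show "f \<in> frakD \<epsilon>"
    unfolding frakD_iff f parts_lift
    by (intro conjI L2_add L2_lift[OF eps] lift_Domain m) simp_all
qed

lemma frakM_nonzero: "\<exists>f\<in>frakM \<epsilon>. \<not> ae_eq f (\<lambda>x. 0)"
proof
  let ?f = "\<lambda>x. lift \<epsilon> 0 (gbase 0 (1 / 2)) x + lift \<epsilon> 1 (\<lambda>u. 0) x"
  show "?f \<in> frakM \<epsilon>"
    unfolding frakM_eq using gbase_in_gspan[of "1/2" 0] gspan.zero by auto
  have "?f x \<noteq> 0" for x by (simp add: lift_def gbase_def)
  moreover have "\<not> (AE x in (lborel :: real measure). False)"
    using ae_filter_eq_bot_iff[of "lborel :: real measure"] by (simp add: eventually_False)
  ultimately show "\<not> ae_eq ?f (\<lambda>x. 0)" by (simp add: ae_eq_def)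
qed

lemma nz_subspace_frakM: "nz_subspace (frakM \<epsilon>)"
  unfolding nz_subspace_def
proof (intro conjI ballI allI frakM_nonzero)
  show "L2 f" if "f \<in> frakM \<epsilon>" for f
    using that frakM_subset_frakD by (auto simp: frakD_iff)
  have "lift \<epsilon> \<sigma> (\<lambda>u. 0) = (\<lambda>x. 0)" for \<sigma> by (simp add: lift_def fun_eq_iff)
  then have "(\<lambda>x. 0) = (\<lambda>x. lift \<epsilon> 0 (\<lambda>u. 0) x + lift \<epsilon> 1 (\<lambda>u. 0) x)" by simp
  then show "(\<lambda>x. 0) \<in> frakM \<epsilon>" unfolding frakM_eq using gspan.zero by blast
next
  fix f f' assume "f \<in> frakM \<epsilon>" "f' \<in> frakM \<epsilon>"
  then obtain g h g' h' where m: "g \<in> gspan" "h \<in> gspan" "g' \<in> gspan" "h' \<in> gspan"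
    and f: "f = (\<lambda>x. lift \<epsilon> 0 g x + lift \<epsilon> 1 h x)" "f' = (\<lambda>x. lift \<epsilon> 0 g' x + lift \<epsilon> 1 h' x)"
    unfolding frakM_eq by blast
  have "(\<lambda>x. f x + f' x) = (\<lambda>x. lift \<epsilon> 0 (\<lambda>u. g u + g' u) x + lift \<epsilon> 1 (\<lambda>u. h u + h' u) x)"
    unfolding f lift_add by (simp add: algebra_simps)
  then show "(\<lambda>x. f x + f' x) \<in> frakM \<epsilon>"
    unfolding frakM_eq using gspan_add[OF m(1,3)] gspan_add[OF m(2,4)] by blast
next
  fix f c assume "f \<in> frakM \<epsilon>"
  then obtain g h where m: "g \<in> gspan" "h \<in> gspan" and f: "f = (\<lambda>x. lift \<epsilon> 0 g x + lift \<epsilon> 1 h x)"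
    unfolding frakM_eq by blast
  have "(\<lambda>x. c * f x) = (\<lambda>x. lift \<epsilon> 0 (\<lambda>u. c * g u) x + lift \<epsilon> 1 (\<lambda>u. c * h u) x)"
    unfolding f lift_cmult by (simp add: algebra_simps)
  then show "(\<lambda>x. c * f x) \<in> frakM \<epsilon>"
    unfolding frakM_eq using gspan_cmult[OF m(1)] gspan_cmult[OF m(2)] by blast
qed

lemma nz_subspace_frakD: "nz_subspace (frakD \<epsilon>)"
  unfolding nz_subspace_def
proof (intro conjI ballI allI frakD_add frakD_cmult)
  show "L2 f" if "f \<in> frakD \<epsilon>" for f using that by (simp add: frakD_iff)
  show "(\<lambda>x. 0) \<in> frakD \<epsilon>" "\<exists>f\<in>frakD \<epsilon>. \<not> ae_eq f (\<lambda>x. 0)"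
    using nz_subspace_frakM frakM_subset_frakD unfolding nz_subspace_def by blast+
qed

lemma h_op_frakM:
  assumes "g \<in> gspan" "h \<in> gspan"
  shows "(\<lambda>x. lift \<epsilon> 0 g x + lift \<epsilon> 1 h x,
    \<lambda>x. lift \<epsilon> 0 (h_symbol \<epsilon> 0 g) x + lift \<epsilon> 1 (h_symbol \<epsilon> 1 h) x) \<in> h_op \<epsilon>"
  using linear_ae_opD(3)[OF linear_ae_op_h_op h_op_lift[OF eps assms(1), of 0] h_op_lift[OF eps assms(2), of 1]]
  by simp

text \<open>The part with S in the second slot is \<open>artanh_lift_commutator\<close> times \<i> /
  sqrt \<epsilon>, giving -\<i>. The other part is the conjugate of the same identity with g and h
  exchanged, giving \<i>. Half their difference is -\<i>.\<close>

lemma block_form_ccr: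
  assumes g: "g \<in> gspan" and h: "h \<in> gspan" and \<sigma>: "\<sigma> \<le> 1"
  shows "block_form (S_block \<epsilon> \<sigma>) (lift \<epsilon> \<sigma> (h_symbol \<epsilon> \<sigma> g)) (lift \<epsilon> \<sigma> h)
      - block_form (S_block \<epsilon> \<sigma>) (lift \<epsilon> \<sigma> g) (lift \<epsilon> \<sigma> (h_symbol \<epsilon> \<sigma> h))
    = - \<i> * l2_inner (lift \<epsilon> \<sigma> g) (lift \<epsilon> \<sigma> h)"
proof -
  let ?K = "h_symbol \<epsilon> \<sigma>" and ?c = "\<i> * complex_of_real (1 / sqrt \<epsilon>)"
  note S = S_block_lift[OF eps _ \<sigma>]
  note lin = linear_ae_op_S_block
  have c: "?c * (- of_real (sqrt \<epsilon>)) = - \<i>" using eps by simp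
  have half: "l2_inner (lift \<epsilon> \<sigma> (?K a)) (\<lambda>x. ?c * artanh_lift \<epsilon> \<sigma> b x)
      - l2_inner (lift \<epsilon> \<sigma> a) (\<lambda>x. ?c * artanh_lift \<epsilon> \<sigma> (?K b) x) = - \<i> * l2_inner (lift \<epsilon> \<sigma> a) (lift \<epsilon> \<sigma> b)"
    if "a \<in> gspan" "b \<in> gspan" for a b
    unfolding l2_inner_cmult_right right_diff_distrib[symmetric] artanh_lift_commutator[OF eps that \<sigma>]
      mult.assoc[symmetric] c ..
  have "cnj (l2_inner (lift \<epsilon> \<sigma> (?K h)) (\<lambda>x. ?c * artanh_lift \<epsilon> \<sigma> g x)
      - l2_inner (lift \<epsilon> \<sigma> h) (\<lambda>x. ?c * artanh_lift \<epsilon> \<sigma> (?K g) x)) = \<i> * l2_inner (lift \<epsilon> \<sigma> g) (lift \<epsilon> \<sigma> h)"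
    unfolding half[OF h g] by (simp add: cnj_l2_inner)
  then have other: "l2_inner (\<lambda>x. ?c * artanh_lift \<epsilon> \<sigma> g x) (lift \<epsilon> \<sigma> (?K h))
      - l2_inner (\<lambda>x. ?c * artanh_lift \<epsilon> \<sigma> (?K g) x) (lift \<epsilon> \<sigma> h) = \<i> * l2_inner (lift \<epsilon> \<sigma> g) (lift \<epsilon> \<sigma> h)"
    by (simp only: complex_cnj_diff cnj_l2_inner)
  have "block_form (S_block \<epsilon> \<sigma>) (lift \<epsilon> \<sigma> (?K g)) (lift \<epsilon> \<sigma> h)
      - block_form (S_block \<epsilon> \<sigma>) (lift \<epsilon> \<sigma> g) (lift \<epsilon> \<sigma> (?K h))
    = ((l2_inner (lift \<epsilon> \<sigma> (?K g)) (\<lambda>x. ?c * artanh_lift \<epsilon> \<sigma> h x)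
        - l2_inner (lift \<epsilon> \<sigma> g) (\<lambda>x. ?c * artanh_lift \<epsilon> \<sigma> (?K h) x))
      - (l2_inner (\<lambda>x. ?c * artanh_lift \<epsilon> \<sigma> g x) (lift \<epsilon> \<sigma> (?K h))
        - l2_inner (\<lambda>x. ?c * artanh_lift \<epsilon> \<sigma> (?K g) x) (lift \<epsilon> \<sigma> h))) / 2"
    unfolding block_form_eq[OF lin S[OF h_symbol_gspan[OF g]] S[OF h]] block_form_eq[OF lin S[OF g] S[OF h_symbol_gspan[OF h]]]
    by (simp only: diff_divide_distrib add_divide_distrib) simp
  then show ?thesis unfolding half[OF g h] other by simp
qed

lemma l2_inner_lift_sum:
  assumes "g \<in> gspan" "h \<in> gspan" "g' \<in> gspan" "h' \<in> gspan"
  shows "l2_inner (\<lambda>x. lift \<epsilon> 0 g x + lift \<epsilon> 1 h x) (\<lambda>x. lift \<epsilon> 0 g' x + lift \<epsilon> 1 h' x)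
    = l2_inner (lift \<epsilon> 0 g) (lift \<epsilon> 0 g') + l2_inner (lift \<epsilon> 1 h) (lift \<epsilon> 1 h')"
proof -
  note L = L2_lift_0[OF eps] L2_lift_1[OF eps]
  have "l2_inner (lift \<epsilon> 0 g) (lift \<epsilon> 1 h') = 0" "l2_inner (lift \<epsilon> 1 h) (lift \<epsilon> 0 g') = 0"
    unfolding l2_inner_def by (intro integral_odd_zero; simp add: lift_minus)+
  then show ?thesis
    by (simp only: l2_inner_add_left[OF L(1)[OF assms(1)] L(2)[OF assms(2)] L2_add[OF L(1)[OF assms(3)] L(2)[OF assms(4)]]]
        l2_inner_add_right[OF L(1)[OF assms(1)] L(1)[OF assms(3)] L(2)[OF assms(4)]]
        l2_inner_add_right[OF L(2)[OF assms(2)] L(1)[OF assms(3)] L(2)[OF assms(4)]] add_0_left add_0_right)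
qed

end

theorem theorem4p3:
  fixes \<epsilon> :: real
  assumes "0 < \<epsilon>" and "\<epsilon> \<le> 1"
  shows "ultra_weak_time_op (h_op \<epsilon>) (frakD \<epsilon>) (frakD \<epsilon>) (t_form \<epsilon>) (frakD \<epsilon>) (frakM \<epsilon>)"
proof -
  note eps = assms(1)
  note ME = frakM_eq[OF eps] and sub = frakM_subset_frakD[OF eps]
  \<comment> \<open>Every value of \<open>h_op\<close> on the domain is, up to a null set, the
    explicit lift, so membership and the form need to be evaluated only there.\<close>
  have h_value: "ae_eq (\<lambda>x. lift \<epsilon> 0 (h_symbol \<epsilon> 0 a) x + lift \<epsilon> 1 (h_symbol \<epsilon> 1 b) x) k \<and> L2 k"
    if "a \<in> gspan" "b \<in> gspan" "(\<lambda>x. lift \<epsilon> 0 a x + lift \<epsilon> 1 b x, k) \<in> h_op \<epsilon>" for a b k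
    using linear_ae_opD(6)[OF linear_ae_op_h_op h_op_frakM[OF eps that(1,2)] that(3) ae_eq_refl]
      linear_ae_opD(2)[OF linear_ae_op_h_op that(3)] by blast
  have h_image: "(\<lambda>x. lift \<epsilon> 0 (h_symbol \<epsilon> 0 a) x + lift \<epsilon> 1 (h_symbol \<epsilon> 1 b) x) \<in> frakD \<epsilon>"
    if "a \<in> gspan" "b \<in> gspan" for a b
    using sub h_symbol_gspan[OF that(1)] h_symbol_gspan[OF that(2)] unfolding ME by blast
  have h_range: "k \<in> frakD \<epsilon>" if m: "\<phi> \<in> frakM \<epsilon>" "(\<phi>, k) \<in> h_op \<epsilon>" for \<phi> k
  proof -
    obtain a b where ab: "a \<in> gspan" "b \<in> gspan" "\<phi> = (\<lambda>x. lift \<epsilon> 0 a x + lift \<epsilon> 1 b x)"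
      using m(1) unfolding ME by blast
    show ?thesis
      using frakD_ae_cong[OF h_image[OF ab(1,2)]] h_value[OF ab(1,2)] m(2) ab(3) by blast
  qed
  have ccr: "t_form \<epsilon> g \<psi> - cnj (t_form \<epsilon> k \<phi>) = - \<i> * l2_inner \<phi> \<psi>"
    if m: "\<phi> \<in> frakM \<epsilon>" "\<psi> \<in> frakM \<epsilon>" "(\<phi>, g) \<in> h_op \<epsilon>" "(\<psi>, k) \<in> h_op \<epsilon>" for \<phi> \<psi> g k
  proof -
    obtain a b where ab: "a \<in> gspan" "b \<in> gspan" "\<phi> = (\<lambda>x. lift \<epsilon> 0 a x + lift \<epsilon> 1 b x)"
      using m(1) unfolding ME by blast
    obtain c d where cd: "c \<in> gspan" "d \<in> gspan" "\<psi> = (\<lambda>x. lift \<epsilon> 0 c x + lift \<epsilon> 1 d x)"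
      using m(2) unfolding ME by blast
    have \<phi>D: "\<phi> \<in> frakD \<epsilon>" and \<psi>D: "\<psi> \<in> frakD \<epsilon>" using m(1,2) sub by auto
    have g: "t_form \<epsilon> g \<psi> = t_form \<epsilon> (\<lambda>x. lift \<epsilon> 0 (h_symbol \<epsilon> 0 a) x + lift \<epsilon> 1 (h_symbol \<epsilon> 1 b) x) \<psi>"
      using h_value[OF ab(1,2), of g] m(3) ab(3) by (intro t_form_cong_left[OF h_image[OF ab(1,2)] \<psi>D]) auto
    have k: "t_form \<epsilon> k \<phi> = t_form \<epsilon> (\<lambda>x. lift \<epsilon> 0 (h_symbol \<epsilon> 0 c) x + lift \<epsilon> 1 (h_symbol \<epsilon> 1 d) x) \<phi>"
      using h_value[OF cd(1,2), of k] m(4) cd(3) by (intro t_form_cong_left[OF h_image[OF cd(1,2)] \<phi>D]) auto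
    \<comment> \<open>Hermitian symmetry rewrites the conjugated term as the form of \<phi> and the
      image of \<psi>, after which everything separates into the even and the odd block.\<close>
    have "t_form \<epsilon> g \<psi> - cnj (t_form \<epsilon> k \<phi>)
        = (block_form (S_block \<epsilon> 0) (lift \<epsilon> 0 (h_symbol \<epsilon> 0 a)) (lift \<epsilon> 0 c)
            - block_form (S_block \<epsilon> 0) (lift \<epsilon> 0 a) (lift \<epsilon> 0 (h_symbol \<epsilon> 0 c)))
        + (block_form (S_block \<epsilon> 1) (lift \<epsilon> 1 (h_symbol \<epsilon> 1 b)) (lift \<epsilon> 1 d)
            - block_form (S_block \<epsilon> 1) (lift \<epsilon> 1 b) (lift \<epsilon> 1 (h_symbol \<epsilon> 1 d)))"
      unfolding g k cnj_t_form unfolding ab(3) cd(3) t_form_block_form parts_lift[OF eps] by simp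
    also have "\<dots> = - \<i> * (l2_inner (lift \<epsilon> 0 a) (lift \<epsilon> 0 c) + l2_inner (lift \<epsilon> 1 b) (lift \<epsilon> 1 d))"
      using block_form_ccr[OF eps ab(1) cd(1), of 0] block_form_ccr[OF eps ab(2) cd(2), of 1]
      by (simp add: distrib_left)
    also have "\<dots> = - \<i> * l2_inner \<phi> \<psi>"
      unfolding ab(3) cd(3) l2_inner_lift_sum[OF eps ab(1,2) cd(1,2)] ..
    finally show ?thesis .
  qed
  have dom: "frakM \<epsilon> \<subseteq> Domain (h_op \<epsilon>) \<inter> frakD \<epsilon>"
    using sub h_op_frakM[OF eps] unfolding ME by blast
  show ?thesis
    unfolding ultra_weak_time_op_def
    using nz_subspace_frakD[OF eps] nz_subspace_frakM[OF eps] sesquilinear_t_form sub dom h_range ccr cnj_t_form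
    by (intro conjI ballI allI impI) auto
qed

end
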